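(* Let $d\ge 1$ and let $\bm{z}_1,\dots,\bm{z}_n\in\mathbb{R}^d$ be points that arrive one at a time in a stream, and let $Z=\mathrm{conv}\{\bm{z}_1,\dots,\bm{z}_n\}$. Suppose the algorithm is given, before the stream starts, a center $\bm{c}_0\in\mathbb{R}^d$ and a radius $r_0>0$ for which it is guaranteed that $\bm{c}_0+r_0\cdot B_2^d\subseteq Z$. Then there exists a streaming algorithm that, for every timestep $t$, maintains an origin-centered ellipsoid $\mathcal{E}_t$, a center $\bm{c}_t\in\mathbb{R}^d$ and a scaling factor $\alpha_t\in(0,1]$ such that at every timestep $t$, \[\mathrm{conv}\{\bm{z}_1,\dots,\bm{z}_t\}\subseteq \bm{c}_t+\mathcal{E}_t,\] and at timestep $n$, \[\bm{c}_n+\alpha_n\cdot\mathcal{E}_n\subseteq Z\subseteq \bm{c}_n+\mathcal{E}_n,\qquad\text{where}\qquad \frac{1}{\alpha_n}=O\!\left(\min\!\left(\frac{R(Z)}{r_0},\ d\log\frac{R(Z)}{r_0}\right)\right).\] The algorithm runs in time $\widetilde{O}(nd^2)$ and stores $O(d^2)$ floating point numbers.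
   Context: $B_2^d=\{\bm{x}\in\mathbb{R}^d:\|\bm{x}\|_2\le 1\}$ is the Euclidean unit ball. An origin-centered ellipsoid is a set of the form $\{\bm{x}:\|\mathbf{A}\bm{x}\|_2\le 1\}$ for a nonsingular matrix $\mathbf{A}\in\mathbb{R}^{d\times d}$. For a convex body $K\subset\mathbb{R}^d$, the circumradius $R(K)$ is the smallest $R$ such that there is a point $\bm{c}$ with $K\subseteq \bm{c}+R\cdot B_2^d$. In the streaming model the algorithm receives $\bm{z}_1,\dots,\bm{z}_n$ one at a time, updates its output after each point, and need not know $n$ in advance. The $O(\cdot)$ hides absolute constants; $\widetilde{O}$ additionally hides logarithmic factors.
   Formalization: The bound on 1/α_n is O(max(1, min(R(Z)/r_0, d log(R(Z)/r_0)))): without the max it fails when R(Z)/r_0 is near 1, e.g. d=1 and Z equal to the given ball, where the logarithm is 0 but α_n ≤ 1 forces 1/α_n ≥ 1. *)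

theory Defs
  imports Complex_Main "Jordan_Normal_Form.Matrix"
begin

section \<open>Euclidean geometry in dimension \<open>d\<close>\<close>

text \<open>
  One program has to serve every dimension, so \<open>d\<close> is quantified inside the theorem and cannot be
  a type. Points are vectors in \<^term>\<open>carrier_vec d\<close>.
\<close>

definition enorm :: "real vec \<Rightarrow> real" where
  "enorm x = sqrt (x \<bullet> x)"

definition unit_ball :: "nat \<Rightarrow> real vec set" where
  "unit_ball d = {x \<in> carrier_vec d. enorm x \<le> 1}"

definition translate :: "real vec \<Rightarrow> real vec set \<Rightarrow> real vec set" where
  "translate c S = (\<lambda>x. c + x) ` S"

definition dilate :: "real \<Rightarrow> real vec set \<Rightarrow> real vec set" where
  "dilate r S = (\<lambda>x. r \<cdot>\<^sub>v x) ` S"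

definition ellipsoid :: "nat \<Rightarrow> real mat \<Rightarrow> real vec set" where
  "ellipsoid d A = {x \<in> carrier_vec d. enorm (A *\<^sub>v x) \<le> 1}"

definition conv :: "nat \<Rightarrow> real vec list \<Rightarrow> real vec set" where
  "conv d zs = {vec d (\<lambda>j. \<Sum>i<length zs. w i * (zs ! i) $ j) |w.
     (\<forall>i<length zs. 0 \<le> w i) \<and> (\<Sum>i<length zs. w i) = (1::real)}"

definition circumradius :: "nat \<Rightarrow> real vec set \<Rightarrow> real" where
  "circumradius d K =
     Inf {R. 0 \<le> R \<and> (\<exists>c \<in> carrier_vec d. K \<subseteq> translate c (dilate R (unit_ball d)))}"


section \<open>Real random access machine\<close>

text \<open>
  A while language over exact real numbers. Real arithmetic, square roots and comparisons have unit
  cost, and the only real literals are integers. Real memory is organised in named two-dimensional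
  arrays (vectors use column \<open>0\<close>, scalars use cell \<open>(0, 0)\<close>); the index expressions
  addressing it are built from finitely many integer registers. These registers support only
  copying, successor and comparison, so that after \<open>T\<close> steps their values are linear in
  \<open>T + d\<close>, and no real number can be packed into them. Division by \<open>0\<close> yields \<open>0\<close> and
  \<^term>\<open>sqrt (- x)\<close> is \<^term>\<open>- sqrt x\<close>, as in HOL; a program can test for both cases anyway.
\<close>

datatype arr = Point | Center0 | Radius0 | OutMatrix | OutCenter | OutAlpha | Work nat

datatype ireg = Dim | Reg nat

datatype iexp = IConst nat | IVar ireg | ISuc iexp

datatype rexp =
    RConst int
  | Cell arr iexp iexp
  | Add rexp rexp
  | Sub rexp rexp
  | Mul rexp rexp
  | Div rexp rexp
  | Sqrt rexp

datatype bexp =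
    RLess rexp rexp
  | ILess iexp iexp
  | Not bexp
  | And bexp bexp

datatype com =
    Skip
  | IAssign ireg iexp
  | RAssign arr iexp iexp rexp
  | Seq com com
  | If bexp com com
  | While bexp com

text \<open>
  The real memory is a partial map: its domain consists of the cells that have been written so far.
  Cells that have never been written read as \<open>0\<close>.
\<close>

type_synonym cell = "arr \<times> nat \<times> nat"
type_synonym state = "(ireg \<Rightarrow> nat) \<times> (cell \<Rightarrow> real option)"

fun load :: "state \<Rightarrow> cell \<Rightarrow> real" where
  "load (\<rho>, m) a = (case m a of None \<Rightarrow> 0 | Some x \<Rightarrow> x)"

fun ival :: "iexp \<Rightarrow> state \<Rightarrow> nat" where
  "ival (IConst n) s = n"
| "ival (IVar r) s = fst s r"
| "ival (ISuc e) s = Suc (ival e s)"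

fun rval :: "rexp \<Rightarrow> state \<Rightarrow> real" where
  "rval (RConst n) s = of_int n"
| "rval (Cell a i j) s = load s (a, ival i s, ival j s)"
| "rval (Add e f) s = rval e s + rval f s"
| "rval (Sub e f) s = rval e s - rval f s"
| "rval (Mul e f) s = rval e s * rval f s"
| "rval (Div e f) s = rval e s / rval f s"
| "rval (Sqrt e) s = sqrt (rval e s)"

fun bval :: "bexp \<Rightarrow> state \<Rightarrow> bool" where
  "bval (RLess e f) s \<longleftrightarrow> rval e s < rval f s"
| "bval (ILess i j) s \<longleftrightarrow> ival i s < ival j s"
| "bval (Not b) s \<longleftrightarrow> \<not> bval b s"
| "bval (And b c) s \<longleftrightarrow> bval b s \<and> bval c s"

fun icost :: "iexp \<Rightarrow> nat" where
  "icost (IConst n) = 1"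
| "icost (IVar r) = 1"
| "icost (ISuc e) = icost e + 1"

fun rcost :: "rexp \<Rightarrow> nat" where
  "rcost (RConst n) = 1"
| "rcost (Cell a i j) = icost i + icost j + 1"
| "rcost (Add e f) = rcost e + rcost f + 1"
| "rcost (Sub e f) = rcost e + rcost f + 1"
| "rcost (Mul e f) = rcost e + rcost f + 1"
| "rcost (Div e f) = rcost e + rcost f + 1"
| "rcost (Sqrt e) = rcost e + 1"

fun bcost :: "bexp \<Rightarrow> nat" where
  "bcost (RLess e f) = rcost e + rcost f + 1"
| "bcost (ILess i j) = icost i + icost j + 1"
| "bcost (Not b) = bcost b + 1"
| "bcost (And b c) = bcost b + bcost c + 1"

text \<open>\<open>exec c s t s'\<close>: started in \<open>s\<close>, the program \<open>c\<close> halts in \<open>s'\<close> after \<open>t\<close> steps.\<close>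

inductive exec :: "com \<Rightarrow> state \<Rightarrow> nat \<Rightarrow> state \<Rightarrow> bool" where
  exec_Skip: "exec Skip s 1 s"
| exec_IAssign: "exec (IAssign r e) (\<rho>, m) (icost e + 1) (\<rho>(r := ival e (\<rho>, m)), m)"
| exec_RAssign: "exec (RAssign a i j e) (\<rho>, m) (icost i + icost j + rcost e + 1)
    (\<rho>, m((a, ival i (\<rho>, m), ival j (\<rho>, m)) \<mapsto> rval e (\<rho>, m)))"
| exec_Seq: "exec c1 s t1 s' \<Longrightarrow> exec c2 s' t2 s'' \<Longrightarrow> exec (Seq c1 c2) s (t1 + t2) s''"
| exec_IfTrue: "bval b s \<Longrightarrow> exec c1 s t s' \<Longrightarrow> exec (If b c1 c2) s (bcost b + t) s'"
| exec_IfFalse: "\<not> bval b s \<Longrightarrow> exec c2 s t s' \<Longrightarrow> exec (If b c1 c2) s (bcost b + t) s'"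
| exec_WhileFalse: "\<not> bval b s \<Longrightarrow> exec (While b c) s (bcost b) s"
| exec_WhileTrue: "bval b s \<Longrightarrow> exec c s t1 s' \<Longrightarrow> exec (While b c) s' t2 s'' \<Longrightarrow>
    exec (While b c) s (bcost b + t1 + t2) s''"

inductive_cases exec_cases:
  "exec Skip s t s'" "exec (IAssign r e) s t s'" "exec (RAssign a i j e) s t s'"
  "exec (Seq c1 c2) s t s'" "exec (If b c1 c2) s t s'" "exec (While b c) s t s'"

lemma exec_deterministic:
  "exec c s t s' \<Longrightarrow> exec c s u s'' \<Longrightarrow> t = u \<and> s' = s''"
proof (induction arbitrary: u s'' rule: exec.induct)
  case (exec_Skip s)
  then show ?case by (rule exec_cases(1)) simp
next
  case (exec_IAssign r e \<rho> m)
  then show ?case by (rule exec_cases(2)) simp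
next
  case (exec_RAssign a i j e \<rho> m)
  then show ?case by (rule exec_cases(3)) simp
next
  case (exec_Seq c1 s t1 s1 c2 t2 s2)
  from exec_Seq.prems obtain v1 x1 v2 where
    v: "exec c1 s v1 x1" "exec c2 x1 v2 s''" "u = v1 + v2" by (rule exec_cases(4))
  have "t1 = v1 \<and> s1 = x1" by (rule exec_Seq.IH(1)[OF v(1)])
  then show ?case using exec_Seq.IH(2) v by simp
next
  case (exec_IfTrue b s c1 t s1 c2)
  from exec_IfTrue.prems obtain v where "exec c1 s v s''" "u = bcost b + v"
    by (rule exec_cases(5)) (simp_all add: exec_IfTrue.hyps(1))
  then show ?case using exec_IfTrue.IH by simp
next
  case (exec_IfFalse b s c2 t s1 c1)
  from exec_IfFalse.prems obtain v where "exec c2 s v s''" "u = bcost b + v"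
    by (rule exec_cases(5)) (simp_all add: exec_IfFalse.hyps(1))
  then show ?case using exec_IfFalse.IH by simp
next
  case (exec_WhileFalse b s c)
  from exec_WhileFalse.prems show ?case
    by (rule exec_cases(6)) (simp_all add: exec_WhileFalse.hyps(1))
next
  case (exec_WhileTrue b s c t1 s1 t2 s2)
  from exec_WhileTrue.prems obtain v1 x1 v2 where
    v: "exec c s v1 x1" "exec (While b c) x1 v2 s''" "u = bcost b + v1 + v2"
    by (rule exec_cases(6)) (simp_all add: exec_WhileTrue.hyps(1))
  have "t1 = v1 \<and> s1 = x1" by (rule exec_WhileTrue.IH(1)[OF v(1)])
  then show ?case using exec_WhileTrue.IH(2) v by simp
qed


section \<open>Streaming algorithms\<close>

text \<open>
  A streaming algorithm consists of a program run once before the stream starts, when only \<open>d\<close>,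
  \<open>c\<^sub>0\<close> and \<open>r\<^sub>0\<close> are in memory, and a program run after the arrival of each point. An
  arriving point overwrites its predecessor in the array \<^const>\<open>Point\<close>, so earlier points are
  accessible only as far as the programs have stored information about them in memory.
\<close>

definition start_state :: "nat \<Rightarrow> real vec \<Rightarrow> real \<Rightarrow> state" where
  "start_state d c0 r0 =
     ((\<lambda>r. if r = Dim then d else 0),
      (\<lambda>(a, i, j). if a = Center0 \<and> i < d \<and> j = 0 then Some (c0 $ i)
                   else if a = Radius0 \<and> i = 0 \<and> j = 0 then Some r0 else None))"

definition receive :: "nat \<Rightarrow> real vec \<Rightarrow> state \<Rightarrow> state" where
  "receive d z = (\<lambda>(\<rho>, m).
     (\<rho>, (\<lambda>(a, i, j). if a = Point \<and> i < d \<and> j = 0 then Some (z $ i) else m (a, i, j))))"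

text \<open>
  \<open>stream_run P Q d c\<^sub>0 r\<^sub>0 zs s T\<close>: with initialisation \<open>P\<close> and update \<open>Q\<close>, state \<open>s\<close> is
  reached in total time \<open>T\<close> once exactly the points \<open>zs\<close> have been processed. Receiving input
  costs one step per real number.
\<close>

inductive stream_run ::
  "com \<Rightarrow> com \<Rightarrow> nat \<Rightarrow> real vec \<Rightarrow> real \<Rightarrow> real vec list \<Rightarrow> state \<Rightarrow> nat \<Rightarrow> bool"
  for P Q d c0 r0 where
  stream_init: "exec P (start_state d c0 r0) t s \<Longrightarrow>
    stream_run P Q d c0 r0 [] s (d + 1 + t)"
| stream_step: "stream_run P Q d c0 r0 zs s T \<Longrightarrow> exec Q (receive d z s) t s' \<Longrightarrow>
    stream_run P Q d c0 r0 (zs @ [z]) s' (T + d + t)"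

lemma stream_run_deterministic:
  "stream_run P Q d c0 r0 zs s T \<Longrightarrow> stream_run P Q d c0 r0 zs s' T' \<Longrightarrow> s = s' \<and> T = T'"
proof (induction arbitrary: s' T' rule: stream_run.induct)
  case (stream_init t s)
  from stream_init.prems obtain t' where t': "exec P (start_state d c0 r0) t' s'" "T' = d + 1 + t'"
    by (cases rule: stream_run.cases) simp_all
  show ?case using exec_deterministic[OF stream_init.hyps t'(1)] t'(2) by simp
next
  case (stream_step zs s T z t s1)
  from stream_step.prems obtain s2 T2 t2 where
    u: "stream_run P Q d c0 r0 zs s2 T2" "exec Q (receive d z s2) t2 s'" "T' = T2 + d + t2"
    by (cases rule: stream_run.cases) simp_all
  have e: "s = s2 \<and> T = T2" by (rule stream_step.IH[OF u(1)])
  show ?case using exec_deterministic[of Q "receive d z s" t s1 t2 s'] stream_step.hyps(2) u e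
    by simp
qed

definition out_matrix :: "nat \<Rightarrow> state \<Rightarrow> real mat" where
  "out_matrix d s = mat d d (\<lambda>(i, j). load s (OutMatrix, i, j))"

definition out_ellipsoid :: "nat \<Rightarrow> state \<Rightarrow> real vec set" where
  "out_ellipsoid d s = ellipsoid d (out_matrix d s)"

definition out_center :: "nat \<Rightarrow> state \<Rightarrow> real vec" where
  "out_center d s = vec d (\<lambda>i. load s (OutCenter, i, 0))"

definition out_alpha :: "state \<Rightarrow> real" where
  "out_alpha s = load s (OutAlpha, 0, 0)"

text \<open>
  Cells are never deallocated, so the number of allocated cells bounds the storage used at any
  earlier moment, including moments inside an update.
\<close>

definition storage :: "state \<Rightarrow> nat" where
  "storage s = card (dom (snd s))"

lemma exec_dom_mono: "exec c s t s' \<Longrightarrow> dom (snd s) \<subseteq> dom (snd s')"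
  by (induction rule: exec.induct) auto

lemma exec_finite_dom: "exec c s t s' \<Longrightarrow> finite (dom (snd s)) \<Longrightarrow> finite (dom (snd s'))"
  by (induction rule: exec.induct) (simp_all del: fun_upd_apply)

lemma finite_dom_start_state: "finite (dom (snd (start_state d c0 r0)))"
  by (rule finite_subset[of _ "(\<lambda>i. (Center0, i, 0)) ` {..<d} \<union> {(Radius0, 0, 0)}"])
    (auto simp: start_state_def split: if_splits)

lemma finite_dom_receive: "finite (dom (snd s)) \<Longrightarrow> finite (dom (snd (receive d z s)))"
  by (rule finite_subset[of _ "(\<lambda>i. (Point, i, 0)) ` {..<d} \<union> dom (snd s)"])
    (auto simp: receive_def split: if_splits prod.splits)

lemma stream_run_finite_dom: "stream_run P Q d c0 r0 zs s T \<Longrightarrow> finite (dom (snd s))"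
  by (induction rule: stream_run.induct)
    (blast intro: exec_finite_dom finite_dom_start_state finite_dom_receive)+

end

theory Submission
  imports Defs "Jordan_Normal_Form.Determinant" "HOL-Analysis.Convex"
begin

text \<open>
  The program keeps \<open>M\<close>, \<open>c\<close> and \<open>\<alpha>\<close> such that all points received so far lie in \<open>c + E\<close> and
  \<open>c + \<alpha> E \<subseteq> Z\<close>, where \<open>E = {x. \<bar>M x\<bar> \<le> 1}\<close>. Let \<open>l > 1\<close> be the norm of a new point relative
  to \<open>c + E\<close>. There are two ways to absorb it. Scaling \<open>E\<close> by \<open>l\<close> and dividing \<open>\<alpha>\<close> by \<open>l\<close>
  keeps a ball around \<open>c\<^sub>0\<close>, and then \<open>1 / \<alpha> \<le> max 4 (2 R / r\<^sub>0)\<close>. Alternatively \<open>E\<close> is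
  stretched by a factor \<open>a\<close> towards the point, slightly widened across, and the center moved, with
  \<open>1 / \<alpha>' = 1 / \<alpha> + 4 (l - 1) / (l + \<alpha>) \<le> 1 / \<alpha> + 4 ln a\<close>, so that \<open>1 / \<alpha>\<close> is paid for by the
  logarithm of the volume of \<open>E\<close>. As \<open>c + \<alpha> E \<subseteq> Z\<close> bounds this volume, this leads to
  \<open>1 / \<alpha> = O(d (ln (R / r\<^sub>0) + ln d + ln (1 / \<alpha>)))\<close>. The program uses balls while \<open>1 / \<alpha>\<close> is at
  most \<open>4 + d (1 + 1/2 + \<dots> + 1/d)\<close>, and stretches afterwards. The threshold has order \<open>d ln d\<close>, where
  \<open>R / r\<^sub>0\<close> and \<open>d ln (R / r\<^sub>0)\<close> cross, and beyond it \<open>ln d\<close> is dominated by \<open>ln (R / r\<^sub>0)\<close>.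
\<close>

section \<open>Stretching the unit ball towards a point\<close>

definition shrink :: "real \<Rightarrow> real \<Rightarrow> real" where
  "shrink \<alpha> l = 1 / (1 / \<alpha> + 4 * ((l - 1) / (l + \<alpha>)))"

definition long_axis :: "real \<Rightarrow> real \<Rightarrow> real" where
  "long_axis \<alpha> l = (l + \<alpha>) / (1 + shrink \<alpha> l)"

definition short_axis :: "real \<Rightarrow> real \<Rightarrow> real" where
  "short_axis \<alpha> l = sqrt (1 + 2 * (shrink \<alpha> l)\<^sup>2 * (1 - 1 / long_axis \<alpha> l))"

locale growth =
  fixes \<alpha> l \<beta> a b :: real
  assumes alpha: "0 < \<alpha>" "\<alpha> \<le> 1 / 4" and l: "1 \<le> l"
    and beta_def: "\<beta> = shrink \<alpha> l"
    and a_def: "a = long_axis \<alpha> l"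
    and b_def: "b = short_axis \<alpha> l"
begin

lemma inverse_beta: "1 / \<beta> = 1 / \<alpha> + 4 * ((l - 1) / (l + \<alpha>))"
  by (simp add: beta_def shrink_def)

lemma tau_bounds: "0 \<le> (l - 1) / (l + \<alpha>)" "(l - 1) / (l + \<alpha>) \<le> 1"
  using alpha l by simp_all

lemma beta: "0 < \<beta>" "\<beta> \<le> \<alpha>"
proof -
  have "0 < 1 / \<alpha>" using alpha by simp
  then have *: "1 / \<alpha> \<le> 1 / \<beta>" "0 < 1 / \<beta>" using tau_bounds inverse_beta by linarith+
  then show p: "0 < \<beta>" by simp
  show "\<beta> \<le> \<alpha>" using *(1) p alpha by (simp add: field_simps)
qed

lemma alpha_eq: "\<alpha> = \<beta> * (1 + 4 * \<alpha> * ((l - 1) / (l + \<alpha>)))"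
proof -
  have "\<alpha> * (\<beta> * (1 / \<beta>)) = \<alpha> * (\<beta> * (1 / \<alpha> + 4 * ((l - 1) / (l + \<alpha>))))"
    by (simp only: inverse_beta)
  also have "\<dots> = \<beta> * (\<alpha> * (1 / \<alpha>) + 4 * \<alpha> * ((l - 1) / (l + \<alpha>)))"
    by (simp only: algebra_simps)
  finally show ?thesis using alpha beta by simp
qed

lemma l_eq: "l = (1 + \<beta>) * a - \<alpha>"
  using beta by (simp add: a_def long_axis_def beta_def field_simps)

lemma a_ge: "1 \<le> a"
proof -
  have "1 * (1 + \<beta>) \<le> l + \<alpha>" using l beta by simp
  also have "\<dots> = a * (1 + \<beta>)" using l_eq by (simp add: mult.commute)
  finally have "1 * (1 + \<beta>) \<le> a * (1 + \<beta>)" .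
  then show ?thesis using beta by (simp add: mult_le_cancel_right)
qed

lemma sigma: "(l - 1) / (l + \<alpha>) \<le> 1 - 1 / a" "1 - 1 / a \<le> 3 / 2 * ((l - 1) / (l + \<alpha>))"
proof -
  have e: "1 - 1 / a = (l - 1) / (l + \<alpha>) + (\<alpha> - \<beta>) / (l + \<alpha>)"
  proof -
    have "1 / a = (1 + \<beta>) / (l + \<alpha>)" by (simp add: a_def long_axis_def beta_def)
    moreover have "(l - 1) / (l + \<alpha>) + (\<alpha> - \<beta>) / (l + \<alpha>) = (l + \<alpha> - (1 + \<beta>)) / (l + \<alpha>)"
      unfolding add_divide_distrib[symmetric] by (simp add: algebra_simps)
    ultimately show ?thesis using alpha l by (simp add: diff_divide_distrib)
  qed
  show "(l - 1) / (l + \<alpha>) \<le> 1 - 1 / a" using e alpha l beta by simp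
  let ?t = "(l - 1) / (l + \<alpha>)"
  have "\<alpha> - \<beta> = \<beta> * (4 * \<alpha>) * ?t" using alpha_eq by (simp add: algebra_simps)
  also have "\<dots> \<le> 1 / 4 * ?t"
    using alpha beta tau_bounds mult_mono[of \<beta> "1/4" "4 * \<alpha>" 1] by (intro mult_right_mono) auto
  finally have "\<alpha> - \<beta> \<le> 1 / 4 * ?t" .
  moreover have "(\<alpha> - \<beta>) / (l + \<alpha>) \<le> \<alpha> - \<beta>"
    using alpha l beta divide_left_mono[of 1 "l + \<alpha>" "\<alpha> - \<beta>"] by simp
  ultimately show "1 - 1 / a \<le> 3 / 2 * ?t" using e tau_bounds by linarith
qed

lemma tau_le_ln: "(l - 1) / (l + \<alpha>) \<le> ln a"
proof -
  have "ln (1 / a) \<le> 1 / a - 1" using a_ge by (intro ln_le_minus_one) auto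
  then show ?thesis using sigma(1) a_ge by (simp add: ln_div)
qed

lemma b_sq: "b\<^sup>2 = 1 + 2 * \<beta>\<^sup>2 * (1 - 1 / a)"
  using a_ge by (simp add: b_def short_axis_def a_def beta_def)

lemma beta_sq: "\<beta>\<^sup>2 \<le> 1 / 16" "0 < \<beta>\<^sup>2"
  using beta alpha power_mono[of \<beta> "1/4" 2] by (auto simp: power_divide)

lemma b_ge: "1 \<le> b" "b \<le> a" "b\<^sup>2 \<le> a"
proof -
  have "0 \<le> 2 * \<beta>\<^sup>2 * (1 - 1 / a)" using a_ge by simp
  then show b1: "1 \<le> b" unfolding b_def short_axis_def a_def[symmetric] beta_def[symmetric] by simp
  have "2 * \<beta>\<^sup>2 * (1 - 1 / a) \<le> 1 * (1 - 1 / a)"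
    using a_ge beta_sq by (intro mult_right_mono) auto
  also have "\<dots> \<le> a * (1 - 1 / a)" using a_ge by (intro mult_right_mono) auto
  also have "\<dots> = a - 1" using a_ge by (simp add: right_diff_distrib)
  finally show ba: "b\<^sup>2 \<le> a" using b_sq by simp
  have "b * 1 \<le> b * b" using b1 by (intro mult_left_mono) auto
  then show "b \<le> a" using ba by (simp add: power2_eq_square)
qed

lemma outer_condition: "(l - a)\<^sup>2 * b\<^sup>2 \<le> (b\<^sup>2 - 1) * (a\<^sup>2 - b\<^sup>2)"
proof -
  define s where "s = a - 1"
  define e where "e = 2 * \<beta>\<^sup>2 * (s / a)"
  have s0: "0 \<le> s" and as: "a = 1 + s" using a_ge by (auto simp: s_def)
  have sa: "1 - 1 / a = s / a" using a_ge by (simp add: s_def field_simps)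
  have b2: "b\<^sup>2 = 1 + e" using b_sq sa by (simp add: e_def)
  have e0: "0 \<le> e" using s0 as by (simp add: e_def)
  have ea: "e * a = 2 * \<beta>\<^sup>2 * s" using a_ge by (simp add: e_def)
  have e1: "e \<le> s / 8"
  proof -
    have "s / a \<le> s" using s0 as by (simp add: field_simps)
    then have "e \<le> 2 * (1/16) * s" unfolding e_def
      using beta_sq s0 as by (intro mult_mono) auto
    then show ?thesis by simp
  qed
  have c1: "l - a = \<beta> * s - (\<alpha> - \<beta>)" using l_eq by (simp add: s_def algebra_simps)
  have "\<alpha> - \<beta> = \<beta> * ((4 * \<alpha>) * ((l - 1) / (l + \<alpha>)))" using alpha_eq by (simp add: algebra_simps)
  also have "\<dots> \<le> \<beta> * (1 * (1 - 1 / a))"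
    using alpha beta sigma(1) tau_bounds by (intro mult_left_mono mult_mono) auto
  also have "\<dots> \<le> \<beta> * s"
    using beta s0 as unfolding sa by (simp add: field_simps)
  finally have c2: "0 \<le> l - a" using c1 by simp
  have c3: "l - a \<le> \<beta> * s" using c1 beta by simp
  have "(l - a)\<^sup>2 \<le> (\<beta> * s)\<^sup>2" using c2 c3 by (intro power_mono)
  then have "(l - a)\<^sup>2 * b\<^sup>2 \<le> (\<beta>\<^sup>2 * s) * (s * (1 + e))"
    using b2 e0 mult_right_mono[of "(l - a)\<^sup>2" "(\<beta> * s)\<^sup>2" "1 + e"]
    by (simp add: power_mult_distrib power2_eq_square ac_simps)
  also have "\<beta>\<^sup>2 * s = e * a / 2" using ea by simp
  also have "e * a / 2 * (s * (1 + e)) = e * ((1 + s) * (s * (1 + e)) / 2)" by (simp add: as)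
  also have "\<dots> \<le> e * (2 * s + s\<^sup>2 - e)"
  proof (rule mult_left_mono[OF _ e0])
    have "e * (s + s\<^sup>2 + 2) \<le> 3 * s + s\<^sup>2"
    proof -
      have "e * s\<^sup>2 \<le> s\<^sup>2"
      proof -
        have "e * s \<le> e * a" using e0 as by (intro mult_left_mono) auto
        also have "\<dots> \<le> 1 * s" unfolding ea using beta_sq s0 by (intro mult_right_mono) auto
        finally have "(e * s) * s \<le> s * s" using s0 by (intro mult_right_mono) auto
        then show ?thesis by (simp add: power2_eq_square mult.assoc)
      qed
      moreover have "e * s \<le> s"
      proof -
        have "e * s \<le> e * a" using e0 as by (intro mult_left_mono) auto
        also have "\<dots> \<le> 1 * s" unfolding ea using beta_sq s0 by (intro mult_right_mono) auto
        finally show ?thesis by simp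
      qed
      ultimately show ?thesis using e1 s0 by (simp add: algebra_simps)
    qed
    then have "(1 + s) * (s * (1 + e)) \<le> 2 * (2 * s + s\<^sup>2 - e)"
      by (simp add: algebra_simps power2_eq_square)
    then show "(1 + s) * (s * (1 + e)) / 2 \<le> 2 * s + s\<^sup>2 - e" by simp
  qed
  also have "\<dots> = (b\<^sup>2 - 1) * (a\<^sup>2 - b\<^sup>2)" unfolding b2 as by (simp add: power2_eq_square algebra_simps)
  finally show ?thesis .
qed

lemma inner_condition: "b\<^sup>2 * \<beta>\<^sup>2 * (l\<^sup>2 - \<alpha>\<^sup>2) \<le> \<alpha>\<^sup>2 * a\<^sup>2 * (1 - \<beta>\<^sup>2)"
proof -
  define t where "t = (l - 1) / (l + \<alpha>)"
  define g where "g = 1 - 1 / a"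
  have t0: "0 \<le> t" "t \<le> 1" using tau_bounds by (auto simp: t_def)
  have g0: "0 \<le> g" "g \<le> 3 / 2 * t" using sigma a_ge by (auto simp: g_def t_def)
  have at: "\<alpha> * t \<le> 1 / 4" using alpha t0 mult_mono[of \<alpha> "1/4" t 1] by simp
  have at0: "0 \<le> \<alpha> * t" using alpha t0 by simp
  have ag: "a * (1 - g) = 1" using a_ge by (simp add: g_def)
  have la: "l - \<alpha> = a * (1 + \<beta> - 2 * \<alpha> * (1 - g))"
  proof -
    have "a * (1 + \<beta> - 2 * \<alpha> * (1 - g)) = (1 + \<beta>) * a - 2 * \<alpha> * (a * (1 - g))"
      by (simp add: algebra_simps)
    then show ?thesis using l_eq ag by simp
  qed
  have key: "b\<^sup>2 * (1 + \<beta> - 2 * \<alpha> * (1 - g)) \<le> (1 + 4 * \<alpha> * t)\<^sup>2 * (1 - \<beta>)"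
  proof -
    have b1: "b\<^sup>2 \<le> 1 + 3 * \<beta>\<^sup>2 * t"
    proof -
      have "2 * \<beta>\<^sup>2 * g \<le> 2 * \<beta>\<^sup>2 * (3 / 2 * t)" using g0 by (intro mult_left_mono) auto
      also have "\<dots> = 3 * \<beta>\<^sup>2 * t" by simp
      finally show ?thesis using b_sq by (simp only: g_def)
    qed
    have ag2: "\<alpha> * g \<le> \<alpha> * (3 / 2 * t)" using alpha g0 by (intro mult_left_mono) auto
    have u: "1 + \<beta> - 2 * \<alpha> * (1 - g) \<le> 1 - \<beta> + 3 * (\<alpha> * t)"
    proof -
      have "2 * \<alpha> * (1 - g) = 2 * \<alpha> - 2 * (\<alpha> * g)" "\<alpha> * (3 / 2 * t) = 3 / 2 * (\<alpha> * t)"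
        by (simp_all add: algebra_simps)
      then show ?thesis using ag2 beta by linarith
    qed
    have ag0: "0 \<le> \<alpha> * g" using alpha g0 by simp
    have u0: "0 \<le> 1 + \<beta> - 2 * \<alpha> * (1 - g)"
      using alpha beta ag0 by (simp add: algebra_simps)
    have "b\<^sup>2 * (1 + \<beta> - 2 * \<alpha> * (1 - g)) \<le> (1 + 3 * \<beta>\<^sup>2 * t) * (1 - \<beta> + 3 * (\<alpha> * t))"
      using b1 u u0 t0 by (intro mult_mono) auto
    also have "\<dots> = (1 - \<beta> + 3 * (\<alpha> * t)) + 3 * \<beta>\<^sup>2 * t * (1 - \<beta> + 3 * (\<alpha> * t))"
      by (simp add: algebra_simps)
    also have "3 * \<beta>\<^sup>2 * t * (1 - \<beta> + 3 * (\<alpha> * t)) \<le> 3 / 4 * (\<alpha> * t) * (7 / 4)"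
    proof (rule mult_mono)
      have "\<beta>\<^sup>2 \<le> \<alpha> / 4"
        using mult_mono[of \<beta> \<alpha> \<beta> "1/4"] beta alpha by (simp add: power2_eq_square)
      then have "3 * \<beta>\<^sup>2 * t \<le> 3 / 4 * \<alpha> * t" using t0 by (intro mult_right_mono) auto
      then show "3 * \<beta>\<^sup>2 * t \<le> 3 / 4 * (\<alpha> * t)" by (simp only: mult.assoc)
      show "1 - \<beta> + 3 * (\<alpha> * t) \<le> 7 / 4" using at beta by simp
    qed (use at0 beta alpha in auto)
    also have "(1 - \<beta> + 3 * (\<alpha> * t)) + 3 / 4 * (\<alpha> * t) * (7 / 4)
        \<le> (1 - \<beta>) + (8 * (\<alpha> * t)) * (3 / 4)" using at0 by simp
    also have "\<dots> \<le> (1 - \<beta>) + (8 * (\<alpha> * t)) * (1 - \<beta>)"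
      using at0 alpha beta by (intro add_left_mono mult_left_mono) auto
    also have "\<dots> = (1 + 8 * (\<alpha> * t)) * (1 - \<beta>)" by (simp add: algebra_simps)
    also have "\<dots> \<le> (1 + 4 * \<alpha> * t)\<^sup>2 * (1 - \<beta>)"
      using alpha beta by (intro mult_right_mono) (auto simp: power2_eq_square algebra_simps)
    finally show ?thesis by simp
  qed
  have l2: "l\<^sup>2 - \<alpha>\<^sup>2 = (l - \<alpha>) * ((1 + \<beta>) * a)"
  proof -
    have "(1 + \<beta>) * a = l + \<alpha>" using l_eq by simp
    then show ?thesis by (simp add: power2_eq_square square_diff_square_factored mult.commute)
  qed
  have al2: "\<alpha>\<^sup>2 = \<beta>\<^sup>2 * (1 + 4 * \<alpha> * t)\<^sup>2"
    using alpha_eq by (metis t_def power_mult_distrib)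
  have "b\<^sup>2 * \<beta>\<^sup>2 * (l\<^sup>2 - \<alpha>\<^sup>2) =
      \<beta>\<^sup>2 * a\<^sup>2 * (1 + \<beta>) * (b\<^sup>2 * (1 + \<beta> - 2 * \<alpha> * (1 - g)))"
    unfolding l2 la by (simp add: power2_eq_square algebra_simps)
  also have "\<dots> \<le> \<beta>\<^sup>2 * a\<^sup>2 * (1 + \<beta>) * ((1 + 4 * \<alpha> * t)\<^sup>2 * (1 - \<beta>))"
    using key beta by (intro mult_left_mono) auto
  also have "\<dots> = (\<beta>\<^sup>2 * (1 + 4 * \<alpha> * t)\<^sup>2) * a\<^sup>2 * ((1 + \<beta>) * (1 - \<beta>))"
    by (simp only: ac_simps)
  also have "\<dots> = \<alpha>\<^sup>2 * a\<^sup>2 * (1 - \<beta>\<^sup>2)"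
    unfolding al2[symmetric] by (simp add: power2_eq_square algebra_simps)
  finally show ?thesis .
qed

end

lemma sphere_in_grown:
  fixes a b k x n :: real
  assumes "1 \<le> b" "b \<le> a" and O: "k\<^sup>2 * b\<^sup>2 \<le> (b\<^sup>2 - 1) * (a\<^sup>2 - b\<^sup>2)" and n: "n \<le> 1" "x\<^sup>2 \<le> n"
  shows "(x - k)\<^sup>2 / a\<^sup>2 + (n - x\<^sup>2) / b\<^sup>2 \<le> 1"
proof -
  have b: "0 < b\<^sup>2" "0 < a\<^sup>2" "1 \<le> b\<^sup>2" using assms by auto
  have "b\<^sup>2 * (x - k)\<^sup>2 + a\<^sup>2 * (n - x\<^sup>2) \<le> b\<^sup>2 * (x - k)\<^sup>2 + a\<^sup>2 * (1 - x\<^sup>2)"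
    using n by (simp add: mult_left_mono)
  also have "\<dots> \<le> a\<^sup>2 * b\<^sup>2"
  proof (cases "a = b")
    case True
    then have "k\<^sup>2 * b\<^sup>2 \<le> 0" using O by simp
    then have "k = 0" using b by (simp add: mult_le_0_iff)
    moreover have "b\<^sup>2 * 1 \<le> b\<^sup>2 * b\<^sup>2" using b by (intro mult_left_mono) auto
    ultimately show ?thesis using True by (simp add: algebra_simps)
  next
    case False
    then have D: "0 < a\<^sup>2 - b\<^sup>2" using assms power_strict_mono[of b a 2] by simp
    have "0 \<le> ((a\<^sup>2 - b\<^sup>2) * x + b\<^sup>2 * k)\<^sup>2 + a\<^sup>2 * ((b\<^sup>2 - 1) * (a\<^sup>2 - b\<^sup>2) - k\<^sup>2 * b\<^sup>2)"
      using O by simp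
    also have "\<dots> = (a\<^sup>2 - b\<^sup>2) * (a\<^sup>2 * b\<^sup>2 - (b\<^sup>2 * (x - k)\<^sup>2 + a\<^sup>2 * (1 - x\<^sup>2)))"
      by (simp add: power2_eq_square algebra_simps)
    finally show ?thesis using D by (simp add: zero_le_mult_iff)
  qed
  finally have "b\<^sup>2 * (x - k)\<^sup>2 + a\<^sup>2 * (n - x\<^sup>2) \<le> a\<^sup>2 * b\<^sup>2" .
  moreover have "(x - k)\<^sup>2 / a\<^sup>2 + (n - x\<^sup>2) / b\<^sup>2
      = (b\<^sup>2 * (x - k)\<^sup>2 + a\<^sup>2 * (n - x\<^sup>2)) / (a\<^sup>2 * b\<^sup>2)"
    using b by (simp add: add_divide_distrib)
  ultimately show ?thesis using b by (simp add: divide_le_eq)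
qed

lemma (in growth) drop_decomposition:
  assumes n: "x\<^sup>2 \<le> n" and grown: "(x - (l - a))\<^sup>2 / a\<^sup>2 + (n - x\<^sup>2) / b\<^sup>2 \<le> \<beta>\<^sup>2"
  shows "\<exists>\<theta>. 0 \<le> \<theta> \<and> \<theta> < 1 \<and> n - 2 * \<theta> * l * x + \<theta>\<^sup>2 * l\<^sup>2 \<le> \<alpha>\<^sup>2 * (1 - \<theta>)\<^sup>2"
proof -
  define \<xi> where "\<xi> = (x - (l - a)) / a"
  have a0: "0 < a" using a_ge by simp
  have x: "x = l - a + a * \<xi>" using a0 by (simp add: \<xi>_def)
  have b0: "0 < b\<^sup>2" using b_ge by simp
  have in': "\<xi>\<^sup>2 + (n - x\<^sup>2) / b\<^sup>2 \<le> \<beta>\<^sup>2" using grown by (simp add: \<xi>_def power_divide)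
  have "0 \<le> (n - x\<^sup>2) / b\<^sup>2" using n by simp
  then have "\<xi>\<^sup>2 \<le> \<beta>\<^sup>2" using in' by linarith
  then have xi: "\<bar>\<xi>\<bar> \<le> \<beta>" using beta by (simp add: abs_le_square_iff[symmetric])
  have Y: "n - x\<^sup>2 \<le> b\<^sup>2 * (\<beta>\<^sup>2 - \<xi>\<^sup>2)" using in' b0 by (simp add: field_simps)
  have la: "0 < l\<^sup>2 - \<alpha>\<^sup>2"
  proof -
    have "\<alpha> < l" using alpha l by linarith
    then have "\<alpha>\<^sup>2 < l\<^sup>2" using alpha by (intro power_strict_mono) auto
    then show ?thesis by simp
  qed
  have cone: "b\<^sup>2 * (\<beta>\<^sup>2 - \<eta>\<^sup>2) * (l\<^sup>2 - \<alpha>\<^sup>2) \<le> \<alpha>\<^sup>2 * a\<^sup>2 * (1 - \<eta>)\<^sup>2" for \<eta>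
  proof -
    have p: "0 < 1 - \<beta>\<^sup>2" using beta_sq by simp
    have "(\<beta>\<^sup>2 - \<eta>\<^sup>2) * (1 - \<beta>\<^sup>2) \<le> \<beta>\<^sup>2 * (1 - \<eta>)\<^sup>2"
    proof -
      have "0 \<le> (\<eta> - \<beta>\<^sup>2)\<^sup>2" by simp
      then show ?thesis by (simp add: power2_eq_square algebra_simps)
    qed
    then have "b\<^sup>2 * (l\<^sup>2 - \<alpha>\<^sup>2) * ((\<beta>\<^sup>2 - \<eta>\<^sup>2) * (1 - \<beta>\<^sup>2)) \<le> b\<^sup>2 * (l\<^sup>2 - \<alpha>\<^sup>2) * (\<beta>\<^sup>2 * (1 - \<eta>)\<^sup>2)"
      using la b0 by (intro mult_left_mono) auto
    also have "\<dots> = (b\<^sup>2 * \<beta>\<^sup>2 * (l\<^sup>2 - \<alpha>\<^sup>2)) * (1 - \<eta>)\<^sup>2" by (simp only: ac_simps)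
    also have "\<dots> \<le> (\<alpha>\<^sup>2 * a\<^sup>2 * (1 - \<beta>\<^sup>2)) * (1 - \<eta>)\<^sup>2"
      using inner_condition by (intro mult_right_mono) auto
    finally have "(1 - \<beta>\<^sup>2) * (b\<^sup>2 * (\<beta>\<^sup>2 - \<eta>\<^sup>2) * (l\<^sup>2 - \<alpha>\<^sup>2)) \<le> (1 - \<beta>\<^sup>2) * (\<alpha>\<^sup>2 * a\<^sup>2 * (1 - \<eta>)\<^sup>2)"
      by (simp only: ac_simps)
    then show ?thesis using p by (simp add: mult_le_cancel_left)
  qed
  show ?thesis
  proof (cases "x \<le> \<alpha>\<^sup>2 / l")
    case True
    define \<xi>0 where "\<xi>0 = (\<alpha>\<^sup>2 / l - (l - a)) / a"
    have x0: "\<alpha>\<^sup>2 / l = l - a + a * \<xi>0" using a0 by (simp add: \<xi>0_def)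
    have le: "\<xi> \<le> \<xi>0" using True a0 by (simp add: \<xi>_def \<xi>0_def divide_right_mono)
    have fac: "(l - a + a * \<eta>)\<^sup>2 + b\<^sup>2 * (\<beta>\<^sup>2 - \<eta>\<^sup>2) - \<alpha>\<^sup>2
        = (\<eta> + \<beta>) * (a * (l - a + a * \<eta> - \<alpha>) + b\<^sup>2 * (\<beta> - \<eta>))" for \<eta>
    proof -
      have "l - a + a * \<eta> + \<alpha> = a * (\<eta> + \<beta>)" using l_eq by (simp add: algebra_simps)
      then have "(l - a + a * \<eta>)\<^sup>2 - \<alpha>\<^sup>2 = (a * (\<eta> + \<beta>)) * (l - a + a * \<eta> - \<alpha>)"
        using square_diff_square_factored[of "l - a + a * \<eta>" \<alpha>] by (simp only: power2_eq_square)
      then show ?thesis by (simp add: power2_eq_square algebra_simps)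
    qed
    have "a * (\<xi>0 + \<beta>) = \<alpha>\<^sup>2 / l + \<alpha>"
      unfolding x0 using l_eq by (simp add: algebra_simps)
    also have "\<dots> > 0" using alpha l by (simp add: add_pos_pos)
    finally have pos: "0 < \<xi>0 + \<beta>" using a0 by (simp add: zero_less_mult_iff)
    have "(l - a + a * \<xi>0)\<^sup>2 + b\<^sup>2 * (\<beta>\<^sup>2 - \<xi>0\<^sup>2) - \<alpha>\<^sup>2 \<le> 0"
    proof -
      have "a * (1 - \<xi>0) = l - \<alpha>\<^sup>2 / l" using x0 by (simp add: algebra_simps)
      also have "\<dots> = (l\<^sup>2 - \<alpha>\<^sup>2) / l" using l by (simp add: field_simps power2_eq_square)
      finally have e: "a\<^sup>2 * (1 - \<xi>0)\<^sup>2 = ((l\<^sup>2 - \<alpha>\<^sup>2) / l)\<^sup>2" by (metis power_mult_distrib)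
      have "b\<^sup>2 * (\<beta>\<^sup>2 - \<xi>0\<^sup>2) * (l\<^sup>2 - \<alpha>\<^sup>2) \<le> \<alpha>\<^sup>2 * (a\<^sup>2 * (1 - \<xi>0)\<^sup>2)" using cone[of \<xi>0] by (simp only: ac_simps)
      also have "\<dots> = (\<alpha>\<^sup>2 * ((l\<^sup>2 - \<alpha>\<^sup>2) / l\<^sup>2)) * (l\<^sup>2 - \<alpha>\<^sup>2)" unfolding e by (simp add: power2_eq_square)
      finally have "b\<^sup>2 * (\<beta>\<^sup>2 - \<xi>0\<^sup>2) \<le> \<alpha>\<^sup>2 * ((l\<^sup>2 - \<alpha>\<^sup>2) / l\<^sup>2)"
        using la by (rule mult_right_le_imp_le)
      also have "\<dots> = \<alpha>\<^sup>2 - (\<alpha>\<^sup>2 / l)\<^sup>2" using l by (simp add: field_simps power2_eq_square)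
      finally show ?thesis using x0 by simp
    qed
    then have L0: "a * (l - a + a * \<xi>0 - \<alpha>) + b\<^sup>2 * (\<beta> - \<xi>0) \<le> 0"
      unfolding fac using pos by (simp add: mult_le_0_iff)
    have "0 \<le> (a\<^sup>2 - b\<^sup>2) * (\<xi>0 - \<xi>)" using le b_ge by simp
    then have L: "a * (l - a + a * \<xi> - \<alpha>) + b\<^sup>2 * (\<beta> - \<xi>) \<le> 0"
      using L0 by (simp add: algebra_simps power2_eq_square)
    have "n \<le> \<alpha>\<^sup>2"
    proof -
      have "(\<xi> + \<beta>) * (a * (l - a + a * \<xi> - \<alpha>) + b\<^sup>2 * (\<beta> - \<xi>)) \<le> 0"
        using L xi by (intro mult_nonneg_nonpos) auto
      then show ?thesis using Y fac[of \<xi>] x by simp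
    qed
    then show ?thesis by (intro exI[of _ 0]) auto
  next
    case False
    define \<theta> where "\<theta> = (l * x - \<alpha>\<^sup>2) / (l\<^sup>2 - \<alpha>\<^sup>2)"
    have "0 \<le> l * x - \<alpha>\<^sup>2" using False l by (simp add: field_simps)
    then have t0: "0 \<le> \<theta>" using la by (simp add: \<theta>_def)
    have "\<xi> < 1" using xi beta alpha by linarith
    then have "a * \<xi> < a" using a0 by simp
    then have "x < l" using x by linarith
    then have "l * x < l * l" using l by simp
    then have t1: "\<theta> < 1" using la by (simp add: \<theta>_def power2_eq_square)
    have th: "\<theta> * (l\<^sup>2 - \<alpha>\<^sup>2) = l * x - \<alpha>\<^sup>2" using la by (simp add: \<theta>_def)
    have ax: "a * (1 - \<xi>) = l - x" using x by (simp add: algebra_simps)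
    have "(n - x\<^sup>2) * (l\<^sup>2 - \<alpha>\<^sup>2) \<le> b\<^sup>2 * (\<beta>\<^sup>2 - \<xi>\<^sup>2) * (l\<^sup>2 - \<alpha>\<^sup>2)"
      using Y la by (intro mult_right_mono) auto
    also have "\<dots> \<le> \<alpha>\<^sup>2 * (a * (1 - \<xi>))\<^sup>2" using cone[of \<xi>] by (simp add: power_mult_distrib mult.assoc)
    finally have fin: "(n - x\<^sup>2) * (l\<^sup>2 - \<alpha>\<^sup>2) \<le> \<alpha>\<^sup>2 * (l - x)\<^sup>2" unfolding ax .
    have "(l\<^sup>2 - \<alpha>\<^sup>2) * (n - 2 * \<theta> * l * x + \<theta>\<^sup>2 * l\<^sup>2 - \<alpha>\<^sup>2 * (1 - \<theta>)\<^sup>2)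
      = (l\<^sup>2 - \<alpha>\<^sup>2) * (n - \<alpha>\<^sup>2) - 2 * (\<theta> * (l\<^sup>2 - \<alpha>\<^sup>2)) * (l * x - \<alpha>\<^sup>2) + (\<theta> * (l\<^sup>2 - \<alpha>\<^sup>2))\<^sup>2"
      by (simp add: power2_eq_square algebra_simps)
    also have "\<dots> = (n - x\<^sup>2) * (l\<^sup>2 - \<alpha>\<^sup>2) - \<alpha>\<^sup>2 * (l - x)\<^sup>2"
      unfolding th by (simp add: power2_eq_square algebra_simps)
    also have "\<dots> \<le> 0" using fin by simp
    finally have "n - 2 * \<theta> * l * x + \<theta>\<^sup>2 * l\<^sup>2 - \<alpha>\<^sup>2 * (1 - \<theta>)\<^sup>2 \<le> 0"
      using la by (simp add: mult_le_0_iff)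
    then show ?thesis using t0 t1 by (intro exI[of _ \<theta>]) auto
  qed
qed

section \<open>Updating an ellipsoid\<close>

definition ip :: "nat \<Rightarrow> (nat \<Rightarrow> real) \<Rightarrow> (nat \<Rightarrow> real) \<Rightarrow> real" where
  "ip d x y = (\<Sum>i<d. x i * y i)"

definition mv :: "nat \<Rightarrow> (nat \<Rightarrow> nat \<Rightarrow> real) \<Rightarrow> (nat \<Rightarrow> real) \<Rightarrow> nat \<Rightarrow> real" where
  "mv d M x i = (\<Sum>j<d. M i j * x j)"

definition gauge :: "nat \<Rightarrow> (nat \<Rightarrow> nat \<Rightarrow> real) \<Rightarrow> (nat \<Rightarrow> real) \<Rightarrow> (nat \<Rightarrow> real) \<Rightarrow> real" where
  "gauge d M c x = ip d (mv d M (\<lambda>j. x j - c j)) (mv d M (\<lambda>j. x j - c j))"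

lemma ip_nonneg: "0 \<le> ip d x x"
  by (simp add: ip_def sum_nonneg)

lemma ip_commute: "ip d x y = ip d y x"
  by (simp add: ip_def mult.commute)

lemma ip_cong: "(\<And>i. i < d \<Longrightarrow> x i = x' i) \<Longrightarrow> (\<And>i. i < d \<Longrightarrow> y i = y' i) \<Longrightarrow> ip d x y = ip d x' y'"
  by (simp add: ip_def)

lemma mv_cong: "(\<And>j. j < d \<Longrightarrow> M i j = M' i j) \<Longrightarrow> (\<And>j. j < d \<Longrightarrow> x j = x' j) \<Longrightarrow> mv d M x i = mv d M' x' i"
  by (simp add: mv_def)

lemma ip_Cauchy_Schwarz: "(ip d x y)\<^sup>2 \<le> ip d x x * ip d y y"
  using Cauchy_Schwarz_ineq_sum[of x y "{..<d}"] by (simp add: ip_def power2_eq_square)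

lemma ip_axpy_left: "ip d (\<lambda>i. r * x i + s * y i) z = r * ip d x z + s * ip d y z"
  by (simp add: ip_def sum.distrib sum_distrib_left algebra_simps)

lemma ip_axpy_right: "ip d z (\<lambda>i. r * x i + s * y i) = r * ip d z x + s * ip d z y"
  by (simp add: ip_def sum.distrib sum_distrib_left algebra_simps)

lemma ip_axpy: "ip d (\<lambda>i. r * x i + s * y i) (\<lambda>i. r * x i + s * y i)
    = r\<^sup>2 * ip d x x + 2 * r * s * ip d x y + s\<^sup>2 * ip d y y"
  unfolding ip_axpy_left ip_axpy_right ip_commute[of d y x]
  by (simp add: power2_eq_square algebra_simps)

lemma mv_axpy: "mv d M (\<lambda>j. r * x j + s * y j) = (\<lambda>i. r * mv d M x i + s * mv d M y i)"
  by (simp add: mv_def sum.distrib sum_distrib_left algebra_simps fun_eq_iff)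

lemma ip_mv: "ip d u (mv d M x) = ip d (\<lambda>j. \<Sum>i<d. u i * M i j) x"
  unfolding ip_def mv_def sum_distrib_left sum_distrib_right
  by (subst sum.swap) (simp add: mult.assoc)

locale update =
  fixes d :: nat and M M' :: "nat \<Rightarrow> nat \<Rightarrow> real" and c c' z u :: "nat \<Rightarrow> real" and l a b :: real
  assumes u_def: "u = mv d M (\<lambda>j. z j - c j)"
    and l_def: "l = max 1 (sqrt (ip d u u))"
    and ab: "0 < a" "0 < b" "l = 1 \<Longrightarrow> a = 1 \<and> b = 1"
    and M': "\<And>i j. i < d \<Longrightarrow> j < d \<Longrightarrow>
      M' i j = M i j / b + (1 / a - 1 / b) / (l * l) * u i * (\<Sum>k<d. u k * M k j)"
    and c': "\<And>i. i < d \<Longrightarrow> c' i = c i + (l - a) / l * (z i - c i)"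
begin

lemma l_ge: "1 \<le> l"
  by (simp add: l_def)

lemma l_cases:
  obtains (still) "l = 1" "a = 1" "b = 1" "ip d u u \<le> 1" | (moved) "ip d u u = l\<^sup>2"
proof (cases "ip d u u \<le> 1")
  case True
  then have "l = 1" by (simp add: l_def)
  then show ?thesis using ab(3) True still by blast
next
  case False
  then have "l = sqrt (ip d u u)" by (simp add: l_def)
  then show ?thesis using moved False by simp
qed

lemma gauge_point: "gauge d M c z = ip d u u"
  by (simp add: gauge_def u_def)

lemma gauge_still:
  assumes "l = 1"
  shows "gauge d M' c' x = gauge d M c x"
proof -
  have "mv d M' (\<lambda>j. x j - c' j) i = mv d M (\<lambda>j. x j - c j) i" if "i < d" for i
    using ab(3)[OF assms] M' c' that assms by (intro mv_cong) auto
  then show ?thesis unfolding gauge_def by (intro ip_cong)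
qed

lemma gauge_moved:
  fixes x p
  defines "p \<equiv> mv d M (\<lambda>j. x j - c j)"
  assumes q: "ip d u u = l\<^sup>2"
  shows "gauge d M' c' x =
    (ip d u p / l - (l - a))\<^sup>2 / a\<^sup>2 + (ip d p p - (ip d u p / l)\<^sup>2) / b\<^sup>2"
proof -
  define \<mu> where "\<mu> = (l - a) / l"
  define \<kappa> where "\<kappa> = (1 / a - 1 / b) / (l * l)"
  define p' where "p' = (\<lambda>i. 1 * p i + (- \<mu>) * u i)"
  define y where "y = (\<lambda>j. 1 * (x j - c j) + (- \<mu>) * (z j - c j))"
  have l0: "0 < l" using l_ge by simp
  have p': "mv d M y = p'" unfolding y_def mv_axpy p'_def p_def u_def ..
  have row: "mv d M' (\<lambda>j. x j - c' j) i = (1 / b) * p' i + (\<kappa> * ip d u p') * u i" if i: "i < d" for i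
  proof -
    define v where "v = (\<lambda>j. \<Sum>k<d. u k * M k j)"
    have "mv d M' (\<lambda>j. x j - c' j) i = (\<Sum>j<d. (M i j / b + \<kappa> * u i * v j) * y j)"
      unfolding mv_def by (rule sum.cong) (auto simp: M'[OF i] c' y_def \<mu>_def \<kappa>_def v_def algebra_simps)
    also have "\<dots> = (1 / b) * mv d M y i + \<kappa> * u i * ip d v y"
      by (simp add: mv_def ip_def sum.distrib sum_distrib_left distrib_right mult.assoc)
    also have "ip d v y = ip d u p'"
      unfolding p'[symmetric] v_def by (rule ip_mv[symmetric])
    finally show ?thesis unfolding p' by simp
  qed
  have "gauge d M' c' x = ip d (\<lambda>i. (1 / b) * p' i + (\<kappa> * ip d u p') * u i)
      (\<lambda>i. (1 / b) * p' i + (\<kappa> * ip d u p') * u i)"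
    unfolding gauge_def by (rule ip_cong) (simp_all add: row)
  also have "\<dots> = (1 / b)\<^sup>2 * ip d p' p' + (2 * (1 / b) * \<kappa> + \<kappa>\<^sup>2 * l\<^sup>2) * (ip d u p')\<^sup>2"
    unfolding ip_axpy q ip_commute[of d p' u] by (simp add: power2_eq_square algebra_simps)
  also have "2 * (1 / b) * \<kappa> + \<kappa>\<^sup>2 * l\<^sup>2 = ((1 / a)\<^sup>2 - (1 / b)\<^sup>2) / l\<^sup>2"
  proof -
    define D where "D = 1 / a - 1 / b"
    have "2 * (1 / b) * \<kappa> + \<kappa>\<^sup>2 * l\<^sup>2 = (2 * (1 / b) * D + D\<^sup>2) / l\<^sup>2"
      using l0 by (simp add: \<kappa>_def D_def[symmetric] add_divide_distrib power2_eq_square)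
    also have "2 * (1 / b) * D + D\<^sup>2 = (1 / a)\<^sup>2 - (1 / b)\<^sup>2"
    proof -
      have "2 * y * (x - y) + (x - y)\<^sup>2 = x\<^sup>2 - y\<^sup>2" for x y :: real
        by (simp add: power2_eq_square algebra_simps)
      then show ?thesis unfolding D_def .
    qed
    finally show ?thesis .
  qed
  also have "ip d p' p' = ip d p p - 2 * \<mu> * ip d u p + \<mu>\<^sup>2 * l\<^sup>2"
    unfolding p'_def ip_axpy q ip_commute[of d p u] by simp
  also have "ip d u p' = l * (ip d u p / l - (l - a))"
    unfolding p'_def ip_axpy_right q using l0 by (simp add: \<mu>_def field_simps power2_eq_square)
  finally have "gauge d M' c' x = (1 / b)\<^sup>2 * (ip d p p - 2 * \<mu> * ip d u p + \<mu>\<^sup>2 * l\<^sup>2)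
      + ((1 / a)\<^sup>2 - (1 / b)\<^sup>2) * (ip d u p / l - (l - a))\<^sup>2"
    using l0 by (simp add: power_mult_distrib)
  also have "ip d p p - 2 * \<mu> * ip d u p + \<mu>\<^sup>2 * l\<^sup>2
      = (ip d u p / l - (l - a))\<^sup>2 + (ip d p p - (ip d u p / l)\<^sup>2)"
  proof -
    define X where "X = ip d u p / l"
    have X: "ip d u p = l * X" and \<mu>: "\<mu> * l = l - a" using l0 by (simp_all add: X_def \<mu>_def)
    have "ip d p p - 2 * \<mu> * (l * X) + \<mu>\<^sup>2 * l\<^sup>2 = ip d p p - 2 * (\<mu> * l) * X + (\<mu> * l)\<^sup>2"
      by (simp add: power_mult_distrib)
    also have "\<dots> = (X - (l - a))\<^sup>2 + (ip d p p - X\<^sup>2)"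
      unfolding \<mu> by (simp add: power2_eq_square algebra_simps)
    finally show ?thesis unfolding X_def[symmetric] X[symmetric] .
  qed
  also have "(1 / b)\<^sup>2 * (A + B) + ((1 / a)\<^sup>2 - (1 / b)\<^sup>2) * A = A / a\<^sup>2 + B / b\<^sup>2" for A B
    by (simp add: power_divide distrib_left left_diff_distrib)
  finally show ?thesis .
qed

end

text \<open>In coordinates where the old outer ellipsoid is the unit ball and the new point is \<open>l\<close> times
  a unit vector, \<open>x\<close> is the component of a point along that vector and \<open>n\<close> its squared norm.\<close>

locale admissible =
  fixes \<alpha> l \<beta> a b :: real
  assumes axes: "1 \<le> a" "1 \<le> b" "l = 1 \<Longrightarrow> a = 1 \<and> b = 1 \<and> \<beta> = \<alpha>"
    and outer: "\<And>x n. x\<^sup>2 \<le> n \<Longrightarrow> n \<le> 1 \<Longrightarrow> (x - (l - a))\<^sup>2 / a\<^sup>2 + (n - x\<^sup>2) / b\<^sup>2 \<le> 1"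
    and inner: "\<And>x n. x\<^sup>2 \<le> n \<Longrightarrow> (x - (l - a))\<^sup>2 / a\<^sup>2 + (n - x\<^sup>2) / b\<^sup>2 \<le> \<beta>\<^sup>2 \<Longrightarrow>
      \<exists>\<theta>. 0 \<le> \<theta> \<and> \<theta> < 1 \<and> n - 2 * \<theta> * l * x + \<theta>\<^sup>2 * l\<^sup>2 \<le> \<alpha>\<^sup>2 * (1 - \<theta>)\<^sup>2"

lemma (in growth) admissible: "admissible \<alpha> l \<beta> a b"
proof
  show "1 \<le> a" "1 \<le> b" using a_ge b_ge by auto
  show "a = 1 \<and> b = 1 \<and> \<beta> = \<alpha>" if "l = 1"
  proof -
    have "shrink \<alpha> l = \<alpha>" using that by (simp add: shrink_def)
    then have "\<beta> = \<alpha>" "a = 1" using that alpha by (simp_all add: beta_def a_def long_axis_def)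
    then show ?thesis using b_sq b_ge(1) by (auto simp: power2_eq_1_iff)
  qed
  show "(x - (l - a))\<^sup>2 / a\<^sup>2 + (n - x\<^sup>2) / b\<^sup>2 \<le> 1" if "x\<^sup>2 \<le> n" "n \<le> 1" for x n
    using sphere_in_grown[OF b_ge(1,2) outer_condition that(2,1)] .
qed (rule drop_decomposition)

lemma admissible_ball:
  assumes l: "1 \<le> l"
  shows "admissible \<alpha> l (\<alpha> / l) l l"
proof
  have l2: "1 \<le> l\<^sup>2" using l by simp
  show "(x - (l - l))\<^sup>2 / l\<^sup>2 + (n - x\<^sup>2) / l\<^sup>2 \<le> 1" if "x\<^sup>2 \<le> n" "n \<le> 1" for x n
  proof -
    have "(x - (l - l))\<^sup>2 / l\<^sup>2 + (n - x\<^sup>2) / l\<^sup>2 = n / l\<^sup>2" by (simp add: diff_divide_distrib)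
    then show ?thesis using that l2 by (simp add: divide_le_eq)
  qed
  show "\<exists>\<theta>. 0 \<le> \<theta> \<and> \<theta> < 1 \<and> n - 2 * \<theta> * l * x + \<theta>\<^sup>2 * l\<^sup>2 \<le> \<alpha>\<^sup>2 * (1 - \<theta>)\<^sup>2"
    if "x\<^sup>2 \<le> n" "(x - (l - l))\<^sup>2 / l\<^sup>2 + (n - x\<^sup>2) / l\<^sup>2 \<le> (\<alpha> / l)\<^sup>2" for x n
  proof -
    have "(x - (l - l))\<^sup>2 / l\<^sup>2 + (n - x\<^sup>2) / l\<^sup>2 = n / l\<^sup>2" by (simp add: diff_divide_distrib)
    then have "n / l\<^sup>2 \<le> \<alpha>\<^sup>2 / l\<^sup>2" using that(2) by (simp add: power_divide)
    then have "n \<le> \<alpha>\<^sup>2" using l by (simp add: divide_le_cancel)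
    then show ?thesis by (intro exI[of _ 0]) auto
  qed
qed (use l in auto)

locale admissible_update = update d M M' c c' z u l a b + admissible \<alpha> l \<beta> a b
  for d M M' c c' z u l a b \<alpha> \<beta>
begin

lemma component_le: 
  assumes q: "ip d u u = l\<^sup>2"
  shows "(ip d u p / l)\<^sup>2 \<le> ip d p p"
proof -
  have "(ip d u p)\<^sup>2 \<le> l\<^sup>2 * ip d p p" using ip_Cauchy_Schwarz[of d u p] q by simp
  then show ?thesis using l_ge by (simp add: power_divide divide_le_eq mult.commute)
qed

lemma gauge_mono:
  assumes "gauge d M c x \<le> 1"
  shows "gauge d M' c' x \<le> 1"
proof (cases rule: l_cases)
  case still
  then show ?thesis using assms by (simp add: gauge_still)
next
  case moved
  then show ?thesis
    unfolding gauge_moved[OF moved] using assms component_le[OF moved]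
    by (intro outer) (auto simp: gauge_def)
qed

lemma gauge_new: "gauge d M' c' z \<le> 1"
proof (cases rule: l_cases)
  case still
  then show ?thesis by (simp add: gauge_still gauge_point)
next
  case moved
  have "l\<^sup>2 / l = l" using l_ge by (simp add: power2_eq_square)
  then show ?thesis
    unfolding gauge_moved[OF moved] u_def[symmetric] moved using axes by simp
qed

lemma inner_step:
  assumes inner_old: "\<And>x. gauge d M c x \<le> \<alpha>\<^sup>2 \<Longrightarrow> vec d x \<in> Z"
    and convex: "\<And>x y \<theta>. vec d x \<in> Z \<Longrightarrow> vec d y \<in> Z \<Longrightarrow> 0 \<le> \<theta> \<Longrightarrow> \<theta> \<le> 1 \<Longrightarrow>
      vec d (\<lambda>i. \<theta> * x i + (1 - \<theta>) * y i) \<in> Z"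
    and z: "vec d z \<in> Z"
    and x: "gauge d M' c' x \<le> \<beta>\<^sup>2"
  shows "vec d x \<in> Z"
proof (cases rule: l_cases)
  case still
  then show ?thesis using inner_old x axes(3) by (simp add: gauge_still)
next
  case moved
  define p where "p = mv d M (\<lambda>j. x j - c j)"
  obtain \<theta> where \<theta>: "0 \<le> \<theta>" "\<theta> < 1"
    and le: "ip d p p - 2 * \<theta> * l * (ip d u p / l) + \<theta>\<^sup>2 * l\<^sup>2 \<le> \<alpha>\<^sup>2 * (1 - \<theta>)\<^sup>2"
    using inner[OF component_le[OF moved, of p]] x unfolding gauge_moved[OF moved] p_def by blast
  define r where "r = 1 / (1 - \<theta>)"
  define y where "y = (\<lambda>i. c i + (r * (x i - c i) + (- (\<theta> * r)) * (z i - c i)))"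
  have t: "(1 - \<theta>) * r = 1" using \<theta> by (simp add: r_def)
  have "gauge d M c y = r\<^sup>2 * (ip d p p - 2 * \<theta> * ip d u p + \<theta>\<^sup>2 * l\<^sup>2)"
    unfolding gauge_def y_def add_diff_cancel_left' mv_axpy ip_axpy p_def[symmetric] u_def[symmetric]
      moved ip_commute[of d p u]
    by (simp add: algebra_simps power2_eq_square)
  also have "ip d p p - 2 * \<theta> * ip d u p + \<theta>\<^sup>2 * l\<^sup>2 = ip d p p - 2 * \<theta> * l * (ip d u p / l) + \<theta>\<^sup>2 * l\<^sup>2"
    using l_ge by simp
  also have "r\<^sup>2 * \<dots> \<le> r\<^sup>2 * (\<alpha>\<^sup>2 * (1 - \<theta>)\<^sup>2)"
    using le by (intro mult_left_mono) auto
  also have "\<dots> = \<alpha>\<^sup>2 * ((1 - \<theta>) * r)\<^sup>2" by (simp add: power_mult_distrib)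
  also have "\<dots> = \<alpha>\<^sup>2" unfolding t by simp
  finally have "vec d y \<in> Z" by (rule inner_old)
  then have "vec d (\<lambda>i. \<theta> * z i + (1 - \<theta>) * y i) \<in> Z" using z \<theta> by (intro convex) auto
  also have "(\<lambda>i. \<theta> * z i + (1 - \<theta>) * y i) = x"
  proof
    fix i
    have "(1 - \<theta>) * y i = (1 - \<theta>) * c i + ((1 - \<theta>) * r) * (x i - c i)
        - ((1 - \<theta>) * r) * \<theta> * (z i - c i)"
      by (simp add: y_def algebra_simps)
    also have "\<dots> = (1 - \<theta>) * c i + (x i - c i) - \<theta> * (z i - c i)" unfolding t by simp
    finally show "\<theta> * z i + (1 - \<theta>) * y i = x i" by (simp add: algebra_simps)
  qed
  finally show ?thesis .
qed

end

section \<open>Determinants\<close>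

lemma det_rank_one_update:
  fixes k :: real
  shows "det (mat n n (\<lambda>(i, j). (if i = j then 1 else 0) + k * u i * u j)) = 1 + k * ip n u u"
proof -
  let ?v = "mat 1 n (\<lambda>(i, j). - k * u j)" and ?u = "mat n 1 (\<lambda>(i, j). u i)"
  let ?R = "mat n n (\<lambda>(i, j). (if i = j then 1 else 0) + k * u i * u j)"
  let ?B = "four_block_mat (1\<^sub>m 1) ?v ?u (1\<^sub>m n)"
  let ?s = "mat 1 1 (\<lambda>_. 1 + k * ip n u u)"
  let ?L = "four_block_mat (1\<^sub>m 1) (0\<^sub>m 1 n) ?u (1\<^sub>m n)"
  have A: "?L * four_block_mat (1\<^sub>m 1) ?v (0\<^sub>m n 1) ?R = ?B"
    by (subst mult_four_block_mat[of _ 1 1 _ n _ n _ _ 1 _ n])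
      (auto intro!: cong_four_block_mat eq_matI simp: scalar_prod_def)
  have B: "four_block_mat ?s ?v (0\<^sub>m n 1) (1\<^sub>m n) * ?L = ?B"
    by (subst mult_four_block_mat[of _ 1 1 _ n _ n _ _ 1 _ n])
      (auto intro!: cong_four_block_mat eq_matI simp: scalar_prod_def ip_def sum_distrib_left sum_negf
        lessThan_atLeast0 mult.assoc)
  have dL: "det ?L = 1" by (subst det_four_block_mat_upper_right_zero[of _ 1 _ n]) auto
  have s: "det ?s = 1 + k * ip n u u" by (simp add: det_single)
  have "det ?B = det ?R"
    unfolding A[symmetric]
    by (subst det_mult[of _ "1 + n"]) (auto simp: dL det_four_block_mat_lower_left_zero[of _ 1 _ n] simp del: One_nat_def)
  moreover have "det ?B = 1 + k * ip n u u"
    unfolding B[symmetric]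
    by (subst det_mult[of _ "1 + n"]) (auto simp: dL s det_four_block_mat_lower_left_zero[of _ 1 _ n] simp del: One_nat_def)
  ultimately show ?thesis by simp
qed

lemma (in admissible_update) det_step:
  assumes d: "1 \<le> d"
  shows "det (mat d d (\<lambda>(i, j). M i j)) \<noteq> 0 \<Longrightarrow> det (mat d d (\<lambda>(i, j). M' i j)) \<noteq> 0" (is "?n \<Longrightarrow> ?n'")
    and "\<bar>det (mat d d (\<lambda>(i, j). M' i j))\<bar> \<le> \<bar>det (mat d d (\<lambda>(i, j). M i j))\<bar> / a" (is ?le)
proof -
  let ?M = "mat d d (\<lambda>(i, j). M i j)" and ?M' = "mat d d (\<lambda>(i, j). M' i j)"
  have "(?n \<longrightarrow> ?n') \<and> ?le"
  proof (cases rule: l_cases)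
    case still
    then have "?M' = ?M" using M' by (intro eq_matI) auto
    then show ?thesis using still by simp
  next
    case moved
    define k where "k = b * ((1 / a - 1 / b) / (l * l))"
    let ?R = "mat d d (\<lambda>(i, j). (if i = j then 1 else 0) + k * u i * u j)"
    have e: "?M' = (1 / b) \<cdot>\<^sub>m (?R * ?M)"
    proof (rule eq_matI)
      fix i j assume ij: "i < dim_row ((1 / b) \<cdot>\<^sub>m (?R * ?M))" "j < dim_col ((1 / b) \<cdot>\<^sub>m (?R * ?M))"
      have *: "(\<Sum>m<d. ((if i = m then 1 else 0) + k * u i * u m) * M m j)
          = M i j + k * u i * (\<Sum>m<d. u m * M m j)"
      proof -
        have "(\<Sum>m<d. (if i = m then 1 else 0) * M m j) = (\<Sum>m<d. if i = m then M m j else 0)"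
          by (rule sum.cong) auto
        then show ?thesis using ij by (simp add: distrib_right sum.distrib sum_distrib_left mult.assoc)
      qed
      have "((1 / b) \<cdot>\<^sub>m (?R * ?M)) $$ (i, j) = 1 / b * (\<Sum>m<d. ((if i = m then 1 else 0) + k * u i * u m) * M m j)"
        using ij by (simp add: scalar_prod_def lessThan_atLeast0)
      also have "\<dots> = ?M' $$ (i, j)"
        unfolding * using ij ab by (simp add: M' k_def distrib_left)
      finally show "?M' $$ (i, j) = ((1 / b) \<cdot>\<^sub>m (?R * ?M)) $$ (i, j)" ..
    qed auto
    have "1 + k * ip d u u = b / a"
      using ab l_ge by (simp add: moved k_def field_simps power2_eq_square)
    then have D: "det ?M' = (1 / b) ^ d * (b / a) * det ?M"
      unfolding e det_smult by (subst det_mult[of _ d]) (auto simp: det_rank_one_update)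
    have "(1 / b) ^ d * b \<le> (1 / b) * b"
      using axes d power_decreasing[of 1 d "1 / b"] by (intro mult_right_mono) auto
    then have 1: "(1 / b) ^ d * b \<le> 1" using ab by simp
    have "\<bar>det ?M'\<bar> = ((1 / b) ^ d * b) * (\<bar>det ?M\<bar> / a)"
      unfolding D using ab by (simp add: abs_mult power_divide)
    also have "\<dots> \<le> 1 * (\<bar>det ?M\<bar> / a)" using 1 ab by (intro mult_right_mono) auto
    finally show ?thesis using D ab by simp
  qed
  then show "?n \<Longrightarrow> ?n'" ?le by blast+
qed

lemma det_le_entries:
  assumes "A \<in> carrier_mat n n" "\<And>i j. i < n \<Longrightarrow> j < n \<Longrightarrow> \<bar>A $$ (i, j)\<bar> \<le> (s :: real)"
  shows "\<bar>det A\<bar> \<le> (real n * s) ^ n"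
proof (cases "n = 0")
  case True
  then show ?thesis using assms(1) by (simp add: det_dim_zero)
next
  case False
  then have s: "0 \<le> s" using assms(2)[of 0 0] by auto
  have "\<bar>det A\<bar> \<le> (\<Sum>p | p permutes {0..<n}. \<bar>signof p * (\<Prod>i = 0..<n. A $$ (i, p i))\<bar>)"
    unfolding det_def'[OF assms(1)] by (rule sum_abs)
  also have "\<dots> \<le> (\<Sum>p | p permutes {0..<n}. s ^ n)"
  proof (rule sum_mono)
    fix p assume p: "p \<in> {p. p permutes {0..<n}}"
    have "\<bar>signof p * (\<Prod>i = 0..<n. A $$ (i, p i))\<bar> = (\<Prod>i = 0..<n. \<bar>A $$ (i, p i)\<bar>)"
      by (simp add: abs_mult sign_def abs_prod)
    also have "\<dots> \<le> (\<Prod>i = 0..<n. s)"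
      using p assms(2) by (intro prod_mono) (auto dest: permutes_in_image[of p "{0..<n}"])
    finally show "\<bar>signof p * (\<Prod>i = 0..<n. A $$ (i, p i))\<bar> \<le> s ^ n" by simp
  qed
  also have "\<dots> = fact n * s ^ n" by (simp add: card_permutations[of "{0..<n}" n])
  also have "\<dots> \<le> real (n ^ n) * s ^ n" using s fact_le_power[of n, where 'a=real] by (intro mult_right_mono) auto
  finally show ?thesis by (simp add: power_mult_distrib)
qed

section \<open>Bounds for the approximation ratio\<close>

definition harm :: "nat \<Rightarrow> real" where
  "harm n = (\<Sum>k<n. inverse (real (Suc k)))"

lemma harm_Suc: "harm (Suc n) = harm n + inverse (real (Suc n))"
  by (simp add: harm_def)

lemma ln_diff_bounds:
  assumes "1 \<le> n"
  shows "inverse (real (Suc n)) \<le> ln (real (Suc n)) - ln (real n)"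
    and "ln (real (Suc n)) - ln (real n) \<le> inverse (real n)"
proof -
  have n: "0 < real n" using assms by simp
  have "ln (real n / (real n + 1)) \<le> real n / (real n + 1) - 1"
    using n by (intro ln_le_minus_one) auto
  also have "\<dots> = - inverse (real (Suc n))" by (simp add: field_simps)
  finally show "inverse (real (Suc n)) \<le> ln (real (Suc n)) - ln (real n)"
    using n by (simp add: ln_div add.commute)
  have "ln ((real n + 1) / real n) \<le> (real n + 1) / real n - 1"
    using n by (intro ln_le_minus_one) auto
  also have "\<dots> = inverse (real n)" using n by (simp add: field_simps)
  finally show "ln (real (Suc n)) - ln (real n) \<le> inverse (real n)"
    using n by (simp add: ln_div add.commute)
qed

lemma harm_bounds:
  assumes "1 \<le> n"
  shows "harm n \<le> 1 + ln (real n)" "ln (real n) \<le> harm n" "1 \<le> harm n"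
proof -
  have "harm n \<le> 1 + ln (real n) \<and> ln (real (Suc n)) \<le> harm n \<and> 1 \<le> harm n"
    using assms
  proof (induction n rule: nat_induct_at_least)
    case base
    then show ?case using ln_le_minus_one[of 2] by (simp add: harm_def)
  next
    case (Suc n)
    then show ?case
      using ln_diff_bounds(1)[of n] ln_diff_bounds(2)[of "Suc n"] by (simp add: harm_Suc add_increasing2)
  qed
  moreover have "ln (real n) \<le> ln (real (Suc n))" using assms by simp
  ultimately show "harm n \<le> 1 + ln (real n)" "ln (real n) \<le> harm n" "1 \<le> harm n" by linarith+
qed

lemma ratio_bound_ball:
  fixes A x :: real
  assumes d: "1 \<le> d" and x: "1 \<le> x"
    and A: "A \<le> 4 + real d * harm d" "A \<le> max 4 (2 * x)"
  shows "A \<le> 264 * max 1 (min x (real d * ln x))"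
proof (cases "x \<le> 3")
  case True
  then have "A \<le> 264 * 1" using A(2) by simp
  also have "\<dots> \<le> 264 * max 1 (min x (real d * ln x))" by simp
  finally show ?thesis .
next
  case False
  have "ln (exp 1) \<le> ln x" using False exp_le by (intro ln_mono) auto
  then have L: "1 \<le> ln x" by simp
  have A1: "A \<le> 2 * x" using A(2) False by simp
  have dL: "real d * 1 \<le> real d * ln x" using L by (intro mult_left_mono) auto
  have A2: "A \<le> 6 * (real d * ln x)"
  proof (cases "x \<le> real d")
    case True
    then show ?thesis using A1 dL d by linarith
  next
    case False
    then have "ln (real d) \<le> ln x" using d by simp
    then have "harm d \<le> 2 * ln x" using harm_bounds(1)[OF d] L by simp
    then have "real d * harm d \<le> real d * (2 * ln x)" by (intro mult_left_mono) auto
    moreover have "1 \<le> real d * ln x" using dL d by linarith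
    ultimately show ?thesis using A(1) by simp
  qed
  have "A \<le> 6 * min x (real d * ln x)" using A1 A2 False by (simp add: min_def)
  also have "\<dots> \<le> 264 * max 1 (min x (real d * ln x))" by (simp add: max_def min_def)
  finally show ?thesis .
qed

text \<open>Here \<open>ln A \<le> A / (8 d) + ln (8 d)\<close> absorbs the term \<open>ln A\<close> on the right of the hypothesis.\<close>

lemma ratio_bound_ellipsoid:
  fixes A x :: real
  assumes d: "1 \<le> d" and A1: "1 \<le> A" and x: "4 + real d * harm d \<le> 2 * x"
    and A: "A \<le> 4 + real d * harm d + 4 * real d * (ln x + ln (real d) + ln A)"
  shows "A \<le> 264 * max 1 (min x (real d * ln x))"
proof -
  define D where "D = real d"
  have D: "1 \<le> D" using d by (simp add: D_def)
  define L where "L = ln x"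
  have hD: "D * 1 \<le> D * harm d" using harm_bounds(3)[OF d] D by (intro mult_left_mono) auto
  have x2: "2 \<le> x" "D \<le> 2 * x" using x hD D unfolding D_def by linarith+
  have "ln 2 \<le> L" unfolding L_def using x2 by (intro ln_mono) auto
  moreover have "1 / 2 \<le> ln (2 :: real)" using ln_le_minus_one[of "1 / 2 :: real"] by (simp add: ln_div)
  ultimately have L2: "1 / 2 \<le> L" "ln 2 \<le> L" by simp_all
  have "ln D \<le> ln (2 * x)" using x2 D by (intro ln_mono) auto
  also have "\<dots> = ln 2 + L" using x2 by (simp add: ln_mult L_def)
  finally have lnD: "ln D \<le> 2 * L" using L2 by linarith
  have DL: "D \<le> 2 * (D * L)" using mult_left_mono[OF L2(1), of D] D by simp
  have "ln (8 * D) = 3 * ln 2 + ln D" using D ln_realpow[of 2 3] by (simp add: ln_mult)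
  then have ln8: "ln (8 * D) \<le> 5 * L" using L2 lnD by simp
  have "ln (A / (8 * D)) \<le> A / (8 * D) - 1" using A1 D by (intro ln_le_minus_one) auto
  then have "ln A \<le> A / (8 * D) + 5 * L" using A1 D ln8 by (simp add: ln_div)
  then have "4 * D * ln A \<le> 4 * D * (A / (8 * D) + 5 * L)" using D by (intro mult_left_mono) auto
  also have "\<dots> = A / 2 + 20 * (D * L)" using D by (simp add: field_simps)
  finally have lnA: "4 * D * ln A \<le> A / 2 + 20 * (D * L)" .
  have "D * harm d \<le> D * (1 + 2 * L)" using harm_bounds(1)[OF d] lnD D
    by (intro mult_left_mono) (auto simp: D_def)
  then have h: "D * harm d \<le> 4 * (D * L)" using DL by (simp add: algebra_simps)
  have lD: "D * ln D \<le> 2 * (D * L)" using mult_left_mono[OF lnD, of D] D by simp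
  have "A \<le> 4 + D * harm d + 4 * (D * L) + 4 * (D * ln D) + 4 * D * ln A"
    using A by (simp add: D_def L_def algebra_simps)
  then have AL: "A \<le> 88 * (D * L)" using h lD lnA DL D by linarith
  have "D * L \<le> 3 * x"
  proof -
    have "ln (x / D) \<le> x / D - 1" using x2 D by (intro ln_le_minus_one) auto
    then have "L \<le> x / D + ln D" using x2 D by (simp add: ln_div L_def)
    also have "ln D \<le> harm d" using harm_bounds(2)[OF d] by (simp add: D_def)
    finally have "D * L \<le> D * (x / D + harm d)" using D by (intro mult_left_mono) auto
    also have "\<dots> = x + D * harm d" using D by (simp add: distrib_left)
    also have "\<dots> \<le> 3 * x" using x by (simp add: D_def)
    finally show ?thesis .
  qed
  then have "A \<le> 264 * x" "A \<le> 264 * (D * L)" using AL DL D by linarith+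
  then have "A \<le> 264 * min x (D * L)" by (simp add: min_def)
  also have "\<dots> \<le> 264 * max 1 (min x (D * L))" by simp
  finally show ?thesis by (simp add: D_def L_def)
qed

section \<open>Ellipsoids and convex hulls\<close>

lemma enorm_eq: "x \<in> carrier_vec d \<Longrightarrow> enorm x = sqrt (ip d (($) x) (($) x))"
  by (simp add: enorm_def scalar_prod_def ip_def lessThan_atLeast0)

lemma mult_mat_vec_eq: "x \<in> carrier_vec d \<Longrightarrow> mat d d (\<lambda>(i, j). M i j) *\<^sub>v x = vec d (mv d M (($) x))"
  by (intro eq_vecI) (simp_all add: mv_def scalar_prod_def lessThan_atLeast0)

lemma ellipsoid_eq:
  "ellipsoid d (mat d d (\<lambda>(i, j). M i j))
    = {x \<in> carrier_vec d. ip d (mv d M (($) x)) (mv d M (($) x)) \<le> 1}"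
proof -
  have "enorm (mat d d (\<lambda>(i, j). M i j) *\<^sub>v x) = sqrt (ip d (mv d M (($) x)) (mv d M (($) x)))"
    if "x \<in> carrier_vec d" for x
    unfolding mult_mat_vec_eq[OF that] enorm_eq[OF vec_carrier]
    by (intro arg_cong[of _ _ sqrt] ip_cong) auto
  then show ?thesis by (auto simp: ellipsoid_def)
qed

lemma mem_translate_ellipsoid:
  assumes "p \<in> carrier_vec d" "gauge d M c (($) p) \<le> 1"
  shows "p \<in> translate (vec d c) (ellipsoid d (mat d d (\<lambda>(i, j). M i j)))"
  unfolding translate_def
proof (rule image_eqI)
  show "p = vec d c + (p - vec d c)" using assms(1) by (intro eq_vecI) auto
  have "ip d (mv d M (($) (p - vec d c))) (mv d M (($) (p - vec d c))) = gauge d M c (($) p)"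
    unfolding gauge_def using assms(1) by (intro ip_cong mv_cong) auto
  then show "p - vec d c \<in> ellipsoid d (mat d d (\<lambda>(i, j). M i j))"
    using assms by (simp add: ellipsoid_eq)
qed

lemma mem_translate_dilate_ellipsoid:
  assumes "p \<in> translate (vec d c) (dilate \<alpha> (ellipsoid d (mat d d (\<lambda>(i, j). M i j))))"
  shows "p \<in> carrier_vec d" "gauge d M c (($) p) \<le> \<alpha>\<^sup>2"
proof -
  obtain x where x: "x \<in> carrier_vec d" "ip d (mv d M (($) x)) (mv d M (($) x)) \<le> 1"
    and p: "p = vec d c + \<alpha> \<cdot>\<^sub>v x"
    using assms by (auto simp: translate_def dilate_def ellipsoid_eq)
  show "p \<in> carrier_vec d" using x p by simp
  have "mv d M (\<lambda>j. p $ j - c j) i = \<alpha> * mv d M (($) x) i + 0 * mv d M (($) x) i" for i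
    unfolding mv_axpy[THEN fun_cong, symmetric] using x p by (intro mv_cong) auto
  then have "gauge d M c (($) p) = \<alpha>\<^sup>2 * ip d (mv d M (($) x)) (mv d M (($) x))"
    unfolding gauge_def by (simp add: ip_def power2_eq_square sum_distrib_left ac_simps)
  also have "\<dots> \<le> \<alpha>\<^sup>2 * 1" using x by (intro mult_left_mono) auto
  finally show "gauge d M c (($) p) \<le> \<alpha>\<^sup>2" by simp
qed

lemma weighted_square_le:
  fixes w y :: "nat \<Rightarrow> real"
  assumes "\<And>i. i < m \<Longrightarrow> 0 \<le> w i" "(\<Sum>i<m. w i) = 1"
  shows "(\<Sum>i<m. w i * y i)\<^sup>2 \<le> (\<Sum>i<m. w i * (y i)\<^sup>2)"
proof -
  let ?s = "\<Sum>i<m. w i * y i"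
  have "0 \<le> (\<Sum>i<m. w i * (y i - ?s)\<^sup>2)" using assms(1) by (intro sum_nonneg) simp
  also have "\<dots> = (\<Sum>i<m. w i * (y i)\<^sup>2 - 2 * ?s * (w i * y i) + ?s\<^sup>2 * w i)"
    by (rule sum.cong) (auto simp: power2_eq_square algebra_simps)
  also have "\<dots> = (\<Sum>i<m. w i * (y i)\<^sup>2) - 2 * ?s * ?s + ?s\<^sup>2 * (\<Sum>i<m. w i)"
    by (simp only: sum.distrib sum_subtractf sum_distrib_left)
  finally show ?thesis using assms(2) by (simp add: power2_eq_square)
qed

lemma gauge_conv_le:
  assumes p: "p \<in> conv d zs" and le: "\<And>i. i < length zs \<Longrightarrow> gauge d M c (($) (zs ! i)) \<le> B"
  shows "gauge d M c (($) p) \<le> B"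
proof -
  let ?m = "length zs"
  obtain w where w: "\<And>i. i < ?m \<Longrightarrow> 0 \<le> w i" "(\<Sum>i<?m. w i) = 1"
    and p: "p = vec d (\<lambda>j. \<Sum>i<?m. w i * (zs ! i) $ j)"
    using p by (auto simp: conv_def)
  define y where "y i = mv d M (\<lambda>j. (zs ! i) $ j - c j)" for i
  have row: "mv d M (\<lambda>j. p $ j - c j) k = (\<Sum>i<?m. w i * y i k)" for k
  proof -
    have "mv d M (\<lambda>j. p $ j - c j) k = mv d M (\<lambda>j. \<Sum>i<?m. w i * ((zs ! i) $ j - c j)) k"
    proof (rule mv_cong)
      fix j assume "j < d"
      then show "p $ j - c j = (\<Sum>i<?m. w i * ((zs ! i) $ j - c j))"
        using w(2) by (simp add: p right_diff_distrib sum_subtractf sum_distrib_right[symmetric])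
    qed simp
    also have "\<dots> = (\<Sum>j<d. \<Sum>i<?m. w i * (M k j * ((zs ! i) $ j - c j)))"
      by (simp add: mv_def sum_distrib_left mult.left_commute)
    also have "\<dots> = (\<Sum>i<?m. w i * y i k)"
      by (subst sum.swap) (simp add: y_def mv_def sum_distrib_left)
    finally show ?thesis .
  qed
  have "gauge d M c (($) p) = (\<Sum>k<d. (\<Sum>i<?m. w i * y i k)\<^sup>2)"
    unfolding gauge_def row by (simp add: ip_def power2_eq_square)
  also have "\<dots> \<le> (\<Sum>k<d. \<Sum>i<?m. w i * (y i k)\<^sup>2)"
    using w by (intro sum_mono weighted_square_le) auto
  also have "\<dots> = (\<Sum>i<?m. w i * gauge d M c (($) (zs ! i)))"
    by (subst sum.swap) (simp add: gauge_def ip_def y_def sum_distrib_left power2_eq_square)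
  also have "\<dots> \<le> (\<Sum>i<?m. w i * B)" using w le by (intro sum_mono mult_left_mono) auto
  also have "\<dots> = B" using w(2) by (simp add: sum_distrib_right[symmetric])
  finally show ?thesis .
qed

lemma conv_convex:
  assumes "vec d x \<in> conv d zs" "vec d y \<in> conv d zs" "0 \<le> \<theta>" "\<theta> \<le> 1"
  shows "vec d (\<lambda>i. \<theta> * x i + (1 - \<theta>) * y i) \<in> conv d zs"
proof -
  let ?m = "length zs"
  obtain v where v: "\<And>i. i < ?m \<Longrightarrow> 0 \<le> v i" "(\<Sum>i<?m. v i) = 1"
    and x: "vec d x = vec d (\<lambda>j. \<Sum>i<?m. v i * (zs ! i) $ j)"
    using assms(1) by (auto simp: conv_def)
  obtain w where w: "\<And>i. i < ?m \<Longrightarrow> 0 \<le> w i" "(\<Sum>i<?m. w i) = 1"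
    and y: "vec d y = vec d (\<lambda>j. \<Sum>i<?m. w i * (zs ! i) $ j)"
    using assms(2) by (auto simp: conv_def)
  have xy: "x j = (\<Sum>i<?m. v i * (zs ! i) $ j)" "y j = (\<Sum>i<?m. w i * (zs ! i) $ j)" if "j < d" for j
    using arg_cong[OF x, of "\<lambda>p. p $ j"] arg_cong[OF y, of "\<lambda>p. p $ j"] that by simp_all
  show ?thesis
    unfolding conv_def
  proof (intro CollectI exI conjI)
    show "vec d (\<lambda>i. \<theta> * x i + (1 - \<theta>) * y i)
        = vec d (\<lambda>j. \<Sum>i<?m. (\<theta> * v i + (1 - \<theta>) * w i) * (zs ! i) $ j)"
      by (intro eq_vecI) (simp_all add: xy sum_distrib_left sum.distrib distrib_right mult.assoc)
    show "\<forall>i<?m. 0 \<le> \<theta> * v i + (1 - \<theta>) * w i" using assms v w by simp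
    show "(\<Sum>i<?m. \<theta> * v i + (1 - \<theta>) * w i) = 1"
      using v w by (simp add: sum.distrib sum_distrib_left[symmetric])
  qed
qed

lemma nth_in_conv:
  assumes "k < length zs" "set zs \<subseteq> carrier_vec d"
  shows "zs ! k \<in> conv d zs"
  unfolding conv_def
proof (intro CollectI exI conjI)
  have "zs ! k \<in> carrier_vec d" using assms by auto
  moreover have "(\<Sum>i<length zs. (if i = k then 1 else 0) * (zs ! i) $ j) = (zs ! k) $ j" for j
    using assms(1) by (subst sum.remove[of _ k]) auto
  ultimately show "zs ! k = vec d (\<lambda>j. \<Sum>i<length zs. (if i = k then 1 else 0) * (zs ! i) $ j)"
    by (intro eq_vecI) auto
qed (use assms(1) in auto)

lemma ip_diff_le: "ip d (\<lambda>i. x i - y i) (\<lambda>i. x i - y i) \<le> 2 * ip d x x + 2 * ip d y y"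
proof -
  have "(x i - y i) * (x i - y i) \<le> 2 * (x i * x i) + 2 * (y i * y i)" for i
    using zero_le_square[of "x i + y i"] by (simp add: algebra_simps)
  then show ?thesis unfolding ip_def sum_distrib_left sum.distrib[symmetric] by (intro sum_mono)
qed

lemma conv_distance_le:
  assumes p: "p \<in> conv d zs" and q: "q \<in> conv d zs"
  shows "sqrt (ip d (\<lambda>i. p $ i - q $ i) (\<lambda>i. p $ i - q $ i)) \<le> 2 * circumradius d (conv d zs)"
proof -
  let ?D = "sqrt (ip d (\<lambda>i. p $ i - q $ i) (\<lambda>i. p $ i - q $ i))"
  let ?R = "{R. 0 \<le> R \<and> (\<exists>c \<in> carrier_vec d. conv d zs \<subseteq> translate c (dilate R (unit_ball d)))}"
  have "?D / 2 \<le> Inf ?R"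
  proof (rule cInf_greatest)
    let ?I = "\<lambda>i j. if i = j then 1 else 0 :: real"
    define S where "S = (\<Sum>i<length zs. gauge d ?I (\<lambda>_. 0) (($) (zs ! i)))"
    have I: "mv d ?I x i = x i" if "i < d" for x i
    proof -
      have "mv d ?I x i = (\<Sum>j<d. if i = j then x j else 0)" unfolding mv_def by (rule sum.cong) auto
      then show ?thesis using that by simp
    qed
    have gI: "gauge d ?I (\<lambda>_. 0) x = ip d x x" for x
      unfolding gauge_def by (intro ip_cong) (simp_all add: I)
    have S0: "0 \<le> S" unfolding S_def gI by (intro sum_nonneg ip_nonneg)
    have "conv d zs \<subseteq> translate (0\<^sub>v d) (dilate (1 + S) (unit_ball d))"
    proof
      fix p assume p: "p \<in> conv d zs"
      then have pc: "p \<in> carrier_vec d" by (auto simp: conv_def)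
      have "gauge d ?I (\<lambda>_. 0) (($) p) \<le> S"
        using p
      proof (rule gauge_conv_le)
        fix i assume "i < length zs"
        then show "gauge d ?I (\<lambda>_. 0) (($) (zs ! i)) \<le> S"
          unfolding S_def gI by (intro member_le_sum) (auto simp: ip_nonneg)
      qed
      then have "ip d (($) p) (($) p) \<le> S" by (simp only: gI)
      also have "\<dots> \<le> (1 + S)\<^sup>2" using S0 by (simp add: power2_eq_square algebra_simps)
      finally have le: "ip d (($) p) (($) p) \<le> (1 + S)\<^sup>2" .
      let ?y = "(1 / (1 + S)) \<cdot>\<^sub>v p"
      have "ip d (($) ?y) (($) ?y) = ip d (($) p) (($) p) / (1 + S)\<^sup>2"
        using pc by (simp add: ip_def power2_eq_square sum_divide_distrib)
      also have "\<dots> \<le> 1" using le S0 by (simp add: divide_le_eq)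
      finally have "?y \<in> unit_ball d" using pc by (simp add: unit_ball_def enorm_eq[of _ d])
      moreover have "p = 0\<^sub>v d + (1 + S) \<cdot>\<^sub>v ?y" using pc S0 by (intro eq_vecI) auto
      ultimately show "p \<in> translate (0\<^sub>v d) (dilate (1 + S) (unit_ball d))"
        unfolding translate_def dilate_def by blast
    qed
    then have "1 + S \<in> ?R" using S0 by auto
    then show "?R \<noteq> {}" by blast
    fix R assume "R \<in> ?R"
    then obtain c where R: "0 \<le> R" and c: "c \<in> carrier_vec d"
      and sub: "conv d zs \<subseteq> translate c (dilate R (unit_ball d))" by blast
    obtain x y where x: "x \<in> unit_ball d" "p = c + R \<cdot>\<^sub>v x" and y: "y \<in> unit_ball d" "q = c + R \<cdot>\<^sub>v y"
      using sub p q unfolding translate_def dilate_def by blast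
    have xy: "x \<in> carrier_vec d" "y \<in> carrier_vec d" "ip d (($) x) (($) x) \<le> 1" "ip d (($) y) (($) y) \<le> 1"
      using x y by (auto simp: unit_ball_def enorm_eq[of _ d])
    have "ip d (\<lambda>i. p $ i - q $ i) (\<lambda>i. p $ i - q $ i) = R\<^sup>2 * ip d (\<lambda>i. x $ i - y $ i) (\<lambda>i. x $ i - y $ i)"
      unfolding ip_def sum_distrib_left using x y xy c
      by (intro sum.cong) (auto simp: power2_eq_square algebra_simps)
    also have "\<dots> \<le> R\<^sup>2 * (2 * 1 + 2 * 1)"
      using ip_diff_le[of d "($) x" "($) y"] xy by (intro mult_left_mono) auto
    finally have "?D \<le> sqrt ((2 * R)\<^sup>2)" by (intro real_sqrt_le_mono) (simp add: power_mult_distrib)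
    also have "\<dots> = 2 * R" using R by (subst real_sqrt_abs) simp
    finally show "?D / 2 \<le> R" by simp
  qed
  then show ?thesis by (simp add: circumradius_def)
qed

section \<open>Reasoning about programs\<close>

type_synonym memory = "arr \<Rightarrow> nat \<Rightarrow> nat \<Rightarrow> real"

definition mem :: "(cell \<Rightarrow> real option) \<Rightarrow> memory" where
  "mem m a i j = load (undefined, m) (a, i, j)"

definition st :: "(ireg \<Rightarrow> nat) \<Rightarrow> memory \<Rightarrow> state" where
  "st \<rho> f = (\<rho>, \<lambda>(a, i, j). Some (f a i j))"

lemma load_st [simp]: "load (st \<rho> f) (a, i, j) = f a i j"
  by (simp add: st_def)

lemma fst_st [simp]: "fst (st \<rho> f) = \<rho>"
  by (simp add: st_def)

lemma ival_st: "ival e (\<rho>, m) = ival e (st \<rho> (mem m))"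
  by (induction e) auto

lemma rval_st: "rval e (\<rho>, m) = rval e (st \<rho> (mem m))"
  
proof (induction e)
  case (Cell a i j)
  show ?case unfolding rval.simps ival_st load_st by (simp add: mem_def)
qed simp_all

lemma bval_st: "bval b (\<rho>, m) = bval b (st \<rho> (mem m))"
  by (induction b) (auto simp: ival_st rval_st)

definition put :: "memory \<Rightarrow> arr \<Rightarrow> nat \<Rightarrow> nat \<Rightarrow> real \<Rightarrow> memory" where
  "put f a i j x = f(a := (f a)(i := (f a i)(j := x)))"

lemma mem_upd: "mem (m((a, i, j) \<mapsto> x)) = put (mem m) a i j x"
  by (auto simp: put_def mem_def fun_eq_iff)

definition arrays :: "arr set" where
  "arrays = {Point, Center0, Radius0, OutMatrix, OutCenter, OutAlpha} \<union> Work ` {..<12}"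

definition cells :: "nat \<Rightarrow> cell set" where
  "cells d = arrays \<times> {..<d} \<times> {..<d}"

definition agree :: "nat \<Rightarrow> (ireg \<Rightarrow> nat) \<Rightarrow> (ireg \<Rightarrow> nat) \<Rightarrow> bool" where
  "agree n \<rho> \<rho>' \<longleftrightarrow> (\<forall>x. (\<forall>k<n. x \<noteq> Reg k) \<longrightarrow> \<rho>' x = \<rho> x)"

definition runs :: "nat \<Rightarrow> nat \<Rightarrow> com \<Rightarrow> (ireg \<Rightarrow> nat) \<Rightarrow> memory \<Rightarrow> memory \<Rightarrow> nat \<Rightarrow> bool" where
  "runs d n c \<rho> f g B \<longleftrightarrow> (\<forall>m. mem m = f \<longrightarrow> dom m \<subseteq> cells d \<longrightarrow>
     (\<exists>t \<rho>' m'. exec c (\<rho>, m) t (\<rho>', m') \<and> t \<le> B \<and> agree n \<rho> \<rho>' \<and> mem m' = g \<and> dom m' \<subseteq> cells d))"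

lemma agree_refl [simp]: "agree n \<rho> \<rho>"
  by (simp add: agree_def)

lemma agree_trans: "agree n \<rho> \<rho>' \<Longrightarrow> agree n \<rho>' \<rho>'' \<Longrightarrow> agree n \<rho> \<rho>''"
  by (simp add: agree_def)

lemma agree_Dim: "agree n \<rho> \<rho>' \<Longrightarrow> \<rho>' Dim = \<rho> Dim"
  by (auto simp: agree_def)

lemma agree_Reg: "agree n \<rho> \<rho>' \<Longrightarrow> n \<le> k \<Longrightarrow> \<rho>' (Reg k) = \<rho> (Reg k)"
  by (auto simp: agree_def)

lemma agree_mono: "agree n \<rho> \<rho>' \<Longrightarrow> n \<le> k \<Longrightarrow> agree k \<rho> \<rho>'"
  by (auto simp: agree_def)

lemma runs_mono: "runs d n c \<rho> f g B \<Longrightarrow> n \<le> k \<Longrightarrow> B \<le> B' \<Longrightarrow> runs d k c \<rho> f g B'"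
  unfolding runs_def
proof (intro allI impI)
  fix m
  assume le: "n \<le> k" "B \<le> B'" and m: "mem m = f" "dom m \<subseteq> cells d"
    and "\<forall>m. mem m = f \<longrightarrow> dom m \<subseteq> cells d \<longrightarrow>
     (\<exists>t \<rho>' m'. exec c (\<rho>, m) t (\<rho>', m') \<and> t \<le> B \<and> agree n \<rho> \<rho>' \<and> mem m' = g \<and> dom m' \<subseteq> cells d)"
  then obtain t \<rho>' m' where "exec c (\<rho>, m) t (\<rho>', m')" "t \<le> B" "agree n \<rho> \<rho>'" "mem m' = g" "dom m' \<subseteq> cells d"
    by blast
  then show "\<exists>t \<rho>' m'. exec c (\<rho>, m) t (\<rho>', m') \<and> t \<le> B' \<and> agree k \<rho> \<rho>' \<and> mem m' = g \<and> dom m' \<subseteq> cells d"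
    using le agree_mono by (intro exI[of _ t] exI[of _ \<rho>'] exI[of _ m']) auto
qed

lemma runs_RAssign:
  assumes "a \<in> arrays" "ival i (st \<rho> f) < d" "ival j (st \<rho> f) < d"
  shows "runs d n (RAssign a i j e) \<rho> f
    (put f a (ival i (st \<rho> f)) (ival j (st \<rho> f)) (rval e (st \<rho> f))) (icost i + icost j + rcost e + 1)"
  unfolding runs_def
proof (intro allI impI exI conjI)
  fix m assume m: "mem m = f" "dom m \<subseteq> cells d"
  show "exec (RAssign a i j e) (\<rho>, m) (icost i + icost j + rcost e + 1)
      (\<rho>, m((a, ival i (\<rho>, m), ival j (\<rho>, m)) \<mapsto> rval e (\<rho>, m)))"
    by (rule exec_RAssign)
  show "mem (m((a, ival i (\<rho>, m), ival j (\<rho>, m)) \<mapsto> rval e (\<rho>, m)))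
      = put f a (ival i (st \<rho> f)) (ival j (st \<rho> f)) (rval e (st \<rho> f))"
    by (simp add: mem_upd ival_st rval_st m)
  show "dom (m((a, ival i (\<rho>, m), ival j (\<rho>, m)) \<mapsto> rval e (\<rho>, m))) \<subseteq> cells d"
    using m assms by (auto simp: ival_st cells_def)
qed auto

lemma runs_Skip: "runs d n Skip \<rho> f f 1"
  unfolding runs_def
proof (intro allI impI exI conjI)
  show "exec Skip (\<rho>, m) 1 (\<rho>, m)" for m by (rule exec_Skip)
qed auto

lemma runs_Seq:
  assumes "runs d n c1 \<rho> f g B1" "\<And>\<rho>'. agree n \<rho> \<rho>' \<Longrightarrow> runs d n c2 \<rho>' g h B2"
  shows "runs d n (Seq c1 c2) \<rho> f h (B1 + B2)"
  unfolding runs_def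
proof (intro allI impI)
  fix m assume "mem m = f" "dom m \<subseteq> cells d"
  then obtain t1 \<rho>1 m1 where 1: "exec c1 (\<rho>, m) t1 (\<rho>1, m1)" "t1 \<le> B1" "agree n \<rho> \<rho>1" "mem m1 = g"
      "dom m1 \<subseteq> cells d"
    using assms(1) unfolding runs_def by blast
  then obtain t2 \<rho>2 m2 where 2: "exec c2 (\<rho>1, m1) t2 (\<rho>2, m2)" "t2 \<le> B2" "agree n \<rho>1 \<rho>2" "mem m2 = h"
      "dom m2 \<subseteq> cells d"
    using assms(2) unfolding runs_def by blast
  show "\<exists>t \<rho>' m'. exec (Seq c1 c2) (\<rho>, m) t (\<rho>', m') \<and> t \<le> B1 + B2 \<and> agree n \<rho> \<rho>' \<and> mem m' = h
      \<and> dom m' \<subseteq> cells d"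
    using exec_Seq[OF 1(1) 2(1)] 1 2 agree_trans[OF 1(3) 2(3)]
    by (intro exI[of _ "t1 + t2"] exI[of _ \<rho>2] exI[of _ m2]) auto
qed

lemma runs_If:
  assumes "bval b (st \<rho> f) \<Longrightarrow> runs d n c1 \<rho> f g1 B1" "\<not> bval b (st \<rho> f) \<Longrightarrow> runs d n c2 \<rho> f g2 B2"
  shows "runs d n (If b c1 c2) \<rho> f (if bval b (st \<rho> f) then g1 else g2) (bcost b + (B1 + B2))"
  unfolding runs_def
proof (intro allI impI)
  fix m assume m: "mem m = f" "dom m \<subseteq> cells d"
  show "\<exists>t \<rho>' m'. exec (If b c1 c2) (\<rho>, m) t (\<rho>', m') \<and> t \<le> bcost b + (B1 + B2) \<and> agree n \<rho> \<rho>'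
      \<and> mem m' = (if bval b (st \<rho> f) then g1 else g2) \<and> dom m' \<subseteq> cells d"
  proof (cases "bval b (st \<rho> f)")
    case True
    then obtain t \<rho>1 m1 where 1: "exec c1 (\<rho>, m) t (\<rho>1, m1)" "t \<le> B1" "agree n \<rho> \<rho>1" "mem m1 = g1"
        "dom m1 \<subseteq> cells d"
      using assms(1) m unfolding runs_def by blast
    have "exec (If b c1 c2) (\<rho>, m) (bcost b + t) (\<rho>1, m1)"
      using True 1 m by (intro exec_IfTrue) (simp_all add: bval_st)
    then show ?thesis using True 1 by (intro exI[of _ "bcost b + t"]) auto
  next
    case False
    then obtain t \<rho>1 m1 where 1: "exec c2 (\<rho>, m) t (\<rho>1, m1)" "t \<le> B2" "agree n \<rho> \<rho>1" "mem m1 = g2"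
        "dom m1 \<subseteq> cells d"
      using assms(2) m unfolding runs_def by blast
    have "exec (If b c1 c2) (\<rho>, m) (bcost b + t) (\<rho>1, m1)"
      using False 1 m by (intro exec_IfFalse) (simp_all add: bval_st)
    then show ?thesis using False 1 by (intro exI[of _ "bcost b + t"]) auto
  qed
qed

definition For :: "nat \<Rightarrow> com \<Rightarrow> com" where
  "For n c = Seq (IAssign (Reg n) (IConst 0))
     (While (ILess (IVar (Reg n)) (IVar Dim)) (Seq c (IAssign (Reg n) (ISuc (IVar (Reg n))))))"

lemma runs_For:
  assumes d: "\<rho> Dim = d"
    and body: "\<And>i \<rho>'. i < d \<Longrightarrow> agree (Suc n) \<rho> \<rho>' \<Longrightarrow> \<rho>' (Reg n) = i \<Longrightarrow> \<rho>' Dim = d \<Longrightarrow>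
      runs d n c \<rho>' (F i) (F (Suc i)) B"
  shows "runs d (Suc n) (For n c) \<rho> (F 0) (F d) (5 + d * (B + 6))"
proof -
  let ?b = "ILess (IVar (Reg n)) (IVar Dim)" and ?i = "IAssign (Reg n) (ISuc (IVar (Reg n)))"
  have loop: "\<exists>t \<rho>'' m'. exec (While ?b (Seq c ?i)) (\<rho>', m) t (\<rho>'', m') \<and> t \<le> 3 + k * (B + 6)
      \<and> agree (Suc n) \<rho> \<rho>'' \<and> mem m' = F d \<and> dom m' \<subseteq> cells d"
    if "\<rho>' (Reg n) + k = d" "agree (Suc n) \<rho> \<rho>'" "mem m = F (\<rho>' (Reg n))" "dom m \<subseteq> cells d" for k \<rho>' m
    using that
  proof (induction k arbitrary: \<rho>' m)
    case 0
    have "\<rho>' Dim = d" using agree_Dim[OF 0(2)] d by simp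
    then have "exec (While ?b (Seq c ?i)) (\<rho>', m) (bcost ?b) (\<rho>', m)"
      using 0 by (intro exec_WhileFalse) simp
    then show ?case using 0 by (intro exI[of _ "bcost ?b"]) auto
  next
    case (Suc k)
    have D: "\<rho>' Dim = d" using agree_Dim[OF Suc(3)] d by simp
    have "\<rho>' (Reg n) < d" using Suc(2) by simp
    from body[OF this Suc(3) refl D] Suc(4,5) obtain t \<rho>1 m1 where
      1: "exec c (\<rho>', m) t (\<rho>1, m1)" "t \<le> B" "agree n \<rho>' \<rho>1" "mem m1 = F (Suc (\<rho>' (Reg n)))" "dom m1 \<subseteq> cells d"
      unfolding runs_def by blast
    have r: "\<rho>1 (Reg n) = \<rho>' (Reg n)" using agree_Reg[OF 1(3)] by simp
    define \<rho>2 where "\<rho>2 = \<rho>1(Reg n := Suc (\<rho>' (Reg n)))"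
    have i: "exec ?i (\<rho>1, m1) 3 (\<rho>2, m1)"
      using exec_IAssign[of "Reg n" "ISuc (IVar (Reg n))" \<rho>1 m1] r by (simp add: \<rho>2_def numeral_3_eq_3)
    have a2: "agree (Suc n) \<rho> \<rho>2"
      using Suc(3) 1(3) by (simp add: \<rho>2_def agree_def less_Suc_eq)
    have r2: "\<rho>2 (Reg n) + k = d" "mem m1 = F (\<rho>2 (Reg n))" using Suc(2) 1(4) by (simp_all add: \<rho>2_def)
    obtain t' \<rho>3 m3 where
      3: "exec (While ?b (Seq c ?i)) (\<rho>2, m1) t' (\<rho>3, m3)" "t' \<le> 3 + k * (B + 6)"
        "agree (Suc n) \<rho> \<rho>3" "mem m3 = F d" "dom m3 \<subseteq> cells d"
      using Suc.IH[OF r2(1) a2 r2(2) 1(5)] by blast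
    have "exec (While ?b (Seq c ?i)) (\<rho>', m) (bcost ?b + (t + 3) + t') (\<rho>3, m3)"
      using Suc(2) D by (intro exec_WhileTrue[OF _ exec_Seq[OF 1(1) i] 3(1)]) simp
    then show ?case using 3 1(2) by (intro exI[of _ "bcost ?b + (t + 3) + t'"] exI[of _ \<rho>3] exI[of _ m3]) auto
  qed
  show ?thesis
    unfolding runs_def
  proof (intro allI impI)
    fix m assume m: "mem m = F 0" "dom m \<subseteq> cells d"
    have i: "exec (IAssign (Reg n) (IConst 0)) (\<rho>, m) 2 (\<rho>(Reg n := 0), m)"
      using exec_IAssign[of "Reg n" "IConst 0" \<rho> m] by (simp add: numeral_2_eq_2)
    have "agree (Suc n) \<rho> (\<rho>(Reg n := 0))" by (simp add: agree_def)
    then obtain t \<rho>' m' where 1: "exec (While ?b (Seq c ?i)) (\<rho>(Reg n := 0), m) t (\<rho>', m')"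
      "t \<le> 3 + d * (B + 6)" "agree (Suc n) \<rho> \<rho>'" "mem m' = F d" "dom m' \<subseteq> cells d"
      using loop[of "\<rho>(Reg n := 0)" d m] m by auto
    show "\<exists>t \<rho>' m'. exec (For n c) (\<rho>, m) t (\<rho>', m') \<and> t \<le> 5 + d * (B + 6) \<and> agree (Suc n) \<rho> \<rho>'
      \<and> mem m' = F d \<and> dom m' \<subseteq> cells d"
      using exec_Seq[OF i 1(1)] 1 unfolding For_def by (intro exI[of _ "2 + t"] exI[of _ \<rho>'] exI[of _ m']) auto
  qed
qed

lemma runs_ForI:
  assumes "\<rho> Dim = d"
    and "\<And>i \<rho>'. i < d \<Longrightarrow> agree (Suc n) \<rho> \<rho>' \<Longrightarrow> \<rho>' (Reg n) = i \<Longrightarrow> \<rho>' Dim = d \<Longrightarrow>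
      runs d n c \<rho>' (F i) (F (Suc i)) B"
    and "F 0 = f" "F d = g" "Suc n \<le> k" "5 + d * (B + 6) \<le> B'"
  shows "runs d k (For n c) \<rho> f g B'"
  using runs_mono[OF runs_For[where \<rho> = \<rho> and d = d and F = F, OF assms(1,2)] assms(5,6)]
  unfolding assms(3,4) .

lemma runs_RAssignI:
  assumes "a \<in> arrays" "ival i (st \<rho> f) = x" "ival j (st \<rho> f) = y" "x < d" "y < d"
    and "put f a x y (rval e (st \<rho> f)) = g" "icost i + icost j + rcost e + 1 \<le> B"
  shows "runs d n (RAssign a i j e) \<rho> f g B"
proof -
  have "runs d n (RAssign a i j e) \<rho> f (put f a (ival i (st \<rho> f)) (ival j (st \<rho> f)) (rval e (st \<rho> f)))
      (icost i + icost j + rcost e + 1)"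
    using assms(1,4,5) by (intro runs_RAssign) (simp_all only: assms(2,3))
  then show ?thesis unfolding assms(2,3,6) by (rule runs_mono) (simp_all only: assms(7) le_refl)
qed

definition region :: "memory \<Rightarrow> arr \<Rightarrow> (nat \<times> nat) set \<Rightarrow> (nat \<Rightarrow> nat \<Rightarrow> real) \<Rightarrow> memory" where
  "region f a S g = (\<lambda>b p q. if b = a \<and> (p, q) \<in> S then g p q else f b p q)"

lemma put_apply: "put f a i j x b p q = (if b = a \<and> p = i \<and> q = j then x else f b p q)"
  by (simp add: put_def)

lemma put_region: "put (region f a S g) a i j (g i j) = region f a (insert (i, j) S) g"
  by (auto simp: region_def put_apply fun_eq_iff)

lemma put_same: "put f a i j (f a i j) = f"
  by (intro ext) (simp add: put_apply)

lemma region_empty: "region f a {} g = f"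
  by (simp add: region_def)

lemma runs_vector:
  assumes d: "\<rho> Dim = d" "0 < d" and a: "a \<in> arrays"
    and e: "\<And>i \<rho>'. i < d \<Longrightarrow> agree 1 \<rho> \<rho>' \<Longrightarrow> \<rho>' (Reg 0) = i \<Longrightarrow>
      rval e (st \<rho>' (region f a ({..<i} \<times> {0}) (\<lambda>p q. g p))) = g i"
  shows "runs d 1 (For 0 (RAssign a (IVar (Reg 0)) (IConst 0) e)) \<rho> f
    (region f a ({..<d} \<times> {0}) (\<lambda>p q. g p)) (5 + d * (rcost e + 9))"
proof -
  have body: "runs d 0 (RAssign a (IVar (Reg 0)) (IConst 0) e) \<rho>' (region f a ({..<i} \<times> {0}) (\<lambda>p q. g p))
      (region f a ({..<Suc i} \<times> {0}) (\<lambda>p q. g p)) (rcost e + 3)"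
    if i: "i < d" "agree (Suc 0) \<rho> \<rho>'" "\<rho>' (Reg 0) = i" "\<rho>' Dim = d" for i \<rho>'
  proof -
    let ?f = "region f a ({..<i} \<times> {0}) (\<lambda>p q. g p)"
    have S: "{..<Suc i} \<times> {0} = insert (i, 0) ({..<i} \<times> {0::nat})" by (auto simp: less_Suc_eq)
    have v: "rval e (st \<rho>' ?f) = g i" using i(1-3) by (intro e) simp_all
    show ?thesis
    proof (rule runs_RAssignI[OF a])
      show "put ?f a i 0 (rval e (st \<rho>' ?f)) = region f a ({..<Suc i} \<times> {0}) (\<lambda>p q. g p)"
        unfolding v S by (rule put_region)
    qed (use i(1,3) d(2) in simp_all)
  qed
  show ?thesis
    by (rule runs_ForI[where F = "\<lambda>i. region f a ({..<i} \<times> {0}) (\<lambda>p q. g p)"],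
        rule d(1), erule (3) body) (simp_all add: region_empty)
qed

lemma runs_accumulate:
  assumes d: "\<rho> Dim = d" "0 < d" and a: "a \<in> arrays" and x: "x < d"
    and i: "\<And>\<rho>' f'. agree 1 \<rho> \<rho>' \<Longrightarrow> ival i (st \<rho>' f') = x"
    and e: "\<And>k \<rho>' y. k < d \<Longrightarrow> agree 1 \<rho> \<rho>' \<Longrightarrow> \<rho>' (Reg 0) = k \<Longrightarrow>
      rval e (st \<rho>' (put f a x 0 y)) = g k"
  shows "runs d 1 (For 0 (RAssign a i (IConst 0) (Add (Cell a i (IConst 0)) e))) \<rho> f
    (put f a x 0 (f a x 0 + (\<Sum>k<d. g k))) (5 + d * (2 * icost i + rcost e + 11))"
proof -
  have body: "runs d 0 (RAssign a i (IConst 0) (Add (Cell a i (IConst 0)) e)) \<rho>'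
      (put f a x 0 (f a x 0 + (\<Sum>j<k. g j))) (put f a x 0 (f a x 0 + (\<Sum>j<Suc k. g j)))
      (icost i + 1 + (icost i + 1 + 1 + rcost e + 1) + 1)"
    if k: "k < d" "agree (Suc 0) \<rho> \<rho>'" "\<rho>' (Reg 0) = k" "\<rho>' Dim = d" for k \<rho>'
  proof -
    let ?f = "put f a x 0 (f a x 0 + (\<Sum>j<k. g j))"
    have v: "ival i (st \<rho>' ?f) = x" "rval e (st \<rho>' ?f) = g k" "ival i (st \<rho>' ?f) < d"
      using k x by (auto simp: i intro!: e)
    have p: "put ?f a x 0 (?f a x 0 + g k) = put f a x 0 (f a x 0 + (\<Sum>j<Suc k. g j))"
      by (intro ext) (simp add: put_apply)
    show ?thesis
      by (rule runs_RAssignI[OF a v(1) ival.simps(1) x d(2)]) (simp_all only: rval.simps load_st ival.simps v p icost.simps rcost.simps le_refl)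
  qed
  show ?thesis
    by (rule runs_ForI[where F = "\<lambda>k. put f a x 0 (f a x 0 + (\<Sum>j<k. g j))"],
        rule d(1), erule (3) body) (simp_all add: put_same)
qed

lemma runs_matrix:
  assumes d: "\<rho> Dim = d" and a: "a \<in> arrays"
    and e: "\<And>i j S \<rho>'. i < d \<Longrightarrow> j < d \<Longrightarrow> (i, j) \<notin> S \<Longrightarrow> \<rho>' (Reg 1) = i \<Longrightarrow> \<rho>' (Reg 0) = j \<Longrightarrow>
      rval e (st \<rho>' (region f a S g)) = g i j"
  shows "runs d 2 (For 1 (For 0 (RAssign a (IVar (Reg 1)) (IVar (Reg 0)) e))) \<rho> f
    (region f a ({..<d} \<times> {..<d}) g) (5 + d * (5 + d * (rcost e + 9) + 6))"
proof -
  have row: "runs d 1 (For 0 (RAssign a (IVar (Reg 1)) (IVar (Reg 0)) e)) \<rho>1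
      (region f a ({..<i} \<times> {..<d}) g) (region f a ({..<Suc i} \<times> {..<d}) g) (5 + d * (rcost e + 9))"
    if i: "i < d" "agree (Suc 1) \<rho> \<rho>1" "\<rho>1 (Reg 1) = i" "\<rho>1 Dim = d" for i \<rho>1
  proof -
    have body: "runs d 0 (RAssign a (IVar (Reg 1)) (IVar (Reg 0)) e) \<rho>'
      (region f a ({..<i} \<times> {..<d} \<union> {i} \<times> {..<j}) g)
      (region f a ({..<i} \<times> {..<d} \<union> {i} \<times> {..<Suc j}) g) (1 + 1 + rcost e + 1)"
      if j: "j < d" "agree (Suc 0) \<rho>1 \<rho>'" "\<rho>' (Reg 0) = j" "\<rho>' Dim = d" for j \<rho>'
    proof -
      let ?S = "{..<i} \<times> {..<d} \<union> {i} \<times> {..<j}"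
      have S: "{..<i} \<times> {..<d} \<union> {i} \<times> {..<Suc j} = insert (i, j) ?S" by (auto simp: less_Suc_eq)
      have r: "\<rho>' (Reg 1) = i" using agree_Reg[OF j(2), of 1] i(3) by (simp only: le_refl One_nat_def)
      have v: "rval e (st \<rho>' (region f a ?S g)) = g i j" by (rule e[OF i(1) j(1) _ r j(3)]) simp
      show ?thesis
        by (rule runs_RAssignI[OF a _ _ i(1) j(1)]) (use r j(3) in \<open>simp_all only: ival.simps fst_st v S put_region icost.simps le_refl\<close>)
    qed
    have S: "{..<i} \<times> {..<d} \<union> {i} \<times> {..<d} = {..<Suc i} \<times> {..<d}" by (auto simp: less_Suc_eq)
    show ?thesis
      by (rule runs_ForI[where F = "\<lambda>j. region f a ({..<i} \<times> {..<d} \<union> {i} \<times> {..<j}) g"],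
          rule i(4), erule (3) body) (simp_all add: S)
  qed
  show ?thesis
    by (rule runs_ForI[where F = "\<lambda>i. region f a ({..<i} \<times> {..<d}) g"],
        rule d, erule (3) row) (simp_all add: region_empty)
qed

abbreviation scalar :: "arr \<Rightarrow> rexp" where
  "scalar a \<equiv> Cell a (IConst 0) (IConst 0)"

abbreviation assign :: "arr \<Rightarrow> rexp \<Rightarrow> com" where
  "assign a e \<equiv> RAssign a (IConst 0) (IConst 0) e"

abbreviation entry :: "arr \<Rightarrow> nat \<Rightarrow> rexp" where
  "entry a k \<equiv> Cell a (IVar (Reg k)) (IConst 0)"

lemma runs_assign:
  assumes "a \<in> arrays" "0 < d"
  shows "runs d n (assign a e) \<rho> f (put f a 0 0 (rval e (st \<rho> f))) (rcost e + 3)"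
  using assms by (intro runs_RAssignI[where x = 0 and y = 0]) simp_all

lemma runs_assignI:
  assumes "a \<in> arrays" "0 < d" "put f a 0 0 (rval e (st \<rho> f)) = g" "rcost e + 3 \<le> B"
  shows "runs d n (assign a e) \<rho> f g B"
  using runs_mono[OF runs_assign[OF assms(1,2), of n e \<rho> f] order.refl assms(4)] unfolding assms(3) .

text \<open>Use of the work arrays: \<open>Work 0\<close> is \<open>w = z - c\<close>, \<open>Work 1\<close> is \<open>u = M w\<close>, \<open>Work 2\<close> is \<open>M\<^sup>T u\<close>. Scalars:
  \<open>Work 3\<close> is \<open>d\<close>, \<open>Work 4\<close> the threshold for the switch to growing ellipsoids, \<open>Work 5\<close> is \<open>u \<bullet> u\<close>,
  \<open>Work 6\<close> is \<open>l\<close>, \<open>Work 7\<close> the new scaling factor, \<open>Work 8\<close> and \<open>Work 9\<close> the axes \<open>a\<close> and \<open>b\<close>,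
  \<open>Work 10\<close> and \<open>Work 11\<close> the coefficients of the rank one update and of the shift of the center.\<close>

definition init_prog :: com where
  "init_prog =
    Seq (For 0 (Seq (assign (Work 3) (Add (scalar (Work 3)) (RConst 1)))
      (assign (Work 4) (Add (scalar (Work 4)) (Div (RConst 1) (scalar (Work 3)))))))
    (Seq (assign (Work 4) (Add (RConst 4) (Mul (scalar (Work 3)) (scalar (Work 4)))))
    (Seq (For 0 (RAssign OutCenter (IVar (Reg 0)) (IConst 0) (entry Center0 0)))
    (Seq (For 0 (RAssign OutMatrix (IVar (Reg 0)) (IVar (Reg 0))
      (Div (RConst 1) (Mul (RConst 4) (scalar Radius0)))))
    (assign OutAlpha (Div (RConst 1) (RConst 4))))))"

definition measure_prog :: com where
  "measure_prog =
    Seq (For 0 (RAssign (Work 0) (IVar (Reg 0)) (IConst 0) (Sub (entry Point 0) (entry OutCenter 0))))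
    (Seq (assign (Work 5) (RConst 0))
    (Seq (For 1
      (Seq (RAssign (Work 1) (IVar (Reg 1)) (IConst 0) (RConst 0))
      (Seq (For 0 (RAssign (Work 1) (IVar (Reg 1)) (IConst 0) (Add (entry (Work 1) 1)
        (Mul (Cell OutMatrix (IVar (Reg 1)) (IVar (Reg 0))) (entry (Work 0) 0)))))
      (assign (Work 5) (Add (scalar (Work 5)) (Mul (entry (Work 1) 1) (entry (Work 1) 1)))))))
    (Seq (assign (Work 6) (Sqrt (scalar (Work 5))))
    (If (RLess (scalar (Work 6)) (RConst 1)) (assign (Work 6) (RConst 1)) Skip))))"

text \<open>Setting the threshold to \<open>0\<close> makes the first branch permanent, since \<open>l\<close> is at least \<open>1\<close>.\<close>

definition axes_prog :: com where
  "axes_prog =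
    If (RLess (Mul (scalar OutAlpha) (scalar (Work 4))) (scalar (Work 6)))
      (Seq (assign (Work 4) (RConst 0))
      (Seq (assign (Work 7) (Div (RConst 1) (Add (Div (RConst 1) (scalar OutAlpha))
        (Mul (RConst 4) (Div (Sub (scalar (Work 6)) (RConst 1)) (Add (scalar (Work 6)) (scalar OutAlpha)))))))
      (Seq (assign (Work 8) (Div (Add (scalar (Work 6)) (scalar OutAlpha)) (Add (RConst 1) (scalar (Work 7)))))
      (assign (Work 9) (Sqrt (Add (RConst 1) (Mul (Mul (RConst 2) (Mul (scalar (Work 7)) (scalar (Work 7))))
        (Sub (RConst 1) (Div (RConst 1) (scalar (Work 8)))))))))))
      (Seq (assign (Work 7) (Div (scalar OutAlpha) (scalar (Work 6))))
      (Seq (assign (Work 8) (scalar (Work 6)))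
      (assign (Work 9) (scalar (Work 6)))))"

definition apply_prog :: com where
  "apply_prog =
    Seq (assign (Work 10) (Div (Sub (Div (RConst 1) (scalar (Work 8))) (Div (RConst 1) (scalar (Work 9))))
      (Mul (scalar (Work 6)) (scalar (Work 6)))))
    (Seq (assign (Work 11) (Div (Sub (scalar (Work 6)) (scalar (Work 8))) (scalar (Work 6))))
    (Seq (For 1
      (Seq (RAssign (Work 2) (IVar (Reg 1)) (IConst 0) (RConst 0))
      (For 0 (RAssign (Work 2) (IVar (Reg 1)) (IConst 0) (Add (entry (Work 2) 1)
        (Mul (entry (Work 1) 0) (Cell OutMatrix (IVar (Reg 0)) (IVar (Reg 1)))))))))
    (Seq (For 1 (For 0 (RAssign OutMatrix (IVar (Reg 1)) (IVar (Reg 0))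
      (Add (Div (Cell OutMatrix (IVar (Reg 1)) (IVar (Reg 0))) (scalar (Work 9)))
        (Mul (Mul (scalar (Work 10)) (entry (Work 1) 1)) (entry (Work 2) 0))))))
    (Seq (For 0 (RAssign OutCenter (IVar (Reg 0)) (IConst 0)
      (Add (entry OutCenter 0) (Mul (scalar (Work 11)) (entry (Work 0) 0)))))
    (assign OutAlpha (scalar (Work 7)))))))"

definition step_prog :: com where
  "step_prog = Seq measure_prog (Seq axes_prog apply_prog)"

lemma in_arrays: "Point \<in> arrays" "Center0 \<in> arrays" "Radius0 \<in> arrays" "OutMatrix \<in> arrays"
    "OutCenter \<in> arrays" "OutAlpha \<in> arrays" "k < 12 \<Longrightarrow> Work k \<in> arrays"
  by (auto simp: arrays_def)

section \<open>Correctness of the programs\<close>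

lemma linear_le_square:
  fixes d :: nat
  assumes "0 < d" "x + y \<le> k"
  shows "x + d * y \<le> k * d * d"
proof -
  have "x + d * y = x * 1 + y * d" by simp
  also have "\<dots> \<le> x * (d * d) + y * (d * d)" using assms(1) by (intro add_mono mult_left_mono) auto
  also have "\<dots> = (x + y) * (d * d)" by (simp add: algebra_simps)
  also have "\<dots> \<le> k * (d * d)" using assms(2) by (rule mult_right_mono) simp
  finally show ?thesis by (simp only: mult.assoc)
qed

lemma quadratic_le_square:
  fixes d :: nat
  assumes "0 < d" "x + y + z \<le> k"
  shows "x + d * (y + d * z) \<le> k * d * d"
proof -
  have "x + d * y \<le> (x + y) * d * d" using assms(1) by (intro linear_le_square) auto
  then have "x + d * y + d * d * z \<le> (x + y) * d * d + d * d * z" by (rule add_right_mono)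
  then have "x + d * (y + d * z) \<le> (x + y + z) * (d * d)" by (simp only: algebra_simps)
  also have "\<dots> \<le> k * (d * d)" using assms(2) by (rule mult_right_mono) simp
  finally show ?thesis by (simp only: mult.assoc)
qed

lemma init_prog_runs:
  assumes d: "\<rho> Dim = d" "0 < d" and f: "f (Work 3) 0 0 = 0" "f (Work 4) 0 0 = 0"
    and M: "\<And>i j. f OutMatrix i j = 0"
  shows "\<exists>g. runs d 2 init_prog \<rho> f g (500 * d * d)
    \<and> (\<forall>i<d. \<forall>j<d. g OutMatrix i j = (if i = j then 1 / (4 * f Radius0 0 0) else 0))
    \<and> (\<forall>i<d. g OutCenter i 0 = f Center0 i 0)
    \<and> g OutAlpha 0 0 = 1 / 4
    \<and> g (Work 4) 0 0 = 4 + real d * harm d"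
proof -
  have dd: "k \<le> 100 \<Longrightarrow> k \<le> 100 * d * d" for k
    using linear_le_square[of d k 0 100] d by simp
  define F where "F k = put (put f (Work 3) 0 0 (real k)) (Work 4) 0 0 (harm k)" for k
  define f2 where "f2 = put (F d) (Work 4) 0 0 (4 + real d * harm d)"
  define f3 where "f3 = region f2 OutCenter ({..<d} \<times> {0}) (\<lambda>p q. f Center0 p 0)"
  define G where "G k = region f3 OutMatrix ((\<lambda>i. (i, i)) ` {..<k}) (\<lambda>p q. 1 / (4 * f Radius0 0 0))" for k
  define f5 where "f5 = put (G d) OutAlpha 0 0 (1 / 4)"
  have 1: "runs d 2 (For 0 (Seq (assign (Work 3) (Add (scalar (Work 3)) (RConst 1)))
      (assign (Work 4) (Add (scalar (Work 4)) (Div (RConst 1) (scalar (Work 3))))))) \<rho> f (F d) (100 * d * d)"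
  proof -
    have "runs d 0 (Seq (assign (Work 3) (Add (scalar (Work 3)) (RConst 1)))
      (assign (Work 4) (Add (scalar (Work 4)) (Div (RConst 1) (scalar (Work 3)))))) \<rho>' (F i) (F (Suc i)) 30"
      if "i < d" "agree (Suc 0) \<rho> \<rho>'" "\<rho>' (Reg 0) = i" "\<rho>' Dim = d" for i \<rho>'
    proof -
      let ?g = "put (F i) (Work 3) 0 0 (real (Suc i))"
      have "runs d 0 (assign (Work 3) (Add (scalar (Work 3)) (RConst 1))) \<rho>' (F i) ?g 8"
        using runs_assign[of "Work 3" d 0 "Add (scalar (Work 3)) (RConst 1)" \<rho>' "F i"] d
        by (simp add: in_arrays F_def put_apply add.commute)
      moreover have "runs d 0 (assign (Work 4) (Add (scalar (Work 4)) (Div (RConst 1) (scalar (Work 3))))) \<rho>'' ?g (F (Suc i)) 12"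
        for \<rho>''
      proof -
        have "put ?g (Work 4) 0 0 (harm i + 1 / real (Suc i)) = F (Suc i)"
          by (auto simp: F_def put_apply fun_eq_iff harm_Suc divide_inverse)
        then show ?thesis
          using runs_assign[of "Work 4" d 0 "Add (scalar (Work 4)) (Div (RConst 1) (scalar (Work 3)))" \<rho>'' ?g] d
          by (simp add: in_arrays F_def put_apply)
      qed
      ultimately show ?thesis by (rule runs_mono[OF runs_Seq]) auto
    qed
    moreover have "F 0 = f" using f by (auto simp: F_def put_apply fun_eq_iff harm_def)
    ultimately show ?thesis
      by (intro runs_ForI[where F = F and B = 30] linear_le_square) (use d in simp_all)
  qed
  have 2: "runs d 2 (assign (Work 4) (Add (RConst 4) (Mul (scalar (Work 3)) (scalar (Work 4))))) \<rho>' (F d) f2 (100 * d * d)"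
    for \<rho>'
    using d by (intro runs_assignI dd) (simp_all add: in_arrays f2_def F_def put_apply)
  have 3: "runs d 2 (For 0 (RAssign OutCenter (IVar (Reg 0)) (IConst 0) (entry Center0 0))) \<rho>' f2 f3 (100 * d * d)"
    if "agree 2 \<rho> \<rho>'" for \<rho>'
  proof -
    have "runs d 1 (For 0 (RAssign OutCenter (IVar (Reg 0)) (IConst 0) (entry Center0 0))) \<rho>' f2 f3
        (5 + d * (rcost (entry Center0 0) + 9))"
      unfolding f3_def using agree_Dim[OF that] d
      by (intro runs_vector) (auto simp: in_arrays region_def f2_def F_def put_apply)
    then show ?thesis by (rule runs_mono) (use d in \<open>auto intro: linear_le_square\<close>)
  qed
  have 4: "runs d 2 (For 0 (RAssign OutMatrix (IVar (Reg 0)) (IVar (Reg 0))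
      (Div (RConst 1) (Mul (RConst 4) (scalar Radius0))))) \<rho>' f3 (G d) (100 * d * d)"
    if "agree 2 \<rho> \<rho>'" for \<rho>'
  proof -
    have "runs d 0 (RAssign OutMatrix (IVar (Reg 0)) (IVar (Reg 0))
      (Div (RConst 1) (Mul (RConst 4) (scalar Radius0)))) \<rho>'' (G i) (G (Suc i)) 30"
      if i: "i < d" "agree (Suc 0) \<rho>' \<rho>''" "\<rho>'' (Reg 0) = i" "\<rho>'' Dim = d" for i \<rho>''
    proof -
      have "put (G i) OutMatrix i i (1 / (4 * f Radius0 0 0)) = G (Suc i)"
        unfolding G_def by (subst put_region) (simp add: lessThan_Suc)
      moreover have "G i Radius0 0 0 = f Radius0 0 0"
        by (simp add: G_def f3_def f2_def F_def region_def put_apply)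
      ultimately show ?thesis
        using runs_RAssign[of OutMatrix "IVar (Reg 0)" \<rho>'' "G i" d "IVar (Reg 0)" 0
            "Div (RConst 1) (Mul (RConst 4) (scalar Radius0))"] i
        by (auto simp: in_arrays intro: runs_mono)
    qed
    moreover have "G 0 = f3" "\<rho>' Dim = d" using agree_Dim[OF that] d by (simp_all add: G_def region_empty)
    ultimately show ?thesis
      by (intro runs_ForI[where F = G and B = 30] linear_le_square) (use d in simp_all)
  qed
  have 5: "runs d 2 (assign OutAlpha (Div (RConst 1) (RConst 4))) \<rho>' (G d) f5 (100 * d * d)" for \<rho>'
    using d by (intro runs_assignI dd) (simp_all add: in_arrays f5_def)
  have "runs d 2 init_prog \<rho> f f5
      (100 * d * d + (100 * d * d + (100 * d * d + (100 * d * d + 100 * d * d))))"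
    unfolding init_prog_def
    by (intro runs_Seq) (use 1 2 3 4 5 agree_trans in blast)+
  then have "runs d 2 init_prog \<rho> f f5 (500 * d * d)" by (rule runs_mono) auto
  then show ?thesis
    by (intro exI[of _ f5] conjI)
      (auto simp: f5_def G_def f3_def f2_def F_def region_def put_apply M)
qed

lemma runs_If_same:
  assumes "bval b (st \<rho> f) \<Longrightarrow> runs d n c1 \<rho> f g B1" "\<not> bval b (st \<rho> f) \<Longrightarrow> runs d n c2 \<rho> f g B2"
    and "bcost b + (B1 + B2) \<le> B"
  shows "runs d n (If b c1 c2) \<rho> f g B"
  using runs_mono[OF runs_If[OF assms(1,2)] order.refl assms(3)] unfolding if_cancel .

lemma measure_prog_runs:
  assumes d: "\<rho> Dim = d" "0 < d"
    and u: "u = mv d (f OutMatrix) (\<lambda>j. f Point j 0 - f OutCenter j 0)"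
    and l: "l = max 1 (sqrt (ip d u u))"
  shows "\<exists>x. runs d 2 measure_prog \<rho> f
    (put (put (region (region f (Work 0) ({..<d} \<times> {0}) (\<lambda>p q. f Point p 0 - f OutCenter p 0))
      (Work 1) ({..<d} \<times> {0}) (\<lambda>p q. u p)) (Work 5) 0 0 x) (Work 6) 0 0 l) (600 * d * d)"
proof -
  have dd: "k \<le> 100 \<Longrightarrow> k \<le> 100 * d * d" for k
    using linear_le_square[of d k 0 100] d by simp
  define f1 where "f1 = region f (Work 0) ({..<d} \<times> {0}) (\<lambda>p q. f Point p 0 - f OutCenter p 0)"
  define f2 where "f2 = put f1 (Work 5) 0 0 0"
  define U where "U k = put (region f1 (Work 1) ({..<k} \<times> {0}) (\<lambda>p q. u p)) (Work 5) 0 0 (\<Sum>i<k. u i * u i)" for k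
  define f3 where "f3 = put (U d) (Work 6) 0 0 (sqrt (ip d u u))"
  define f4 where "f4 = put (U d) (Work 6) 0 0 l"
  have 1: "runs d 2 (For 0 (RAssign (Work 0) (IVar (Reg 0)) (IConst 0) (Sub (entry Point 0) (entry OutCenter 0))))
      \<rho> f f1 (100 * d * d)"
    unfolding f1_def
    by (rule runs_mono[OF runs_vector[where \<rho> = \<rho> and d = d, OF d]])
      (use d in \<open>auto simp: in_arrays region_def intro!: linear_le_square\<close>)
  have 2: "runs d 2 (assign (Work 5) (RConst 0)) \<rho>' f1 f2 (100 * d * d)" for \<rho>'
    using d by (intro runs_assignI dd) (simp_all add: in_arrays f2_def)
  let ?e = "Mul (Cell OutMatrix (IVar (Reg 1)) (IVar (Reg 0))) (entry (Work 0) 0)"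
  let ?c1 = "RAssign (Work 1) (IVar (Reg 1)) (IConst 0) (RConst 0)"
    and ?c2 = "For 0 (RAssign (Work 1) (IVar (Reg 1)) (IConst 0) (Add (entry (Work 1) 1) ?e))"
    and ?c3 = "assign (Work 5) (Add (scalar (Work 5)) (Mul (entry (Work 1) 1) (entry (Work 1) 1)))"
  have body: "runs d 1 (Seq ?c1 (Seq ?c2 ?c3)) \<rho>1 (U i) (U (Suc i)) (4 + (5 + d * 20 + 15))"
    if i: "i < d" "agree (Suc 1) \<rho>' \<rho>1" "\<rho>1 (Reg 1) = i" "\<rho>1 Dim = d" for i \<rho>' \<rho>1
  proof -
    define g1 where "g1 = put (U i) (Work 1) i 0 0"
    define g2 where "g2 = put g1 (Work 1) i 0 (u i)"
    have c1: "runs d 1 ?c1 \<rho>1 (U i) g1 4"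
      by (rule runs_RAssignI[OF _ _ _ i(1) d(2)]) (use i in \<open>simp_all add: in_arrays g1_def\<close>)
    have c2: "runs d 1 ?c2 \<rho>2 g1 g2 (5 + d * 20)" if a: "agree 1 \<rho>1 \<rho>2" for \<rho>2
    proof -
      have D: "\<rho>2 Dim = d" using agree_Dim[OF a] i by simp
      have R: "\<rho>2 (Reg 1) = i" using agree_Reg[OF a order.refl] i by simp
      have "runs d 1 ?c2 \<rho>2 g1 (put g1 (Work 1) i 0 (g1 (Work 1) i 0 +
          (\<Sum>k<d. f OutMatrix i k * (f Point k 0 - f OutCenter k 0)))) (5 + d * (2 * icost (IVar (Reg 1)) + rcost ?e + 11))"
      proof (rule runs_accumulate[where \<rho> = \<rho>2 and d = d and x = i, OF D d(2) _ i(1)])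
        show "ival (IVar (Reg 1)) (st \<rho>'' f') = i" if "agree 1 \<rho>2 \<rho>''" for \<rho>'' f'
          using agree_Reg[OF that order.refl] R by simp
        show "rval ?e (st \<rho>'' (put g1 (Work 1) i 0 y)) = f OutMatrix i k * (f Point k 0 - f OutCenter k 0)"
          if "k < d" "agree 1 \<rho>2 \<rho>''" "\<rho>'' (Reg 0) = k" for k \<rho>'' y
          using agree_Reg[OF that(2) order.refl] R that(1,3)
          by (simp add: g1_def U_def f1_def put_apply region_def)
      qed (simp add: in_arrays)
      moreover have "put g1 (Work 1) i 0 (g1 (Work 1) i 0 +
          (\<Sum>k<d. f OutMatrix i k * (f Point k 0 - f OutCenter k 0))) = g2"
        by (simp add: g2_def u mv_def) (simp add: g1_def put_apply)
      ultimately show ?thesis by simp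
    qed
    have c3: "runs d 1 ?c3 \<rho>2 g2 (U (Suc i)) 15" if a: "agree 1 \<rho>1 \<rho>2" for \<rho>2
    proof (rule runs_assignI)
      have R: "\<rho>2 (Reg 1) = i" using agree_Reg[OF a order.refl] i by simp
      show "put g2 (Work 5) 0 0 (rval (Add (scalar (Work 5)) (Mul (entry (Work 1) 1) (entry (Work 1) 1))) (st \<rho>2 g2)) = U (Suc i)"
        using R by (intro ext) (auto simp: g2_def g1_def U_def put_apply region_def less_Suc_eq)
    qed (use d in \<open>simp_all add: in_arrays\<close>)
    show ?thesis
      by (rule runs_Seq[OF c1], rule runs_Seq[OF c2], assumption, rule c3, erule (1) agree_trans)
  qed
  have 3: "runs d 2 (For 1 (Seq ?c1 (Seq ?c2 ?c3))) \<rho>' f2 (U d) (100 * d * d)" if "agree 2 \<rho> \<rho>'" for \<rho>'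
  proof (rule runs_ForI[where F = U])
    show "\<rho>' Dim = d" using agree_Dim[OF that] d by simp
    show "U 0 = f2" by (simp add: U_def f2_def region_def)
    have "4 + (5 + d * 20 + 15) + 6 = 30 + d * 20" by simp
    then show "5 + d * (4 + (5 + d * 20 + 15) + 6) \<le> 100 * d * d"
      using quadratic_le_square[of d 5 30 20 100] d by simp
  qed (use body in simp_all)
  have 4: "runs d 2 (assign (Work 6) (Sqrt (scalar (Work 5)))) \<rho>' (U d) f3 (100 * d * d)" for \<rho>'
    using d by (intro runs_assignI dd) (simp_all add: in_arrays f3_def U_def put_apply ip_def)
  have 5: "runs d 2 (If (RLess (scalar (Work 6)) (RConst 1)) (assign (Work 6) (RConst 1)) Skip) \<rho>' f3 f4 (100 * d * d)" for \<rho>'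
  proof (rule runs_If_same)
    show "runs d 2 (assign (Work 6) (RConst 1)) \<rho>' f3 f4 4"
      if "bval (RLess (scalar (Work 6)) (RConst 1)) (st \<rho>' f3)"
      using that d by (intro runs_assignI) (auto simp: in_arrays f3_def f4_def l put_apply fun_eq_iff)
    show "runs d 2 Skip \<rho>' f3 f4 1"
      if "\<not> bval (RLess (scalar (Work 6)) (RConst 1)) (st \<rho>' f3)"
    proof -
      have "f3 = f4" using that by (simp add: f3_def f4_def l put_apply max_def)
      then show ?thesis using runs_Skip by simp
    qed
    show "bcost (RLess (scalar (Work 6)) (RConst 1)) + (4 + 1) \<le> 100 * d * d" by (rule dd) simp
  qed
  have "runs d 2 measure_prog \<rho> f f4
      (100 * d * d + (100 * d * d + (100 * d * d + (100 * d * d + 100 * d * d))))"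
    unfolding measure_prog_def
    by (intro runs_Seq[OF 1] runs_Seq[OF 2] runs_Seq[OF 3] runs_Seq[OF 4] 5) (blast intro: agree_trans)
  then show ?thesis unfolding f4_def U_def f1_def
    by (intro exI) (erule runs_mono, simp_all)
qed

lemma axes_prog_runs:
  assumes d: "0 < d" 
    and l: "l = f (Work 6) 0 0" and \<alpha>: "\<alpha> = f OutAlpha 0 0" and H: "H = f (Work 4) 0 0"
    and \<beta>: "\<beta> = (if \<alpha> * H < l then shrink \<alpha> l else \<alpha> / l)"
    and a: "a = (if \<alpha> * H < l then long_axis \<alpha> l else l)"
    and b: "b = (if \<alpha> * H < l then short_axis \<alpha> l else l)"
  shows "runs d n axes_prog \<rho> f (put (put (put (put f (Work 4) 0 0 (if \<alpha> * H < l then 0 else H))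
    (Work 7) 0 0 \<beta>) (Work 8) 0 0 a) (Work 9) 0 0 b) (300 * d * d)"
proof -
  have dd: "k \<le> 300 \<Longrightarrow> k \<le> 300 * d * d" for k
    using linear_le_square[of d k 0 300] d by simp
  show ?thesis
    unfolding axes_prog_def
  proof (rule runs_If_same)
    let ?g = "put (put (put (put f (Work 4) 0 0 (if \<alpha> * H < l then 0 else H))
      (Work 7) 0 0 \<beta>) (Work 8) 0 0 a) (Work 9) 0 0 b"
    let ?b = "RLess (Mul (scalar OutAlpha) (scalar (Work 4))) (scalar (Work 6))"
    {
      assume "bval ?b (st \<rho> f)"
      then have t: "\<alpha> * H < l" by (simp add: \<alpha> H l)
      let ?f1 = "put f (Work 4) 0 0 0"
      let ?f2 = "put ?f1 (Work 7) 0 0 \<beta>"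
      let ?f3 = "put ?f2 (Work 8) 0 0 a"
      have g: "?g = put ?f3 (Work 9) 0 0 b" using t by simp
      show "runs d n (Seq (assign (Work 4) (RConst 0))
        (Seq (assign (Work 7) (Div (RConst 1) (Add (Div (RConst 1) (scalar OutAlpha))
          (Mul (RConst 4) (Div (Sub (scalar (Work 6)) (RConst 1)) (Add (scalar (Work 6)) (scalar OutAlpha)))))))
        (Seq (assign (Work 8) (Div (Add (scalar (Work 6)) (scalar OutAlpha)) (Add (RConst 1) (scalar (Work 7)))))
        (assign (Work 9) (Sqrt (Add (RConst 1) (Mul (Mul (RConst 2) (Mul (scalar (Work 7)) (scalar (Work 7))))
          (Sub (RConst 1) (Div (RConst 1) (scalar (Work 8))))))))))) \<rho> f ?g (40 + (40 + (40 + 40)))"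
        unfolding g
      proof (intro runs_Seq)
        show "runs d n (assign (Work 4) (RConst 0)) \<rho> f ?f1 40"
          using d by (intro runs_assignI) (simp_all add: in_arrays)
        show "runs d n (assign (Work 7) (Div (RConst 1) (Add (Div (RConst 1) (scalar OutAlpha))
          (Mul (RConst 4) (Div (Sub (scalar (Work 6)) (RConst 1)) (Add (scalar (Work 6)) (scalar OutAlpha)))))))
          \<rho>' ?f1 ?f2 40" for \<rho>'
          using d t by (intro runs_assignI) (simp_all add: in_arrays put_apply \<beta> shrink_def flip: \<alpha> l)
        show "runs d n (assign (Work 8) (Div (Add (scalar (Work 6)) (scalar OutAlpha)) (Add (RConst 1) (scalar (Work 7)))))
          \<rho>' ?f2 ?f3 40" for \<rho>'
          using d t by (intro runs_assignI) (simp_all add: in_arrays put_apply \<beta> a long_axis_def flip: \<alpha> l)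
        show "runs d n (assign (Work 9) (Sqrt (Add (RConst 1) (Mul (Mul (RConst 2) (Mul (scalar (Work 7)) (scalar (Work 7))))
          (Sub (RConst 1) (Div (RConst 1) (scalar (Work 8)))))))) \<rho>' ?f3 (put ?f3 (Work 9) 0 0 b) 40" for \<rho>'
          using d t by (intro runs_assignI) (simp_all add: in_arrays put_apply \<beta> a b short_axis_def power2_eq_square)
      qed
    next
      assume "\<not> bval ?b (st \<rho> f)"
      then have t: "\<not> \<alpha> * H < l" by (simp add: \<alpha> H l)
      let ?f2 = "put f (Work 7) 0 0 \<beta>"
      let ?f3 = "put ?f2 (Work 8) 0 0 a"
      have g: "?g = put ?f3 (Work 9) 0 0 b" using t by (simp add: H put_same)
      show "runs d n (Seq (assign (Work 7) (Div (scalar OutAlpha) (scalar (Work 6))))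
        (Seq (assign (Work 8) (scalar (Work 6)))
        (assign (Work 9) (scalar (Work 6))))) \<rho> f ?g (40 + (40 + 40))"
        unfolding g
      proof (intro runs_Seq)
        show "runs d n (assign (Work 7) (Div (scalar OutAlpha) (scalar (Work 6)))) \<rho> f ?f2 40"
          using d t by (intro runs_assignI) (simp_all add: in_arrays \<beta> flip: \<alpha> l)
        show "runs d n (assign (Work 8) (scalar (Work 6))) \<rho>' ?f2 ?f3 40" for \<rho>'
          using d t by (intro runs_assignI) (simp_all add: in_arrays put_apply a flip: l)
        show "runs d n (assign (Work 9) (scalar (Work 6))) \<rho>' ?f3 (put ?f3 (Work 9) 0 0 b) 40" for \<rho>'
          using d t by (intro runs_assignI) (simp_all add: in_arrays put_apply b flip: l)
      qed
    }
    show "bcost ?b + ((40 + (40 + (40 + 40))) + (40 + (40 + 40))) \<le> 300 * d * d"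
      by (rule dd) simp
  qed
qed

lemma apply_prog_runs:
  assumes d0: "0 < d"
    and l: "l = f (Work 6) 0 0" and a: "a = f (Work 8) 0 0" and b: "b = f (Work 9) 0 0"
    and u: "u = (\<lambda>i. f (Work 1) i 0)"
  shows "\<exists>g. (\<forall>\<rho>. \<rho> Dim = d \<longrightarrow> runs d 2 apply_prog \<rho> f g (600 * d * d))
    \<and> (\<forall>i<d. \<forall>j<d. g OutMatrix i j = f OutMatrix i j / b
        + (1 / a - 1 / b) / (l * l) * u i * (\<Sum>k<d. u k * f OutMatrix k j))
    \<and> (\<forall>i<d. g OutCenter i 0 = f OutCenter i 0 + (l - a) / l * f (Work 0) i 0)
    \<and> g OutAlpha 0 0 = f (Work 7) 0 0 \<and> g (Work 4) 0 0 = f (Work 4) 0 0"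
proof -
  have dd: "k \<le> 100 \<Longrightarrow> k \<le> 100 * d * d" for k
    using linear_le_square[of d k 0 100] d0 by simp
  define v where "v j = (\<Sum>k<d. u k * f OutMatrix k j)" for j
  define f1 where "f1 = put f (Work 10) 0 0 ((1 / a - 1 / b) / (l * l))"
  define f2 where "f2 = put f1 (Work 11) 0 0 ((l - a) / l)"
  define V where "V k = region f2 (Work 2) ({..<k} \<times> {0}) (\<lambda>p q. v p)" for k
  define f4 where "f4 = region (V d) OutMatrix ({..<d} \<times> {..<d})
    (\<lambda>i j. f OutMatrix i j / b + (1 / a - 1 / b) / (l * l) * u i * v j)"
  define f5 where "f5 = region f4 OutCenter ({..<d} \<times> {0}) (\<lambda>i j. f OutCenter i 0 + (l - a) / l * f (Work 0) i 0)"
  define f6 where "f6 = put f5 OutAlpha 0 0 (f (Work 7) 0 0)"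
  have run: "runs d 2 apply_prog \<rho> f f6 (600 * d * d)" if "\<rho> Dim = d" for \<rho>
  proof -
    note d = that d0
    have 1: "runs d 2 (assign (Work 10) (Div (Sub (Div (RConst 1) (scalar (Work 8))) (Div (RConst 1) (scalar (Work 9))))
        (Mul (scalar (Work 6)) (scalar (Work 6))))) \<rho> f f1 (100 * d * d)"
      using d by (intro runs_assignI dd) (simp_all add: in_arrays f1_def l a b)
    have 2: "runs d 2 (assign (Work 11) (Div (Sub (scalar (Work 6)) (scalar (Work 8))) (scalar (Work 6)))) \<rho>' f1 f2 (100 * d * d)" for \<rho>'
      using d by (intro runs_assignI dd) (simp_all add: in_arrays f2_def f1_def put_apply l a)
    let ?e = "Mul (entry (Work 1) 0) (Cell OutMatrix (IVar (Reg 0)) (IVar (Reg 1)))"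
    let ?c1 = "RAssign (Work 2) (IVar (Reg 1)) (IConst 0) (RConst 0)"
      and ?c2 = "For 0 (RAssign (Work 2) (IVar (Reg 1)) (IConst 0) (Add (entry (Work 2) 1) ?e))"
    have body: "runs d 1 (Seq ?c1 ?c2) \<rho>1 (V i) (V (Suc i)) (4 + (5 + d * 20))"
      if i: "i < d" "agree (Suc 1) \<rho>' \<rho>1" "\<rho>1 (Reg 1) = i" "\<rho>1 Dim = d" for i \<rho>' \<rho>1
    proof -
      define g1 where "g1 = put (V i) (Work 2) i 0 0"
      have c1: "runs d 1 ?c1 \<rho>1 (V i) g1 4"
        by (rule runs_RAssignI[OF _ _ _ i(1) d(2)]) (use i in \<open>simp_all add: in_arrays g1_def\<close>)
      have c2: "runs d 1 ?c2 \<rho>2 g1 (V (Suc i)) (5 + d * 20)" if a: "agree 1 \<rho>1 \<rho>2" for \<rho>2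
      proof -
        have D: "\<rho>2 Dim = d" using agree_Dim[OF a] i by simp
        have R: "\<rho>2 (Reg 1) = i" using agree_Reg[OF a order.refl] i by simp
        have "runs d 1 ?c2 \<rho>2 g1 (put g1 (Work 2) i 0 (g1 (Work 2) i 0 +
            (\<Sum>k<d. u k * f OutMatrix k i))) (5 + d * (2 * icost (IVar (Reg 1)) + rcost ?e + 11))"
        proof (rule runs_accumulate[where \<rho> = \<rho>2 and d = d and x = i, OF D d(2) _ i(1)])
          show "ival (IVar (Reg 1)) (st \<rho>'' f') = i" if "agree 1 \<rho>2 \<rho>''" for \<rho>'' f'
            using agree_Reg[OF that order.refl] R by simp
          show "rval ?e (st \<rho>'' (put g1 (Work 2) i 0 y)) = u k * f OutMatrix k i"
            if "k < d" "agree 1 \<rho>2 \<rho>''" "\<rho>'' (Reg 0) = k" for k \<rho>'' y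
            using agree_Reg[OF that(2) order.refl] R that(1,3)
            by (simp add: g1_def V_def f2_def f1_def put_apply region_def u)
        qed (simp add: in_arrays)
        moreover have "put g1 (Work 2) i 0 (g1 (Work 2) i 0 + (\<Sum>k<d. u k * f OutMatrix k i)) = V (Suc i)"
          unfolding v_def[symmetric]
          by (intro ext) (auto simp: g1_def V_def put_apply region_def less_Suc_eq)
        ultimately show ?thesis by simp
      qed
      show ?thesis by (rule runs_Seq[OF c1 c2])
    qed
    have 3: "runs d 2 (For 1 (Seq ?c1 ?c2)) \<rho>' f2 (V d) (100 * d * d)" if "agree 2 \<rho> \<rho>'" for \<rho>'
    proof (rule runs_ForI[where F = V])
      show "\<rho>' Dim = d" using agree_Dim[OF that] d by simp
      show "V 0 = f2" by (simp add: V_def region_def)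
      have "4 + (5 + d * 20) + 6 = 15 + d * 20" by simp
      then show "5 + d * (4 + (5 + d * 20) + 6) \<le> 100 * d * d"
        using quadratic_le_square[of d 5 15 20 100] d by simp
    qed (use body in simp_all)
    have 4: "runs d 2 (For 1 (For 0 (RAssign OutMatrix (IVar (Reg 1)) (IVar (Reg 0))
        (Add (Div (Cell OutMatrix (IVar (Reg 1)) (IVar (Reg 0))) (scalar (Work 9)))
          (Mul (Mul (scalar (Work 10)) (entry (Work 1) 1)) (entry (Work 2) 0)))))) \<rho>' (V d) f4 (100 * d * d)"
      if "agree 2 \<rho> \<rho>'" for \<rho>'
    proof -
      have D: "\<rho>' Dim = d" using agree_Dim[OF that] d by simp
      have "5 + d * (5 + d * (rcost (Add (Div (Cell OutMatrix (IVar (Reg 1)) (IVar (Reg 0))) (scalar (Work 9)))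
          (Mul (Mul (scalar (Work 10)) (entry (Work 1) 1)) (entry (Work 2) 0))) + 9) + 6) \<le> 100 * d * d"
        using quadratic_le_square[of d 5 11 28 100] d by (simp add: add.commute)
      moreover have "rval (Add (Div (Cell OutMatrix (IVar (Reg 1)) (IVar (Reg 0))) (scalar (Work 9)))
          (Mul (Mul (scalar (Work 10)) (entry (Work 1) 1)) (entry (Work 2) 0)))
          (st \<rho>'' (region (V d) OutMatrix S (\<lambda>i j. f OutMatrix i j / b + (1 / a - 1 / b) / (l * l) * u i * v j)))
        = f OutMatrix i j / b + (1 / a - 1 / b) / (l * l) * u i * v j"
        if "i < d" "j < d" "(i, j) \<notin> S" "\<rho>'' (Reg 1) = i" "\<rho>'' (Reg 0) = j" for i j S \<rho>''
        using that by (simp add: V_def f2_def f1_def region_def put_apply u b)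
      ultimately show ?thesis
        unfolding f4_def by (intro runs_mono[OF runs_matrix[where \<rho> = \<rho>' and d = d, OF D]]) (simp_all add: in_arrays)
    qed
    have 5: "runs d 2 (For 0 (RAssign OutCenter (IVar (Reg 0)) (IConst 0)
        (Add (entry OutCenter 0) (Mul (scalar (Work 11)) (entry (Work 0) 0))))) \<rho>' f4 f5 (100 * d * d)"
      if "agree 2 \<rho> \<rho>'" for \<rho>'
    proof -
      have D: "\<rho>' Dim = d" using agree_Dim[OF that] d by simp
      show ?thesis
        unfolding f5_def
        by (rule runs_mono[OF runs_vector[where \<rho> = \<rho>' and d = d, OF D d(2)]])
          (use d in \<open>auto simp: in_arrays f4_def V_def f2_def f1_def region_def put_apply intro!: linear_le_square\<close>)
    qed
    have 6: "runs d 2 (assign OutAlpha (scalar (Work 7))) \<rho>' f5 f6 (100 * d * d)" for \<rho>'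
      using d by (intro runs_assignI dd) (simp_all add: in_arrays f6_def f5_def f4_def V_def f2_def f1_def region_def put_apply)
    have "runs d 2 apply_prog \<rho> f f6
        (100 * d * d + (100 * d * d + (100 * d * d + (100 * d * d + (100 * d * d + 100 * d * d)))))"
      unfolding apply_prog_def
      by (intro runs_Seq[OF 1] runs_Seq[OF 2] runs_Seq[OF 3] runs_Seq[OF 4] runs_Seq[OF 5] 6) (blast intro: agree_trans)+
    then show ?thesis by (rule runs_mono) simp_all
  qed
  then show ?thesis
    by (intro exI[of _ f6] conjI)
      (simp_all add: f6_def f5_def f4_def V_def f2_def f1_def region_def put_apply v_def)
qed

lemma step_prog_runs:
  assumes d: "\<rho> Dim = d" "0 < d"
    and u: "u = mv d (f OutMatrix) (\<lambda>j. f Point j 0 - f OutCenter j 0)"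
    and l: "l = max 1 (sqrt (ip d u u))"
    and \<alpha>: "\<alpha> = f OutAlpha 0 0" and H: "H = f (Work 4) 0 0"
    and \<beta>: "\<beta> = (if \<alpha> * H < l then shrink \<alpha> l else \<alpha> / l)"
    and a: "a = (if \<alpha> * H < l then long_axis \<alpha> l else l)"
    and b: "b = (if \<alpha> * H < l then short_axis \<alpha> l else l)"
  shows "\<exists>g. runs d 2 step_prog \<rho> f g (1500 * d * d)
    \<and> (\<forall>i<d. \<forall>j<d. g OutMatrix i j = f OutMatrix i j / b
        + (1 / a - 1 / b) / (l * l) * u i * (\<Sum>k<d. u k * f OutMatrix k j))
    \<and> (\<forall>i<d. g OutCenter i 0 = f OutCenter i 0 + (l - a) / l * (f Point i 0 - f OutCenter i 0))
    \<and> g OutAlpha 0 0 = \<beta> \<and> g (Work 4) 0 0 = (if \<alpha> * H < l then 0 else H)"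
proof -
  obtain x where 1: "runs d 2 measure_prog \<rho> f
    (put (put (region (region f (Work 0) ({..<d} \<times> {0}) (\<lambda>p q. f Point p 0 - f OutCenter p 0))
      (Work 1) ({..<d} \<times> {0}) (\<lambda>p q. u p)) (Work 5) 0 0 x) (Work 6) 0 0 l) (600 * d * d)"
    (is "runs _ _ _ _ _ ?f1 _")
    using measure_prog_runs[where \<rho> = \<rho> and d = d and f = f and u = u, OF d u l] by blast
  let ?f2 = "put (put (put (put ?f1 (Work 4) 0 0 (if \<alpha> * H < l then 0 else H))
    (Work 7) 0 0 \<beta>) (Work 8) 0 0 a) (Work 9) 0 0 b"
  have 2: "runs d 2 axes_prog \<rho>' ?f1 ?f2 (300 * d * d)" for \<rho>'
    by (rule axes_prog_runs[OF d(2) _ _ _ \<beta> a b]) (simp_all add: put_apply region_def \<alpha> H)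
  obtain g where 3: "\<And>\<rho>'. \<rho>' Dim = d \<Longrightarrow> runs d 2 apply_prog \<rho>' ?f2 g (600 * d * d)"
    and M: "\<And>i j. i < d \<Longrightarrow> j < d \<Longrightarrow> g OutMatrix i j = ?f2 OutMatrix i j / b
        + (1 / a - 1 / b) / (l * l) * ?f2 (Work 1) i 0 * (\<Sum>k<d. ?f2 (Work 1) k 0 * ?f2 OutMatrix k j)"
    and c: "\<And>i. i < d \<Longrightarrow> g OutCenter i 0 = ?f2 OutCenter i 0 + (l - a) / l * ?f2 (Work 0) i 0"
    and g: "g OutAlpha 0 0 = ?f2 (Work 7) 0 0" "g (Work 4) 0 0 = ?f2 (Work 4) 0 0"
    using apply_prog_runs[OF d(2), of l ?f2 a b] by (auto simp: put_apply)
  have "runs d 2 step_prog \<rho> f g (600 * d * d + (300 * d * d + 600 * d * d))"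
    unfolding step_prog_def
    by (rule runs_Seq[OF 1], rule runs_Seq[OF 2], rule 3) (metis agree_Dim d(1))
  then have "runs d 2 step_prog \<rho> f g (1500 * d * d)" by (rule runs_mono) simp_all
  then show ?thesis
    using M c g by (intro exI[of _ g]) (simp add: put_apply region_def)
qed

lemma load_mem: "load s (a, i, j) = mem (snd s) a i j"
  by (cases s) (simp add: mem_def)

lemma card_cells: "card (cells d) = 18 * (d * d)"
proof -
  have "card arrays = 18"
    unfolding arrays_def by (subst card_Un_disjoint) (auto simp: card_image inj_on_def)
  then show ?thesis by (simp add: cells_def card_cartesian_product)
qed

lemma storage_le:
  assumes "dom (snd s) \<subseteq> cells d"
  shows "storage s \<le> 18 * (d * d)"
proof -
  have "finite (cells d)" by (simp add: cells_def arrays_def)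
  then show ?thesis unfolding storage_def card_cells[symmetric] using assms by (rule card_mono)
qed

section \<open>The invariant of the stream\<close>

locale rounding =
  fixes d :: nat and zs :: "real vec list" and c0 :: "real vec" and r0 :: real
  assumes d: "1 \<le> d" and zs: "set zs \<subseteq> carrier_vec d" and c0: "c0 \<in> carrier_vec d" and r0: "0 < r0"
    and ball: "translate c0 (dilate r0 (unit_ball d)) \<subseteq> conv d zs"
begin

abbreviation Z :: "real vec set" where
  "Z \<equiv> conv d zs"

abbreviation R :: real where
  "R \<equiv> circumradius d Z"

definition threshold :: real where
  "threshold = 4 + real d * harm d"

abbreviation dt :: "(nat \<Rightarrow> nat \<Rightarrow> real) \<Rightarrow> real" where
  "dt M \<equiv> det (mat d d (\<lambda>(i, j). M i j))"

lemma threshold_ge: "5 \<le> threshold"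
proof -
  have "1 * 1 \<le> real d * harm d" using d harm_bounds(3)[OF d] by (intro mult_mono) auto
  then show ?thesis by (simp add: threshold_def)
qed

lemma ball_in_Z:
  assumes "ip d (\<lambda>i. x i - c0 $ i) (\<lambda>i. x i - c0 $ i) \<le> r0\<^sup>2"
  shows "vec d x \<in> Z"
proof -
  let ?y = "vec d (\<lambda>i. (x i - c0 $ i) / r0)"
  have "ip d (($) ?y) (($) ?y) = ip d (\<lambda>i. x i - c0 $ i) (\<lambda>i. x i - c0 $ i) / r0\<^sup>2"
    by (simp add: ip_def power2_eq_square sum_divide_distrib)
  also have "\<dots> \<le> 1" using assms r0 by (simp add: divide_le_eq)
  finally have "?y \<in> unit_ball d" by (simp add: unit_ball_def enorm_eq[of _ d])
  moreover have "vec d x = c0 + r0 \<cdot>\<^sub>v ?y" using c0 r0 by (intro eq_vecI) auto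
  ultimately show ?thesis using ball unfolding translate_def dilate_def by blast
qed

lemma point_in_Z:
  assumes "t < length zs"
  shows "vec d (($) (zs ! t)) \<in> Z"
proof -
  have "zs ! t \<in> carrier_vec d" using zs assms by auto
  then have "vec d (($) (zs ! t)) = zs ! t" by (intro eq_vecI) auto
  then show ?thesis using nth_in_conv[OF assms zs] by simp
qed

lemma center_in_Z: "vec d (($) c0) \<in> Z"
  using r0 by (intro ball_in_Z) (simp add: ip_def)

lemma distance_le:
  assumes "vec d x \<in> Z" "vec d y \<in> Z"
  shows "ip d (\<lambda>i. x i - y i) (\<lambda>i. x i - y i) \<le> (2 * R)\<^sup>2"
proof -
  have "ip d (\<lambda>i. vec d x $ i - vec d y $ i) (\<lambda>i. vec d x $ i - vec d y $ i) = ip d (\<lambda>i. x i - y i) (\<lambda>i. x i - y i)"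
    by (intro ip_cong) auto
  then have "sqrt (ip d (\<lambda>i. x i - y i) (\<lambda>i. x i - y i)) \<le> 2 * R"
    using conv_distance_le[OF assms] by simp
  then show ?thesis by (rule sqrt_le_D)
qed

lemma R_ge: "r0 \<le> R"
proof -
  define x where "x s i = c0 $ i + (if i = 0 then s * r0 else 0)" for s :: real and i :: nat
  have sum: "ip d (\<lambda>i. if i = 0 then y else 0) (\<lambda>i. if i = 0 then y else 0) = y\<^sup>2" for y :: real
    using d by (simp add: ip_def sum.remove[of "{..<d}" 0] power2_eq_square)
  have "vec d (x s) \<in> Z" if "s\<^sup>2 = 1" for s
  proof (rule ball_in_Z)
    have "ip d (\<lambda>i. x s i - c0 $ i) (\<lambda>i. x s i - c0 $ i) = (s * r0)\<^sup>2"
      unfolding x_def add_diff_cancel_left' by (rule sum)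
    then show "ip d (\<lambda>i. x s i - c0 $ i) (\<lambda>i. x s i - c0 $ i) \<le> r0\<^sup>2"
      using that by (simp add: power_mult_distrib)
  qed
  then have "ip d (\<lambda>i. x 1 i - x (- 1) i) (\<lambda>i. x 1 i - x (- 1) i) \<le> (2 * R)\<^sup>2"
    by (intro distance_le) auto
  also have "(\<lambda>i. x 1 i - x (- 1) i) = (\<lambda>i. if i = 0 then 2 * r0 else 0)"
    by (auto simp: x_def)
  finally have sq: "(2 * r0)\<^sup>2 \<le> (2 * R)\<^sup>2" unfolding sum .
  have "0 \<le> 2 * R" using conv_distance_le[OF center_in_Z center_in_Z] by (simp add: ip_def)
  then show ?thesis using power2_le_imp_le[OF sq] by simp
qed

lemma R_pos: "0 < R"
  using R_ge r0 by simp

definition good :: "nat \<Rightarrow> (nat \<Rightarrow> nat \<Rightarrow> real) \<Rightarrow> (nat \<Rightarrow> real) \<Rightarrow> real \<Rightarrow> bool" where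
  "good t M c \<alpha> \<longleftrightarrow> 0 < \<alpha> \<and> \<alpha> \<le> 1 / 4 \<and> dt M \<noteq> 0
    \<and> (\<forall>i<t. gauge d M c (($) (zs ! i)) \<le> 1)
    \<and> (\<forall>x. gauge d M c x \<le> \<alpha>\<^sup>2 \<longrightarrow> vec d x \<in> Z)
    \<and> 1 / \<alpha> + 4 * ln \<bar>dt M\<bar> \<le> threshold - 4 * real d * ln r0"

definition round_phase :: "(nat \<Rightarrow> nat \<Rightarrow> real) \<Rightarrow> (nat \<Rightarrow> real) \<Rightarrow> real \<Rightarrow> real \<Rightarrow> bool" where
  "round_phase M c \<alpha> H \<longleftrightarrow> H = threshold \<and> (\<forall>i<d. c i = c0 $ i)
    \<and> (\<forall>i<d. \<forall>j<d. M i j = (if i = j then \<alpha> / r0 else 0))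
    \<and> 1 / \<alpha> \<le> threshold \<and> 1 / \<alpha> \<le> max 4 (2 * (R / r0))"

definition ellipsoid_phase :: "real \<Rightarrow> bool" where
  "ellipsoid_phase H \<longleftrightarrow> H = 0 \<and> threshold \<le> 2 * (R / r0)"

definition rounding_inv :: "nat \<Rightarrow> (nat \<Rightarrow> nat \<Rightarrow> real) \<Rightarrow> (nat \<Rightarrow> real) \<Rightarrow> real \<Rightarrow> real \<Rightarrow> bool" where
  "rounding_inv t M c \<alpha> H \<longleftrightarrow> good t M c \<alpha> \<and> (round_phase M c \<alpha> H \<or> ellipsoid_phase H)"

lemma round_mv:
  assumes "round_phase M c \<alpha> H" "i < d"
  shows "mv d M x i = \<alpha> / r0 * x i"
proof -
  have "mv d M x i = (\<Sum>j<d. if i = j then \<alpha> / r0 * x j else 0)"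
    unfolding mv_def using assms by (intro sum.cong) (auto simp: round_phase_def)
  then show ?thesis using assms by simp
qed

lemma round_gauge:
  assumes "round_phase M c \<alpha> H"
  shows "gauge d M c x = (\<alpha> / r0)\<^sup>2 * ip d (\<lambda>i. x i - c0 $ i) (\<lambda>i. x i - c0 $ i)"
  unfolding gauge_def ip_def sum_distrib_left using assms
  by (intro sum.cong) (auto simp: round_mv[OF assms] round_phase_def power2_eq_square)

lemma round_det:
  assumes "round_phase M c \<alpha> H"
  shows "dt M = (\<alpha> / r0) ^ d"
proof -
  have "mat d d (\<lambda>(i, j). M i j) = (\<alpha> / r0) \<cdot>\<^sub>m 1\<^sub>m d"
    using assms by (intro eq_matI) (auto simp: round_phase_def)
  then show ?thesis by simp
qed

lemma round_potential:
  assumes "round_phase M c \<alpha> H" "0 < \<alpha>" "\<alpha> \<le> 1 / 4"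
  shows "1 / \<alpha> + 4 * ln \<bar>dt M\<bar> \<le> threshold - 4 * real d * ln r0"
proof -
  have "ln \<alpha> \<le> 0" using assms(2,3) by simp
  then have "4 * real d * ln \<alpha> \<le> 0" by (intro mult_nonneg_nonpos) auto
  moreover have "ln \<bar>dt M\<bar> = real d * ln \<alpha> - real d * ln r0"
    unfolding round_det[OF assms(1)] using assms(2) r0
    by (simp add: ln_realpow ln_div power_abs abs_of_pos right_diff_distrib)
  moreover have "1 / \<alpha> \<le> threshold" using assms(1) by (simp add: round_phase_def)
  ultimately show ?thesis by simp
qed

lemma inv_init:
  assumes "\<And>i j. i < d \<Longrightarrow> j < d \<Longrightarrow> M i j = (if i = j then 1 / (4 * r0) else 0)"
    and "\<And>i. i < d \<Longrightarrow> c i = c0 $ i"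
  shows "rounding_inv 0 M c (1 / 4) threshold"
proof -
  have ph: "round_phase M c (1 / 4) threshold"
    using assms threshold_ge by (auto simp: round_phase_def)
  have "vec d x \<in> Z" if "gauge d M c x \<le> (1 / 4)\<^sup>2" for x
    using that r0 unfolding round_gauge[OF ph] by (intro ball_in_Z) (simp add: power2_eq_square field_simps)
  then show ?thesis
    using ph round_det[OF ph] round_potential[OF ph] r0 by (simp add: rounding_inv_def good_def)
qed

lemma good_step:
  assumes "good t M c \<alpha>" and t: "t < length zs"
    and "admissible_update d M M' c c' (($) (zs ! t)) u l a b \<alpha> \<beta>"
    and \<beta>: "0 < \<beta>" "\<beta> \<le> 1 / 4" and pot: "1 / \<beta> \<le> 1 / \<alpha> + 4 * ln a"
  shows "good (Suc t) M' c' \<beta>"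
proof -
  interpret admissible_update d M M' c c' "($) (zs ! t)" u l a b \<alpha> \<beta> by fact
  note g = assms(1)[unfolded good_def]
  note z = point_in_Z[OF t]
  have 1: "gauge d M' c' (($) (zs ! i)) \<le> 1" if "i < Suc t" for i
    using that g gauge_new gauge_mono by (cases "i = t") auto
  have 2: "vec d x \<in> Z" if "gauge d M' c' x \<le> \<beta>\<^sup>2" for x
    using g by (intro inner_step[OF _ conv_convex z that]) auto
  have 3: "dt M' \<noteq> 0" using g det_step(1)[OF d] by simp
  have "ln \<bar>dt M'\<bar> \<le> ln (\<bar>dt M\<bar> / a)" using det_step(2)[OF d] 3 g ab by (intro ln_mono) auto
  also have "\<dots> = ln \<bar>dt M\<bar> - ln a" using g ab by (simp add: ln_div)
  finally show ?thesis using 1 2 3 \<beta> pot g by (simp add: good_def)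
qed

lemma inv_step:
  assumes inv: "rounding_inv t M c \<alpha> H" and t: "t < length zs"
    and u: "u = mv d M (\<lambda>j. (zs ! t) $ j - c j)" and len: "l = max 1 (sqrt (ip d u u))"
    and \<beta>: "\<beta> = (if \<alpha> * H < l then shrink \<alpha> l else \<alpha> / l)"
    and a: "a = (if \<alpha> * H < l then long_axis \<alpha> l else l)"
    and b: "b = (if \<alpha> * H < l then short_axis \<alpha> l else l)"
    and M': "\<And>i j. i < d \<Longrightarrow> j < d \<Longrightarrow>
      M' i j = M i j / b + (1 / a - 1 / b) / (l * l) * u i * (\<Sum>k<d. u k * M k j)"
    and c': "\<And>i. i < d \<Longrightarrow> c' i = c i + (l - a) / l * ((zs ! t) $ i - c i)"
  shows "rounding_inv (Suc t) M' c' \<beta> (if \<alpha> * H < l then 0 else H)"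
proof -
  note g = inv[unfolded rounding_inv_def good_def]
  have l1: "1 \<le> l" by (simp add: len)
  note z = point_in_Z[OF t]
  have far: "l \<le> max 1 (\<alpha> * (2 * (R / r0)))" if ph: "round_phase M c \<alpha> H"
  proof -
    have "ip d u u = gauge d M c (($) (zs ! t))" by (simp add: gauge_def u)
    also have "\<dots> \<le> (\<alpha> / r0)\<^sup>2 * (2 * R)\<^sup>2"
      unfolding round_gauge[OF ph] using distance_le[OF z center_in_Z] by (intro mult_left_mono) auto
    finally have "sqrt (ip d u u) \<le> sqrt ((\<alpha> * (2 * (R / r0)))\<^sup>2)"
      by (intro real_sqrt_le_mono) (simp add: power2_eq_square ac_simps)
    also have "\<dots> = \<alpha> * (2 * (R / r0))" using g R_pos r0 by (subst real_sqrt_abs) simp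
    finally show ?thesis unfolding len by linarith
  qed
  show ?thesis
  proof (cases "\<alpha> * H < l")
    case True
    interpret growth \<alpha> l \<beta> a b using True g l1 by unfold_locales (simp_all add: \<beta> a b)
    have adm: "admissible \<alpha> l \<beta> a b" by (rule admissible)
    have "update d M M' c c' (($) (zs ! t)) u l a b"
      using u len M' c' a_ge b_ge admissible.axes(3)[OF adm] by unfold_locales auto
    then have "admissible_update d M M' c c' (($) (zs ! t)) u l a b \<alpha> \<beta>"
      using adm by (simp add: admissible_update_def)
    moreover have "1 / \<beta> \<le> 1 / \<alpha> + 4 * ln a" using tau_le_ln unfolding inverse_beta by linarith
    moreover have "good t M c \<alpha>" using inv by (simp add: rounding_inv_def)
    ultimately have "good (Suc t) M' c' \<beta>" using t beta alpha by (intro good_step) auto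
    moreover have "ellipsoid_phase 0"
    proof (cases "round_phase M c \<alpha> H")
      case ph: True
      then have H: "H = threshold" and "1 / \<alpha> \<le> threshold" by (auto simp: round_phase_def)
      then have "1 \<le> \<alpha> * threshold" using alpha by (simp add: field_simps)
      then have "\<alpha> * threshold < \<alpha> * (2 * (R / r0))" using True[unfolded H] far[OF ph] by linarith
      then have "threshold < 2 * (R / r0)" using mult_less_cancel_left_pos[OF alpha(1)] by blast
      then show ?thesis by (simp add: ellipsoid_phase_def)
    next
      case False
      then show ?thesis using g by (simp add: ellipsoid_phase_def)
    qed
    ultimately show ?thesis using True by (simp add: rounding_inv_def)
  next
    case False
    have "\<not> ellipsoid_phase H" using False l1 by (auto simp: ellipsoid_phase_def)
    then have ph: "round_phase M c \<alpha> H" using g by simp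
    have ab: "\<beta> = \<alpha> / l" "a = l" "b = l" using False by (simp_all add: \<beta> a b)
    have \<beta>0: "0 < \<beta>" "\<beta> \<le> 1 / 4" using g l1 by (auto simp: ab field_simps)
    have ib: "1 / \<beta> = l / \<alpha>" by (simp add: ab)
    have "l \<le> \<alpha> * threshold" using False ph by (simp add: round_phase_def)
    then have b1: "1 / \<beta> \<le> threshold" unfolding ib using g by (simp add: divide_le_eq mult.commute)
    have b2: "1 / \<beta> \<le> max 4 (2 * (R / r0))"
    proof (cases "l = 1")
      case True
      then show ?thesis using ph by (simp add: ib round_phase_def)
    next
      case False
      then have "l \<le> \<alpha> * (2 * (R / r0))" using far[OF ph] l1 by linarith
      then have "l / \<alpha> \<le> 2 * (R / r0)" using g by (simp add: divide_le_eq mult.commute)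
      then show ?thesis unfolding ib by linarith
    qed
    have ph': "round_phase M' c' \<beta> H"
      using ph b1 b2 by (simp add: round_phase_def M' c' ab)
    have adm: "admissible \<alpha> l \<beta> a b" unfolding ab using l1 by (rule admissible_ball)
    have "update d M M' c c' (($) (zs ! t)) u l a b"
      using u len M' c' ab l1 by unfold_locales auto
    then interpret admissible_update d M M' c c' "($) (zs ! t)" u l a b \<alpha> \<beta>
      using adm by (simp add: admissible_update_def)
    have 1: "gauge d M' c' (($) (zs ! i)) \<le> 1" if "i < Suc t" for i
      using that g gauge_new gauge_mono by (cases "i = t") auto
    have 2: "vec d x \<in> Z" if "gauge d M' c' x \<le> \<beta>\<^sup>2" for x
      using g by (intro inner_step[OF _ conv_convex z that]) auto
    have "dt M' \<noteq> 0" using \<beta>0 r0 by (simp add: round_det[OF ph'])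
    then have "good (Suc t) M' c' \<beta>"
      using 1 2 \<beta>0 round_potential[OF ph' \<beta>0] by (simp add: good_def)
    then show ?thesis using False ph' by (simp add: rounding_inv_def)
  qed
qed

lemma det_inverse_le:
  assumes good: "good t M c \<alpha>"
  shows "1 / \<bar>dt M\<bar> \<le> (real d * (R / \<alpha>)) ^ d"
proof -
  note g = good[unfolded good_def]
  let ?M = "mat d d (\<lambda>(i, j). M i j)"
  define N where "N = (1 / dt M) \<cdot>\<^sub>m adj_mat ?M"
  have N: "N \<in> carrier_mat d d" using adj_mat(1)[of ?M d] by (simp add: N_def)
  have MN: "?M * N = 1\<^sub>m d"
    unfolding N_def using adj_mat(1,2)[of ?M d] g
    by (subst mult_smult_distrib[of _ d d _ d]) (auto intro!: eq_matI)
  have "\<bar>N $$ (i, j)\<bar> \<le> R / \<alpha>" if ij: "i < d" "j < d" for i j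
  proof -
    have col: "mv d M (\<lambda>k. N $$ (k, j)) k = (if k = j then 1 else 0)" if "k < d" for k
    proof -
      have "(?M * N) $$ (k, j) = mv d M (\<lambda>k. N $$ (k, j)) k"
        using that ij N by (simp add: scalar_prod_def mv_def lessThan_atLeast0)
      then show ?thesis unfolding MN using that ij by simp
    qed
    have in_Z: "vec d (\<lambda>k. c k + s * N $$ (k, j)) \<in> Z" if "s\<^sup>2 = \<alpha>\<^sup>2" for s
    proof -
      have "gauge d M c (\<lambda>k. c k + s * N $$ (k, j)) = ip d (\<lambda>k. if k = j then s else 0) (\<lambda>k. if k = j then s else 0)"
        unfolding gauge_def
      proof (rule ip_cong)
        have "mv d M (\<lambda>k. c k + s * N $$ (k, j) - c k) k = s * mv d M (\<lambda>k. N $$ (k, j)) k" for k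
          by (simp add: mv_def sum_distrib_left ac_simps)
        then show "mv d M (\<lambda>k. c k + s * N $$ (k, j) - c k) k = (if k = j then s else 0)"
          "mv d M (\<lambda>k. c k + s * N $$ (k, j) - c k) k = (if k = j then s else 0)" if "k < d" for k
          using col that by simp_all
      qed
      also have "\<dots> = s\<^sup>2"
        using ij by (simp add: ip_def sum.remove[of "{..<d}" j] power2_eq_square)
      finally show ?thesis using g that by simp
    qed
    have "ip d (\<lambda>k. (c k + \<alpha> * N $$ (k, j)) - (c k + (- \<alpha>) * N $$ (k, j)))
        (\<lambda>k. (c k + \<alpha> * N $$ (k, j)) - (c k + (- \<alpha>) * N $$ (k, j))) \<le> (2 * R)\<^sup>2"
      by (intro distance_le in_Z) auto
    moreover have "(2 * \<alpha> * N $$ (i, j))\<^sup>2 \<le> ip d (\<lambda>k. (c k + \<alpha> * N $$ (k, j)) - (c k + (- \<alpha>) * N $$ (k, j)))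
        (\<lambda>k. (c k + \<alpha> * N $$ (k, j)) - (c k + (- \<alpha>) * N $$ (k, j)))"
    proof -
      have "(2 * \<alpha> * N $$ (i, j))\<^sup>2 \<le> (\<Sum>k<d. (2 * \<alpha> * N $$ (k, j))\<^sup>2)"
        using ij by (intro member_le_sum[of i "{..<d}" "\<lambda>k. (2 * \<alpha> * N $$ (k, j))\<^sup>2"]) auto
      then show ?thesis by (simp add: ip_def power2_eq_square)
    qed
    ultimately have "(2 * \<alpha> * N $$ (i, j))\<^sup>2 \<le> (2 * R)\<^sup>2" by linarith
    then have "\<bar>2 * \<alpha> * N $$ (i, j)\<bar> \<le> \<bar>2 * R\<bar>" by (simp add: abs_le_square_iff)
    then have "\<alpha> * \<bar>N $$ (i, j)\<bar> \<le> R" using g R_pos by (simp add: abs_mult)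
    then show ?thesis using g by (simp add: le_divide_eq mult.commute)
  qed
  then have "\<bar>det N\<bar> \<le> (real d * (R / \<alpha>)) ^ d" using N by (intro det_le_entries) auto
  moreover have "dt M * det N = 1"
    using det_mult[of ?M d N] N MN by simp
  then have "det N = 1 / dt M" using g by (simp add: field_simps)
  ultimately show ?thesis by simp
qed

lemma inv_ratio:
  assumes inv: "rounding_inv t M c \<alpha> H"
  shows "1 / \<alpha> \<le> 264 * max 1 (min (R / r0) (real d * ln (R / r0)))"
proof (cases "round_phase M c \<alpha> H")
  case True
  then show ?thesis
    using R_ge r0 by (intro ratio_bound_ball[OF d]) (auto simp: round_phase_def threshold_def)
next
  case False
  note g = inv[unfolded rounding_inv_def good_def]
  have ph: "threshold \<le> 2 * (R / r0)" using inv False by (simp add: rounding_inv_def ellipsoid_phase_def)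
  have "ln (1 / \<bar>dt M\<bar>) \<le> ln ((real d * (R / \<alpha>)) ^ d)"
    using inv det_inverse_le g by (intro ln_mono) (auto simp: rounding_inv_def)
  also have "\<dots> = real d * (ln (real d) + (ln R - ln \<alpha>))"
    using d g R_pos by (simp add: ln_realpow ln_mult ln_div)
  finally have "- ln \<bar>dt M\<bar> \<le> real d * (ln (real d) + (ln R - ln \<alpha>))"
    using g by (simp add: ln_div)
  then have "1 / \<alpha> \<le> threshold - 4 * real d * ln r0 + 4 * (real d * (ln (real d) + (ln R - ln \<alpha>)))"
    using g by linarith
  also have "\<dots> = 4 + real d * harm d + 4 * real d * (ln (R / r0) + ln (real d) + ln (1 / \<alpha>))"
    using R_pos r0 g by (simp add: threshold_def ln_div algebra_simps)
  finally have "1 / \<alpha> \<le> \<dots>" .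
  then show ?thesis
    using g ph by (intro ratio_bound_ellipsoid[OF d]) (auto simp: threshold_def le_divide_eq)
qed

definition mem_inv :: "nat \<Rightarrow> memory \<Rightarrow> bool" where
  "mem_inv t f \<longleftrightarrow> rounding_inv t (f OutMatrix) (\<lambda>i. f OutCenter i 0) (f OutAlpha 0 0) (f (Work 4) 0 0)"

lemma init_run:
  "\<exists>s T. stream_run init_prog step_prog d c0 r0 [] s T \<and> fst s Dim = d \<and> dom (snd s) \<subseteq> cells d
    \<and> mem_inv 0 (mem (snd s)) \<and> T \<le> d + 1 + 500 * d * d"
proof -
  obtain \<rho> m where s: "start_state d c0 r0 = (\<rho>, m)" by (cases "start_state d c0 r0")
  have \<rho>: "\<rho> Dim = d" and m: "m = (\<lambda>(a, i, j). if a = Center0 \<and> i < d \<and> j = 0 then Some (c0 $ i)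
                   else if a = Radius0 \<and> i = 0 \<and> j = 0 then Some r0 else None)"
    using s by (auto simp: start_state_def)
  have d0: "0 < d" using d by simp
  have dom: "dom m \<subseteq> cells d"
    using d0 by (auto simp: m cells_def in_arrays split: if_splits)
  obtain g where run: "runs d 2 init_prog \<rho> (mem m) g (500 * d * d)"
    and g: "\<And>i j. i < d \<Longrightarrow> j < d \<Longrightarrow> g OutMatrix i j = (if i = j then 1 / (4 * r0) else 0)"
      "\<And>i. i < d \<Longrightarrow> g OutCenter i 0 = c0 $ i" "g OutAlpha 0 0 = 1 / 4" "g (Work 4) 0 0 = threshold"
    using init_prog_runs[where \<rho> = \<rho> and d = d and f = "mem m", OF \<rho> d0] by (auto simp: mem_def m threshold_def)
  then obtain t \<rho>' m' where e: "exec init_prog (\<rho>, m) t (\<rho>', m')" "t \<le> 500 * d * d" "agree 2 \<rho> \<rho>'"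
      "mem m' = g" "dom m' \<subseteq> cells d"
    using dom unfolding runs_def by blast
  have "mem_inv 0 g" unfolding mem_inv_def g(3,4) by (rule inv_init) (simp_all add: g)
  then show ?thesis
    using stream_init[of init_prog d c0 r0 t "(\<rho>', m')" step_prog] e s agree_Dim[OF e(3)] \<rho>
    by (intro exI[of _ "(\<rho>', m')"] exI[of _ "d + 1 + t"]) auto
qed

lemma step_run:
  assumes run: "stream_run init_prog step_prog d c0 r0 (take t zs) s T" and t: "t < length zs"
    and s: "fst s Dim = d" "dom (snd s) \<subseteq> cells d" "mem_inv t (mem (snd s))"
  shows "\<exists>s' T'. stream_run init_prog step_prog d c0 r0 (take (Suc t) zs) s' T' \<and> fst s' Dim = d
    \<and> dom (snd s') \<subseteq> cells d \<and> mem_inv (Suc t) (mem (snd s')) \<and> T' \<le> T + (d + 1500 * d * d)"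
proof -
  obtain \<rho> m where r: "receive d (zs ! t) s = (\<rho>, m)" by (cases "receive d (zs ! t) s")
  have d0: "0 < d" using d by simp
  have \<rho>: "\<rho> Dim = d" using r s by (auto simp: receive_def split: prod.splits)
  have m: "m = (\<lambda>(a, i, j). if a = Point \<and> i < d \<and> j = 0 then Some ((zs ! t) $ i) else snd s (a, i, j))"
    using r by (auto simp: receive_def split: prod.splits)
  have dom: "dom m \<subseteq> cells d"
  proof
    fix x assume "x \<in> dom m"
    then have "x \<in> dom (snd s) \<or> (\<exists>i<d. x = (Point, i, 0))"
      by (cases x) (auto simp: m split: if_splits)
    then show "x \<in> cells d" using s(2) d0 by (auto simp: cells_def in_arrays)
  qed
  let ?f = "mem m" and ?M = "mem (snd s) OutMatrix" and ?c = "\<lambda>i. mem (snd s) OutCenter i 0"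
  have f: "?f OutMatrix = ?M" "?f OutCenter = mem (snd s) OutCenter" "?f OutAlpha = mem (snd s) OutAlpha"
      "?f (Work 4) = mem (snd s) (Work 4)"
      and fp: "\<And>i. i < d \<Longrightarrow> ?f Point i 0 = (zs ! t) $ i"
    by (auto simp: mem_def m fun_eq_iff)
  define u where "u = mv d ?M (\<lambda>j. (zs ! t) $ j - ?c j)"
  define l where "l = max 1 (sqrt (ip d u u))"
  define \<alpha> H where "\<alpha> = mem (snd s) OutAlpha 0 0" and "H = mem (snd s) (Work 4) 0 0"
  define \<beta> a b where "\<beta> = (if \<alpha> * H < l then shrink \<alpha> l else \<alpha> / l)"
    and "a = (if \<alpha> * H < l then long_axis \<alpha> l else l)"
    and "b = (if \<alpha> * H < l then short_axis \<alpha> l else l)"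
  have u': "u = mv d (?f OutMatrix) (\<lambda>j. ?f Point j 0 - ?f OutCenter j 0)"
    unfolding u_def f by (intro ext mv_cong) (simp_all add: fp)
  have \<alpha>H: "\<alpha> = ?f OutAlpha 0 0" "H = ?f (Work 4) 0 0" by (simp_all add: f \<alpha>_def H_def)
  obtain g where runs: "runs d 2 step_prog \<rho> ?f g (1500 * d * d)"
    and M': "\<And>i j. i < d \<Longrightarrow> j < d \<Longrightarrow> g OutMatrix i j = ?M i j / b
        + (1 / a - 1 / b) / (l * l) * u i * (\<Sum>k<d. u k * ?M k j)"
    and c': "\<And>i. i < d \<Longrightarrow> g OutCenter i 0 = ?c i + (l - a) / l * ((zs ! t) $ i - ?c i)"
    and g: "g OutAlpha 0 0 = \<beta>" "g (Work 4) 0 0 = (if \<alpha> * H < l then 0 else H)"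
    using step_prog_runs[where \<rho> = \<rho> and d = d and f = ?f and u = u, OF \<rho> d0 u' l_def \<alpha>H \<beta>_def a_def b_def] unfolding f by (auto simp: fp)
  then obtain t' \<rho>' m' where e: "exec step_prog (\<rho>, m) t' (\<rho>', m')" "t' \<le> 1500 * d * d" "agree 2 \<rho> \<rho>'"
      "mem m' = g" "dom m' \<subseteq> cells d"
    using dom unfolding runs_def by blast
  have "rounding_inv t ?M ?c \<alpha> H" using s(3) by (simp add: mem_inv_def \<alpha>_def H_def)
  from inv_step[OF this t u_def l_def \<beta>_def a_def b_def M' c']
  have "mem_inv (Suc t) g" by (simp add: mem_inv_def g)
  moreover have "stream_run init_prog step_prog d c0 r0 (take (Suc t) zs) (\<rho>', m') (T + d + t')"
    using stream_step[OF run, of "zs ! t" t' "(\<rho>', m')"] e(1) r t by (simp add: take_Suc_conv_app_nth)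
  ultimately show ?thesis
    using e agree_Dim[OF e(3)] \<rho> by (intro exI[of _ "(\<rho>', m')"] exI[of _ "T + d + t'"]) auto
qed

lemma runs_exist:
  "t \<le> length zs \<Longrightarrow> \<exists>s T. stream_run init_prog step_prog d c0 r0 (take t zs) s T \<and> fst s Dim = d
    \<and> dom (snd s) \<subseteq> cells d \<and> mem_inv t (mem (snd s))
    \<and> T \<le> d + 1 + 500 * d * d + t * (d + 1500 * d * d)"
proof (induction t)
  case 0
  then show ?case using init_run by simp
next
  case (Suc t)
  then obtain s T where s: "stream_run init_prog step_prog d c0 r0 (take t zs) s T" "fst s Dim = d"
      "dom (snd s) \<subseteq> cells d" "mem_inv t (mem (snd s))"
      "T \<le> d + 1 + 500 * d * d + t * (d + 1500 * d * d)"
    by auto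
  have "t < length zs" using Suc by simp
  from step_run[OF s(1) this s(2-4)] s(5) show ?case by fastforce
qed

lemma zs_nonempty: "1 \<le> length zs"
  using center_in_Z by (cases zs) (auto simp: conv_def)

lemma out_eq:
  "out_matrix d s = mat d d (\<lambda>(i, j). mem (snd s) OutMatrix i j)"
  "out_center d s = vec d (\<lambda>i. mem (snd s) OutCenter i 0)"
  "out_alpha s = mem (snd s) OutAlpha 0 0"
  by (simp_all add: out_matrix_def out_center_def out_alpha_def load_mem)

lemma outputs:
  assumes inv: "mem_inv t (mem (snd s))" and t: "t \<le> length zs"
  shows "invertible_mat (out_matrix d s)" "0 < out_alpha s" "out_alpha s \<le> 1"
    "conv d (take t zs) \<subseteq> translate (out_center d s) (out_ellipsoid d s)"
    "translate (out_center d s) (dilate (out_alpha s) (out_ellipsoid d s)) \<subseteq> Z"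
    "1 / out_alpha s \<le> 264 * max 1 (min (R / r0) (real d * ln (R / r0)))"
proof -
  define M where "M = mem (snd s) OutMatrix"
  define c where "c = (\<lambda>i. mem (snd s) OutCenter i 0)"
  define \<alpha> where "\<alpha> = mem (snd s) OutAlpha 0 0"
  have out: "out_matrix d s = mat d d (\<lambda>(i, j). M i j)" "out_center d s = vec d c" "out_alpha s = \<alpha>"
    by (simp_all add: out_eq M_def c_def \<alpha>_def)
  have rounding_inv': "rounding_inv t M c \<alpha> (mem (snd s) (Work 4) 0 0)"
    using inv by (simp add: mem_inv_def M_def c_def \<alpha>_def)
  note g = rounding_inv'[unfolded rounding_inv_def good_def]
  let ?M = "mat d d (\<lambda>(i, j). M i j)"
  have A: "adj_mat ?M \<in> carrier_mat d d" "?M * adj_mat ?M = dt M \<cdot>\<^sub>m 1\<^sub>m d" "adj_mat ?M * ?M = dt M \<cdot>\<^sub>m 1\<^sub>m d"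
    using adj_mat[of ?M d] by auto
  have "?M * ((1 / dt M) \<cdot>\<^sub>m adj_mat ?M) = 1\<^sub>m d"
    using A g by (subst mult_smult_distrib[of _ d d _ d]) (auto intro!: eq_matI)
  moreover have "((1 / dt M) \<cdot>\<^sub>m adj_mat ?M) * ?M = 1\<^sub>m d"
    using A g by (subst mult_smult_assoc_mat[of _ d d _ d]) (auto intro!: eq_matI)
  ultimately show "invertible_mat (out_matrix d s)"
    using A(1) unfolding invertible_mat_def inverts_mat_def out
    by (intro conjI exI[of _ "(1 / dt M) \<cdot>\<^sub>m adj_mat ?M"]) auto
  show "0 < out_alpha s" "out_alpha s \<le> 1" using g by (simp_all add: out)
  show "conv d (take t zs) \<subseteq> translate (out_center d s) (out_ellipsoid d s)"
    unfolding out_ellipsoid_def out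
  proof
    fix p assume p: "p \<in> conv d (take t zs)"
    then have "gauge d M c (($) p) \<le> 1" by (rule gauge_conv_le) (use g in simp)
    moreover have "p \<in> carrier_vec d" using p by (auto simp: conv_def)
    ultimately show "p \<in> translate (vec d c) (ellipsoid d ?M)" by (intro mem_translate_ellipsoid)
  qed
  show "translate (out_center d s) (dilate (out_alpha s) (out_ellipsoid d s)) \<subseteq> Z"
    unfolding out_ellipsoid_def out
  proof
    fix p assume "p \<in> translate (vec d c) (dilate \<alpha> (ellipsoid d ?M))"
    note p = mem_translate_dilate_ellipsoid[OF this]
    have "vec d (($) p) = p" using p(1) by (intro eq_vecI) auto
    then show "p \<in> Z" using p(2) g by metis
  qed
  show "1 / out_alpha s \<le> 264 * max 1 (min (R / r0) (real d * ln (R / r0)))"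
    unfolding out using inv_ratio[OF rounding_inv'] .
qed

lemma total_time_le:
  assumes T: "T \<le> d + 1 + 500 * d * d + length zs * (d + 1500 * d * d)"
  shows "real T \<le> 2003 * (real (length zs) * real d ^ 2)"
proof -
  let ?n = "length zs"
  have dd: "d \<le> d * d" "1 \<le> d * d" using d by auto
  have "T \<le> 1 * (502 * (d * d)) + ?n * (1501 * (d * d))"
  proof (rule order.trans[OF T], rule add_mono)
    show "?n * (d + 1500 * d * d) \<le> ?n * (1501 * (d * d))" using dd by (intro mult_left_mono) auto
    show "d + 1 + 500 * d * d \<le> 1 * (502 * (d * d))" using dd by (simp only: mult.assoc)
  qed
  also have "\<dots> \<le> ?n * (502 * (d * d)) + ?n * (1501 * (d * d))"
    using zs_nonempty by (intro add_right_mono mult_right_mono) auto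
  finally have "T \<le> 2003 * (?n * (d * d))" by (simp add: algebra_simps)
  then have "real T \<le> real (2003 * (?n * (d * d)))" by (simp only: of_nat_le_iff)
  then show ?thesis by (simp add: power2_eq_square)
qed

end

theorem theorem1:
  "\<exists>(P :: com) (Q :: com) (C_apx :: real) (C_time :: real) (k :: nat) (C_space :: real).
     \<forall>(d :: nat) (zs :: real vec list) (c0 :: real vec) (r0 :: real).
       1 \<le> d \<and> set zs \<subseteq> carrier_vec d \<and> c0 \<in> carrier_vec d \<and> 0 < r0 \<and>
       translate c0 (dilate r0 (unit_ball d)) \<subseteq> conv d zs \<longrightarrow>
       (\<exists>(s :: nat \<Rightarrow> state) (T :: nat \<Rightarrow> nat).
          let n = length zs; Z = conv d zs; R = circumradius d Z in
          (\<forall>t\<le>n. stream_run P Q d c0 r0 (take t zs) (s t) (T t)) \<and>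
          (\<forall>t\<in>{1..n}.
             invertible_mat (out_matrix d (s t)) \<and>
             0 < out_alpha (s t) \<and> out_alpha (s t) \<le> 1 \<and>
             conv d (take t zs) \<subseteq> translate (out_center d (s t)) (out_ellipsoid d (s t))) \<and>
          translate (out_center d (s n)) (dilate (out_alpha (s n)) (out_ellipsoid d (s n))) \<subseteq> Z \<and>
          Z \<subseteq> translate (out_center d (s n)) (out_ellipsoid d (s n)) \<and>
          1 / out_alpha (s n) \<le> C_apx * max 1 (min (R / r0) (real d * ln (R / r0))) \<and>
          real (T n) \<le> C_time * (real n * real d ^ 2) * (1 + ln (real n * real d ^ 2)) ^ k \<and>
          (\<forall>t\<le>n. real (storage (s t)) \<le> C_space * real d ^ 2))"
proof (rule exI[of _ init_prog], rule exI[of _ step_prog], rule exI[of _ 264], rule exI[of _ 2003],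
    rule exI[of _ 0], rule exI[of _ 18], intro allI impI)
  fix d :: nat and zs :: "real vec list" and c0 :: "real vec" and r0 :: real
  assume "1 \<le> d \<and> set zs \<subseteq> carrier_vec d \<and> c0 \<in> carrier_vec d \<and> 0 < r0 \<and>
    translate c0 (dilate r0 (unit_ball d)) \<subseteq> conv d zs"
  then interpret rounding d zs c0 r0 by unfold_locales auto
  let ?n = "length zs"
  define good_run where "good_run t s T \<longleftrightarrow> stream_run init_prog step_prog d c0 r0 (take t zs) s T
    \<and> dom (snd s) \<subseteq> cells d \<and> mem_inv t (mem (snd s))
    \<and> T \<le> d + 1 + 500 * d * d + t * (d + 1500 * d * d)" for t s T
  have "\<forall>t. \<exists>s T. t \<le> ?n \<longrightarrow> good_run t s T" using runs_exist unfolding good_run_def by blast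
  then obtain s T where run: "\<And>t. t \<le> ?n \<Longrightarrow> good_run t (s t) (T t)" by metis
  have out: "mem_inv t (mem (snd (s t)))" if "t \<le> ?n" for t
    using run[OF that] by (simp add: good_run_def)
  have storage: "real (storage (s t)) \<le> 18 * real d ^ 2" if "t \<le> ?n" for t
  proof -
    have "storage (s t) \<le> 18 * (d * d)" using run[OF that] by (intro storage_le) (simp add: good_run_def)
    then have "real (storage (s t)) \<le> real (18 * (d * d))" by (simp only: of_nat_le_iff)
    then show ?thesis by (simp add: power2_eq_square)
  qed
  have time: "real (T ?n) \<le> 2003 * (real ?n * real d ^ 2) * (1 + ln (real ?n * real d ^ 2)) ^ 0"
    using run[OF order.refl] total_time_le[of "T ?n"] by (simp add: good_run_def)
  show "\<exists>(s :: nat \<Rightarrow> state) (T :: nat \<Rightarrow> nat).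
    let n = length zs; Z = conv d zs; R = circumradius d Z in
      (\<forall>t\<le>n. stream_run init_prog step_prog d c0 r0 (take t zs) (s t) (T t)) \<and>
      (\<forall>t\<in>{1..n}.
         invertible_mat (out_matrix d (s t)) \<and>
         0 < out_alpha (s t) \<and> out_alpha (s t) \<le> 1 \<and>
         conv d (take t zs) \<subseteq> translate (out_center d (s t)) (out_ellipsoid d (s t))) \<and>
      translate (out_center d (s n)) (dilate (out_alpha (s n)) (out_ellipsoid d (s n))) \<subseteq> Z \<and>
      Z \<subseteq> translate (out_center d (s n)) (out_ellipsoid d (s n)) \<and>
      1 / out_alpha (s n) \<le> 264 * max 1 (min (R / r0) (real d * ln (R / r0))) \<and>
      real (T n) \<le> 2003 * (real n * real d ^ 2) * (1 + ln (real n * real d ^ 2)) ^ 0 \<and>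
      (\<forall>t\<le>n. real (storage (s t)) \<le> 18 * real d ^ 2)"
    unfolding Let_def
  proof (intro exI[of _ s] exI[of _ T] conjI allI ballI impI)
    show "stream_run init_prog step_prog d c0 r0 (take t zs) (s t) (T t)" if "t \<le> ?n" for t
      using run[OF that] by (simp add: good_run_def)
    show "conv d zs \<subseteq> translate (out_center d (s ?n)) (out_ellipsoid d (s ?n))"
      using outputs(4)[OF out order.refl] by simp
    show "invertible_mat (out_matrix d (s t))" "0 < out_alpha (s t)" "out_alpha (s t) \<le> 1"
      "conv d (take t zs) \<subseteq> translate (out_center d (s t)) (out_ellipsoid d (s t))"
      if "t \<in> {1..?n}" for t
      using outputs(1-4)[OF out, of t] that by simp_all
  qed (use outputs(5,6)[OF out[OF order.refl]] time storage in simp_all)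
qed

end
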